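(* Let $S=k[x_1,\ldots,x_n]$ be a polynomial ring over a field $k$. Let $I\subset S$ be a componentwise lexsegment ideal and $d\geq 1$ the lowest degree of the minimal monomial generators of $I$. Let $u,v\in\mathrm{Mon}_d(S)$, $x_1\mid u$, be such that $I_{\langle d\rangle}=(\mathcal L(u,v))$. The following conditions are equivalent: (a) $I$ is a componentwise linear ideal. (b) $I_{\langle d\rangle}$ has a linear resolution. (c) $I_{\langle d\rangle}$ has linear quotients. (d) $I$ has componentwise linear quotients.
   Context: $\mathrm{Mon}_d(S)$ is the set of monomials of degree $d$ of $S$; monomials are ordered by the lexicographic order with $x_1>\cdots>x_n$. For $u\geq_{lex}v$ in $\mathrm{Mon}_d(S)$, $\mathcal L(u,v)=\{w\in\mathrm{Mon}_d(S): u\geq_{lex}w\geq_{lex}v\}$. For a monomial ideal $I$, $I_j$ is its degree $j$ component and $I_{\langle j\rangle}$ is the ideal generated by all monomials of degree $j$ belonging to $I$. A monomial ideal $I$ with $d$ the least degree of its minimal monomial generators is componentwise lexsegment if there are $u,v\in\mathrm{Mon}_d(S)$ such that for all $j\geq d$ the component $I_j$ is spanned, as a $k$-vector space, by the lexsegment set $\mathcal L(x_1^{j-d}u,\,x_n^{j-d}v)$ (of degree $j$). A monomial ideal has linear quotients if its minimal monomial generators can be ordered $u_1,\ldots,u_s$ so that for all $2\le i\le s$ the colon ideal $(u_1,\ldots,u_{i-1}):u_i$ is generated by variables. $I$ is componentwise linear (respectively, has componentwise linear quotients) if for all $j$ the ideal $I_{\langle j\rangle}$ has a linear resolution (respectively,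 linear quotients). *)

theory Defs
  imports "HOL-Library.Poly_Mapping" "Jordan_Normal_Form.Matrix_Kernel"
begin

text \<open>
  The polynomial ring \<open>S = k[x\<^sub>1,\<dots>,x\<^sub>n]\<close> is the type \<open>('n, 'k) poly_ring\<close>: the variables are indexed
  by a finite linearly ordered type \<open>'n\<close> with \<open>n = CARD('n)\<close> elements, where \<open>x\<^sub>1\<close> belongs to the least
  and \<open>x\<^sub>n\<close> to the greatest index. Monomials are represented by exponent vectors, with
  multiplication written additively.
\<close>

type_synonym 'n monomial = "'n \<Rightarrow>\<^sub>0 nat"
type_synonym ('n, 'k) poly_ring = "'n monomial \<Rightarrow>\<^sub>0 'k"

definition mon :: "'n monomial \<Rightarrow> ('n, 'k::field) poly_ring" where
  "mon m = Poly_Mapping.single m 1"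

definition var :: "'n \<Rightarrow> ('n, 'k::field) poly_ring" where
  "var i = mon (Poly_Mapping.single i 1)"

definition first_var :: "'n::{finite,linorder}" where
  "first_var = Min UNIV"

definition last_var :: "'n::{finite,linorder}" where
  "last_var = Max UNIV"

definition mdeg :: "'n::finite monomial \<Rightarrow> nat" where
  "mdeg m = (\<Sum>i\<in>UNIV. Poly_Mapping.lookup m i)"

definition Mon :: "nat \<Rightarrow> 'n::finite monomial set" where
  "Mon d = {m. mdeg m = d}"

text \<open>
  The library's order on \<open>'n \<Rightarrow>\<^sub>0 nat\<close> is the lexicographic order with \<open>x\<^sub>1 > \<dots> > x\<^sub>n\<close>:
\<close>

lemma less_monomial_iff:
  fixes w u :: "'n::{finite,linorder} monomial"
  shows "w < u \<longleftrightarrow> (\<exists>i. Poly_Mapping.lookup w i < Poly_Mapping.lookup u i \<and>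
           (\<forall>j<i. Poly_Mapping.lookup w j = Poly_Mapping.lookup u j))"
  by transfer (simp add: less_fun_def)

definition lexseg :: "'n::{finite,linorder} monomial \<Rightarrow> 'n monomial \<Rightarrow> 'n monomial set" where
  "lexseg u v = {w \<in> Mon (mdeg u). v \<le> w \<and> w \<le> u}"


text \<open>Ideals of a commutative ring are the submodules of the ring as a module over itself.\<close>

global_interpretation ring_module: Modules.module "(*) :: 'a::comm_ring_1 \<Rightarrow> 'a \<Rightarrow> 'a"
  defines ideal_gen = ring_module.span
  by unfold_locales (simp_all add: algebra_simps)

definition scalar :: "'k::field \<Rightarrow> ('n, 'k) poly_ring \<Rightarrow> ('n, 'k) poly_ring" where
  "scalar c p = Poly_Mapping.single 0 c * p"

global_interpretation poly_space: Vector_Spaces.vector_space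
    "scalar :: 'k::field \<Rightarrow> ('n, 'k) poly_ring \<Rightarrow> ('n, 'k) poly_ring"
  defines lin_span = poly_space.span
proof unfold_locales
  fix a b :: 'k and x y :: "('n, 'k) poly_ring"
  show "scalar a (x + y) = scalar a x + scalar a y"
    by (simp add: scalar_def algebra_simps)
  show "scalar (a + b) x = scalar a x + scalar b x"
    by (simp add: scalar_def single_add algebra_simps)
  show "scalar a (scalar b x) = scalar (a * b) x"
    by (simp add: scalar_def mult.assoc[symmetric] mult_single)
  show "scalar 1 x = x"
    by (simp add: scalar_def)
qed

definition monomial_ideal :: "('n, 'k::field) poly_ring set \<Rightarrow> bool" where
  "monomial_ideal I \<longleftrightarrow> (\<exists>A. I = ideal_gen (mon ` A))"

definition homogeneous :: "nat \<Rightarrow> ('n::finite, 'k::field) poly_ring \<Rightarrow> bool" where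
  "homogeneous j f \<longleftrightarrow> Poly_Mapping.keys f \<subseteq> Mon j"

text \<open>\<open>I\<^sub>j\<close>\<close>
definition component :: "('n::finite, 'k::field) poly_ring set \<Rightarrow> nat \<Rightarrow> ('n, 'k) poly_ring set" where
  "component I j = {f \<in> I. homogeneous j f}"

text \<open>\<open>I\<^sub>\<langle>\<^sub>j\<^sub>\<rangle>\<close>\<close>
definition component_ideal ::
    "('n::finite, 'k::field) poly_ring set \<Rightarrow> nat \<Rightarrow> ('n, 'k) poly_ring set" where
  "component_ideal I j = ideal_gen (mon ` {m \<in> Mon j. mon m \<in> I})"

definition min_gens :: "('n, 'k::field) poly_ring set \<Rightarrow> 'n monomial set" where
  "min_gens I = {m. mon m \<in> I \<and>
     (\<forall>m'. mon m' \<in> I \<and> mon m' dvd (mon m :: ('n, 'k) poly_ring) \<longrightarrow> m' = m)}"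

text \<open>This holds for no \<open>d\<close> if \<open>I\<close> is the zero ideal.\<close>
definition lowest_gen_degree :: "('n::finite, 'k::field) poly_ring set \<Rightarrow> nat \<Rightarrow> bool" where
  "lowest_gen_degree I d \<longleftrightarrow>
     (\<exists>m\<in>min_gens I. mdeg m = d) \<and> (\<forall>m\<in>min_gens I. d \<le> mdeg m)"

definition componentwise_lexsegment ::
    "('n::{finite,linorder}, 'k::field) poly_ring set \<Rightarrow> bool" where
  "componentwise_lexsegment I \<longleftrightarrow> monomial_ideal I \<and>
     (\<exists>d. lowest_gen_degree I d \<and>
       (\<exists>u\<in>Mon d. \<exists>v\<in>Mon d. \<forall>j\<ge>d.
          component I j = lin_span (mon ` lexseg (Poly_Mapping.single first_var (j - d) + u)
                                                 (Poly_Mapping.single last_var (j - d) + v))))"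


definition colon :: "'a::comm_ring_1 set \<Rightarrow> 'a \<Rightarrow> 'a set" where
  "colon I f = {g. g * f \<in> I}"

definition has_linear_quotients :: "('n, 'k::field) poly_ring set \<Rightarrow> bool" where
  "has_linear_quotients I \<longleftrightarrow>
     (\<exists>us. distinct us \<and> set us = min_gens I \<and>
        (\<forall>i. 1 \<le> i \<and> i < length us \<longrightarrow>
           (\<exists>V. colon (ideal_gen (mon ` set (take i us))) (mon (us ! i)) =
                (ideal_gen (var ` V) :: ('n, 'k) poly_ring set))))"


text \<open>
  A minimal graded free resolution \<open>\<cdots> \<rightarrow> F\<^sub>1 \<rightarrow> F\<^sub>0 \<rightarrow> I \<rightarrow> 0\<close>. The list \<open>s i\<close> contains the degrees of the
  basis elements of \<open>F\<^sub>i = \<Oplus>\<^sub>a S(-s\<^sub>i\<^sub>a)\<close>; \<open>M 0\<close> (a single row) is the matrix of \<open>F\<^sub>0 \<rightarrow> S\<close> and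
  \<open>M (i + 1)\<close> is the matrix of \<open>F\<^sub>i\<^sub>+\<^sub>1 \<rightarrow> F\<^sub>i\<close>. All maps preserve degrees, so an entry in the column of a
  basis element of degree \<open>e\<close> and in the row of one of degree \<open>c\<close> is homogeneous of degree \<open>e - c\<close>
  (zero if \<open>e < c\<close>). Minimality means that the maps \<open>F\<^sub>i\<^sub>+\<^sub>1 \<rightarrow> F\<^sub>i\<close> have entries in the graded maximal
  ideal \<open>(x\<^sub>1,\<dots>,x\<^sub>n)\<close>. Finite length need not be required: minimal resolutions of ideals of \<open>S\<close> are
  finite by Hilbert's syzygy theorem.
\<close>

definition graded_matrix ::
    "nat list \<Rightarrow> nat list \<Rightarrow> ('n::finite, 'k::field) poly_ring mat \<Rightarrow> bool" where
  "graded_matrix c e A \<longleftrightarrow> A \<in> carrier_mat (length c) (length e) \<and>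
     (\<forall>a<length c. \<forall>b<length e. \<forall>m\<in>Poly_Mapping.keys (A $$ (a, b)). mdeg m + c ! a = e ! b)"

definition minimal_graded_free_resolution ::
    "(nat \<Rightarrow> nat list) \<Rightarrow> (nat \<Rightarrow> ('n::finite, 'k::field) poly_ring mat) \<Rightarrow>
     ('n, 'k) poly_ring set \<Rightarrow> bool" where
  "minimal_graded_free_resolution s M I \<longleftrightarrow>
     graded_matrix [0] (s 0) (M 0) \<and>
     (\<forall>i. graded_matrix (s i) (s (Suc i)) (M (Suc i))) \<and>
     {(M 0 *\<^sub>v f) $ 0 | f. f \<in> carrier_vec (length (s 0))} = I \<and>
     (\<forall>i. mat_kernel (M i) = {M (Suc i) *\<^sub>v f | f. f \<in> carrier_vec (length (s (Suc i)))}) \<and>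
     (\<forall>i. elements_mat (M (Suc i)) \<subseteq> ideal_gen (range var))"

definition has_linear_resolution :: "('n::finite, 'k::field) poly_ring set \<Rightarrow> bool" where
  "has_linear_resolution I \<longleftrightarrow>
     (\<exists>d s M. minimal_graded_free_resolution s M I \<and> (\<forall>i. \<forall>c\<in>set (s i). c = d + i))"

definition componentwise_linear :: "('n::finite, 'k::field) poly_ring set \<Rightarrow> bool" where
  "componentwise_linear I \<longleftrightarrow> (\<forall>j. has_linear_resolution (component_ideal I j))"

definition componentwise_linear_quotients :: "('n::finite, 'k::field) poly_ring set \<Rightarrow> bool" where
  "componentwise_linear_quotients I \<longleftrightarrow> (\<forall>j. has_linear_quotients (component_ideal I j))"

end

theory Submission
  imports Defs "HOL-Library.Function_Algebras"
begin

text \<open>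
  Everything is decided by one notion, Koszul-linearity. An ideal \<open>I\<close> generated in degree \<open>e\<close> has a
  linear resolution if and only if \<open>Tor\<^sub>i(I, k)\<close> lives in degree \<open>i + e\<close> only. Computed with the Koszul
  complex of the variables, this says that every Koszul cycle with coefficients in \<open>I\<close> that are
  homogeneous of degree greater than \<open>e\<close> is the boundary of a chain with coefficients in \<open>I\<close>. The
  equivalence with the existence of a linear resolution is proved in the two lemmas
  \<open>linear_resolution_imp_koszul_linear\<close> and \<open>koszul_linear_imp_linear_resolution\<close> by chasing cycles through
  the resolution. Linear quotients imply Koszul-linearity, because adding a generator \<open>u\<close> to an ideal \<open>J\<close>
  contributes the Koszul homology of \<open>S/(J : u)\<close>, and the Koszul complex is acyclic in positive
  coefficient degree modulo an ideal generated by variables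
  (\<open>linear_quotients_imp_koszul_linear\<close>).

  It remains to show that a Koszul-linear lexsegment ideal \<open>(\<L>(u, v))\<close> has linear quotients. Let \<open>x\<^sub>i\<close> be
  the first variable in whose exponent \<open>u\<close> and \<open>v\<close> differ. There are two situations in which the
  generators can be ordered by hand. In the first one (\<open>recoverable\<close>), whenever a monomial \<open>q\<close> with the
  same exponents as \<open>u\<close> up to \<open>x\<^sub>i\<close> overshoots \<open>u\<close>, the monomial \<open>q x\<^sub>n / x\<^sub>i\<close> does not fall below \<open>v\<close>. In the
  second one (\<open>exceptional\<close>), \<open>v\<close> is, up to its part in \<open>x\<^sub>1,\<dots>,x\<^sub>i\<close>, of the form \<open>x\<^sub>j x\<^sub>n\<^sup>c\<close>, and \<open>u\<close> contains
  \<open>x\<^sub>i\<close> exactly once more than \<open>v\<close>. If neither holds, a nonlinear syzygy can be written down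
  (\<open>koszul_linear_imp_recoverable_or_exceptional\<close>): for a monomial \<open>g\<close> outside the ideal and a set \<open>s\<close> of
  variables with \<open>x\<^sub>a g\<close> in the ideal for all \<open>a\<close> in \<open>s\<close>, the boundary of \<open>g e\<^sub>s\<close> is a cycle over the ideal,
  and comparing a single coefficient shows that it bounds nothing over the ideal
  (\<open>koszul_linear_obstruction\<close>).

  For a componentwise lexsegment ideal, the degree \<open>d + k\<close> part is spanned by
  \<open>\<L>(x\<^sub>1\<^sup>k u, x\<^sub>n\<^sup>k v)\<close>. For \<open>k \<ge> 1\<close> such a segment is always recoverable: dividing \<open>q > x\<^sub>1\<^sup>k u\<close> by \<open>x\<^sub>1\<close> leaves
  something greater than \<open>x\<^sub>1\<^sup>k\<^sup>-\<^sup>1 u \<ge> x\<^sub>n\<^sup>k\<^sup>-\<^sup>1 v\<close>. So all components above degree \<open>d\<close> have linear quotients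
  unconditionally, and the four properties only depend on the component of degree \<open>d\<close>.
\<close>

section \<open>Monomials and monomial ideals\<close>

abbreviation lookup :: "('a \<Rightarrow>\<^sub>0 'b::zero) \<Rightarrow> 'a \<Rightarrow> 'b" where
  "lookup \<equiv> Poly_Mapping.lookup"

abbreviation keys :: "('a \<Rightarrow>\<^sub>0 'b::zero) \<Rightarrow> 'a set" where
  "keys \<equiv> Poly_Mapping.keys"

definition xv :: "'n \<Rightarrow> 'n monomial" where
  "xv i = Poly_Mapping.single i 1"

definition mdvd :: "'n monomial \<Rightarrow> 'n monomial \<Rightarrow> bool" where
  "mdvd a m \<longleftrightarrow> (\<forall>i. lookup a i \<le> lookup m i)"

lemma lookup_xv: "lookup (xv i) j = (if i = j then 1 else 0)"
  by (simp add: xv_def lookup_single when_def)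

lemma var_eq_mon: "var i = mon (xv i)"
  by (simp add: var_def xv_def)

lemma mdvd_refl [simp]: "mdvd m m"
  by (simp add: mdvd_def)

lemma mdvd_add [simp]: "mdvd a (a + b)" "mdvd b (a + b)"
  by (simp_all add: mdvd_def lookup_add)

lemma add_diff_monomial: "mdvd a m \<Longrightarrow> a + (m - a) = m"
  by (rule poly_mapping_eqI) (simp add: mdvd_def lookup_add lookup_minus)

lemma mdvd_iff: "mdvd a m \<longleftrightarrow> (\<exists>b. m = a + b)"
  by (metis add_diff_monomial mdvd_add(1))

lemma mdvd_xv: "mdvd (xv i) m \<longleftrightarrow> lookup m i > 0"
  by (auto simp: mdvd_def lookup_xv Suc_le_eq split: if_splits)

lemma mdeg_add: "mdeg (a + b) = mdeg a + mdeg b"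
  by (simp add: mdeg_def lookup_add sum.distrib)

lemma mdeg_xv [simp]: "mdeg (xv i) = 1"
  by (simp add: mdeg_def lookup_xv)

lemma mdeg_single: "mdeg (Poly_Mapping.single i c) = c"
  by (simp add: mdeg_def lookup_single when_def)

lemma mdeg_zero [simp]: "mdeg 0 = 0"
  by (simp add: mdeg_def)

lemma mdeg_eq_0_iff: "mdeg m = 0 \<longleftrightarrow> m = 0"
  by (auto simp: mdeg_def intro!: poly_mapping_eqI)

lemma mdeg_mono: "mdvd a m \<Longrightarrow> mdeg a \<le> mdeg m"
  by (auto simp: mdvd_iff mdeg_add)

lemma mdvd_eq_if_mdeg_le:
  assumes "mdvd a m" "mdeg m \<le> mdeg a" shows "a = m"
proof -
  obtain b where b: "m = a + b" using assms(1) by (auto simp: mdvd_iff)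
  with assms(2) have "mdeg b = 0" by (simp add: mdeg_add)
  then show ?thesis using b by (simp add: mdeg_eq_0_iff)
qed

lemma lookup_mon_mult:
  "lookup (mon m * p) k = (if mdvd m k then lookup p (k - m) else 0)"
proof -
  have "lookup (mon m * p) k = (\<Sum>q. lookup p q when k = m + q)"
    by (simp add: mon_def lookup_mult lookup_single when_mult)
  also have "\<dots> = (if mdvd m k then lookup p (k - m) else 0)"
  proof (cases "mdvd m k")
    case True
    then have "k = m + q \<longleftrightarrow> q = k - m" for q
      using add_diff_monomial by (metis add_diff_cancel_left')
    then show ?thesis using True by simp
  next
    case False
    then have "k \<noteq> m + q" for q by auto
    then show ?thesis using False by simp
  qed
  finally show ?thesis .
qed

lemma mon_add: "mon (a + b) = mon a * mon b"
  by (simp add: mon_def mult_single)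

lemma keys_mon [simp]: "keys (mon m :: ('n, 'k::field) poly_ring) = {m}"
  by (simp add: mon_def)

lemma lookup_mon: "lookup (mon m) k = (if k = m then 1 else 0)"
  by (auto simp: mon_def lookup_single when_def)

lemma mon_dvd_mon_iff: "(mon a :: ('n, 'k::field) poly_ring) dvd mon b \<longleftrightarrow> mdvd a b"
proof
  assume "(mon a :: ('n, 'k) poly_ring) dvd mon b"
  then obtain p :: "('n, 'k) poly_ring" where "mon b = mon a * p" by (auto elim: dvdE)
  then have "lookup (mon a * p) b = (1::'k)" by (metis lookup_mon)
  then show "mdvd a b" by (auto simp: lookup_mon_mult split: if_splits)
qed (auto simp: mdvd_iff mon_add)

lemma poly_eq_sum_singles:
  "p = (\<Sum>m\<in>keys p. Poly_Mapping.single m (lookup p m))"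
proof (rule poly_mapping_eqI)
  fix k
  have "lookup (\<Sum>m\<in>keys p. Poly_Mapping.single m (lookup p m)) k
      = (\<Sum>m\<in>keys p. if m = k then lookup p m else 0)"
    by (simp add: lookup_sum lookup_single when_def)
  also have "\<dots> = lookup p k"
    by (simp add: sum.delta in_keys_iff)
  finally show "lookup p k = lookup (\<Sum>m\<in>keys p. Poly_Mapping.single m (lookup p m)) k"
    by simp
qed

text \<open>
  Membership in a monomial ideal is decided monomial by monomial, which makes such ideals stable under
  every operation that drops some of the terms of a polynomial.
\<close>

lemma mem_monomial_ideal_iff:
  fixes f :: "('n, 'k::field) poly_ring"
  shows "f \<in> ideal_gen (mon ` A) \<longleftrightarrow> (\<forall>m\<in>keys f. \<exists>a\<in>A. mdvd a m)"
proof
  assume "f \<in> ideal_gen (mon ` A)"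
  then show "\<forall>m\<in>keys f. \<exists>a\<in>A. mdvd a m"
  proof (induction rule: ring_module.span_induct_alt)
    case base
    then show ?case by simp
  next
    case (step c x y)
    then obtain a where a: "a \<in> A" "x = mon a" by auto
    have "keys (c * x + y) \<subseteq> keys (c * x) \<union> keys y"
      by (rule keys_add)
    moreover have "keys (c * x) \<subseteq> {k + a |k. True}"
      using keys_mult[of c x] a(2) by auto
    ultimately show ?case using step(2) a(1) mdvd_add(2) by blast
  qed
next
  assume *: "\<forall>m\<in>keys f. \<exists>a\<in>A. mdvd a m"
  have "(\<Sum>m\<in>keys f. Poly_Mapping.single m (lookup f m)) \<in> ideal_gen (mon ` A)"
  proof (rule ring_module.span_sum)
    fix m assume "m \<in> keys f"
    then obtain a b where a: "a \<in> A" "m = b + a"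
      using * by (metis add.commute mdvd_iff)
    have "Poly_Mapping.single m (lookup f m) = Poly_Mapping.single b (lookup f m) * mon a"
      by (simp add: mon_def mult_single a(2))
    then show "Poly_Mapping.single m (lookup f m) \<in> ideal_gen (mon ` A)"
      using a(1) by (simp add: ring_module.span_scale ring_module.span_base)
  qed
  then show "f \<in> ideal_gen (mon ` A)" by (simp flip: poly_eq_sum_singles)
qed

lemma mon_mem_monomial_ideal_iff:
  "(mon m :: ('n, 'k::field) poly_ring) \<in> ideal_gen (mon ` A) \<longleftrightarrow> (\<exists>a\<in>A. mdvd a m)"
  by (simp add: mem_monomial_ideal_iff)

lemma var_ideal_eq: "ideal_gen (var ` V) = ideal_gen (mon ` xv ` V)"
  by (simp add: image_image var_eq_mon)

lemma mem_var_ideal_iff: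
  "(f :: ('n, 'k::field) poly_ring) \<in> ideal_gen (var ` V) \<longleftrightarrow>
    (\<forall>m\<in>keys f. \<exists>i\<in>V. lookup m i > 0)"
  by (simp add: var_ideal_eq mem_monomial_ideal_iff mdvd_xv)

section \<open>Homogeneous parts\<close>

definition restrict_poly :: "('n monomial \<Rightarrow> bool) \<Rightarrow> ('n, 'k::field) poly_ring \<Rightarrow> ('n, 'k) poly_ring" where
  "restrict_poly P p = Poly_Mapping.mapp (\<lambda>m c. c when P m) p"

lemma lookup_restrict_poly: "lookup (restrict_poly P p) m = (if P m then lookup p m else 0)"
  by (auto simp: restrict_poly_def lookup_mapp when_def in_keys_iff)

lemma keys_restrict_poly: "keys (restrict_poly P p) = {m \<in> keys p. P m}"
  by (auto simp: in_keys_iff lookup_restrict_poly split: if_splits)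

lemma restrict_poly_zero [simp]: "restrict_poly P 0 = 0"
  by (rule poly_mapping_eqI) (simp add: lookup_restrict_poly)

lemma restrict_poly_add: "restrict_poly P (p + q) = restrict_poly P p + restrict_poly P q"
  by (rule poly_mapping_eqI) (simp add: lookup_restrict_poly lookup_add)

lemma restrict_poly_sum: "restrict_poly P (sum f A) = (\<Sum>a\<in>A. restrict_poly P (f a))"
  by (rule poly_mapping_eqI) (simp add: lookup_restrict_poly lookup_sum)

lemma restrict_poly_minus: "restrict_poly P (- p) = - restrict_poly P p"
  by (rule poly_mapping_eqI) (simp add: lookup_restrict_poly)

lemma homogeneousI: "(\<And>m. m \<in> keys f \<Longrightarrow> mdeg m = c) \<Longrightarrow> homogeneous c f"
  by (auto simp: homogeneous_def Mon_def)

lemma homogeneousD: "homogeneous c f \<Longrightarrow> m \<in> keys f \<Longrightarrow> mdeg m = c"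
  by (auto simp: homogeneous_def Mon_def)

lemma homogeneous_zero [simp]: "homogeneous c 0"
  by (simp add: homogeneous_def)

lemma homogeneous_add: "homogeneous c p \<Longrightarrow> homogeneous c q \<Longrightarrow> homogeneous c (p + q)"
  using keys_add[of p q] by (auto simp: homogeneous_def)

lemma homogeneous_sum: "(\<And>a. a \<in> A \<Longrightarrow> homogeneous c (f a)) \<Longrightarrow> homogeneous c (sum f A)"
  by (induction A rule: infinite_finite_induct) (auto intro: homogeneous_add)

lemma homogeneous_minus: "homogeneous c p \<Longrightarrow> homogeneous c (- p)"
  by (auto simp: homogeneous_def in_keys_iff)

lemma homogeneous_mult: "homogeneous c p \<Longrightarrow> homogeneous e q \<Longrightarrow> homogeneous (c + e) (p * q)"
  using keys_mult[of p q] by (fastforce simp: homogeneous_def Mon_def mdeg_add)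

lemma homogeneous_mon [simp]: "homogeneous (mdeg m) (mon m :: ('n::finite, 'k::field) poly_ring)"
  by (simp add: homogeneous_def Mon_def)

lemma homogeneous_var [simp]: "homogeneous (Suc 0) (var i :: ('n::finite, 'k::field) poly_ring)"
  by (simp add: homogeneous_def Mon_def var_eq_mon)

definition hpart :: "nat \<Rightarrow> ('n::finite, 'k::field) poly_ring \<Rightarrow> ('n, 'k) poly_ring" where
  "hpart c = restrict_poly (\<lambda>m. mdeg m = c)"

lemma homogeneous_hpart [simp]: "homogeneous c (hpart c p)"
  by (auto simp: homogeneous_def hpart_def keys_restrict_poly Mon_def)

lemma hpart_id: "homogeneous c p \<Longrightarrow> hpart c p = p"
  by (rule poly_mapping_eqI)
     (auto simp: homogeneous_def hpart_def lookup_restrict_poly Mon_def in_keys_iff)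

text \<open>
  Multiplication by a homogeneous polynomial shifts homogeneous parts, so every equation between
  products with homogeneous factors can be cut down to a single degree.
\<close>

lemma hpart_mult:
  assumes "homogeneous e p"
  shows "hpart (e + c) (p * q) = p * hpart c q"
proof -
  define r where "r = restrict_poly (\<lambda>m. mdeg m \<noteq> c) q"
  have q: "q = hpart c q + r"
    by (rule poly_mapping_eqI) (simp add: r_def hpart_def lookup_add lookup_restrict_poly)
  have "hpart (e + c) (p * r) = 0"
  proof (rule poly_mapping_eqI)
    fix m
    have "m \<in> keys (p * r) \<Longrightarrow> mdeg m \<noteq> e + c"
      using keys_mult[of p r] homogeneousD[OF assms]
      by (auto simp: r_def keys_restrict_poly mdeg_add)
    then show "lookup (hpart (e + c) (p * r)) m = lookup 0 m"
      by (auto simp: hpart_def lookup_restrict_poly in_keys_iff)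
  qed
  moreover have "hpart (e + c) (p * hpart c q) = p * hpart c q"
    using assms by (intro hpart_id homogeneous_mult) auto
  moreover have "hpart (e + c) (p * q) = hpart (e + c) (p * hpart c q) + hpart (e + c) (p * r)"
    by (subst q) (simp add: hpart_def restrict_poly_add distrib_left)
  ultimately show ?thesis by simp
qed

lemma hpart_mem_monomial_ideal:
  "f \<in> ideal_gen (mon ` A) \<Longrightarrow> hpart c f \<in> ideal_gen (mon ` A)"
  by (auto simp: mem_monomial_ideal_iff hpart_def keys_restrict_poly)

section \<open>The Koszul complex of the variables\<close>

(* As a rewrite rule, a * (b * x) = (a * b) * x runs in circles with the associativity law in
   algebra_simps. *)
declare ring_module.scale_scale [simp del]

text \<open>
  A chain assigns to a set \<open>s\<close> of variables its coefficient at the basis element \<open>e\<^sub>s\<close> of the exterior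
  algebra; chains of all homological degrees are treated together. The coefficient of the boundary
  at \<open>s\<close> collects the contributions of the sets \<open>s \<union> {a}\<close>.
\<close>

type_synonym ('n, 'k) chain = "'n set \<Rightarrow> ('n, 'k) poly_ring"

definition koszul_sign :: "'n::{finite,linorder} \<Rightarrow> 'n set \<Rightarrow> ('n, 'k::field) poly_ring" where
  "koszul_sign a s = (- 1) ^ card {b \<in> s. b < a}"

definition koszul_d :: "('n::{finite,linorder}, 'k::field) chain \<Rightarrow> ('n, 'k) chain" where
  "koszul_d f s = (\<Sum>a\<in>- s. koszul_sign a s * (var a * f (insert a s)))"

lemma koszul_sign_mult_cases: "koszul_sign a s * p = p \<or> koszul_sign a s * p = - p"
  by (cases "even (card {b \<in> s. b < a})") (simp_all add: koszul_sign_def)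

lemma koszul_sign_square [simp]: "koszul_sign a s * (koszul_sign a s * p) = p"
  by (cases "even (card {b \<in> s. b < a})") (simp_all add: koszul_sign_def)

lemma koszul_sign_insert:
  assumes "b \<notin> s"
  shows "koszul_sign a (insert b s) = (if b < a then - koszul_sign a s else koszul_sign a s)"
proof (cases "b < a")
  case True
  then have "{c \<in> insert b s. c < a} = insert b {c \<in> s. c < a}" by auto
  then show ?thesis using True assms by (simp add: koszul_sign_def)
next
  case False
  then have "{c \<in> insert b s. c < a} = {c \<in> s. c < a}" by auto
  then show ?thesis using False by (simp add: koszul_sign_def)
qed

lemma koszul_sign_swap:
  assumes "a \<noteq> b" "a \<notin> s" "b \<notin> s"
  shows "koszul_sign b s * koszul_sign a (insert b s) = - (koszul_sign a s * koszul_sign b (insert a s))"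
  using assms by (auto simp: koszul_sign_insert)

lemma lookup_koszul_sign_mult_eq_0: "lookup (koszul_sign a s * p) m = 0 \<longleftrightarrow> lookup p m = 0"
  using koszul_sign_mult_cases[of a s p] by auto

lemma homogeneous_koszul_sign_mult: "homogeneous c p \<Longrightarrow> homogeneous c (koszul_sign a s * p)"
  using koszul_sign_mult_cases[of a s p] by (auto simp: homogeneous_minus)

lemma restrict_poly_koszul_sign_mult: "restrict_poly P (koszul_sign a s * p) = koszul_sign a s * restrict_poly P p"
  by (cases "even (card {b \<in> s. b < a})") (simp_all add: koszul_sign_def restrict_poly_minus)

lemma koszul_d_zero [simp]: "koszul_d (\<lambda>s. 0) = (\<lambda>s. 0)"
  by (rule ext) (simp add: koszul_d_def)

lemma koszul_d_add: "koszul_d (\<lambda>s. f s + g s) s = koszul_d f s + koszul_d g s"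
  by (simp add: koszul_d_def distrib_left sum.distrib)

lemma koszul_d_diff: "koszul_d (\<lambda>s. f s - g s) s = koszul_d f s - koszul_d g s"
  by (simp add: koszul_d_def right_diff_distrib sum_subtractf)

lemma koszul_d_mult: "koszul_d (\<lambda>s. p * f s) s = p * koszul_d f s"
  by (simp add: koszul_d_def sum_distrib_left mult.left_commute)

lemma koszul_d_sum: "koszul_d (\<lambda>s. \<Sum>j\<in>J. f j s) s = (\<Sum>j\<in>J. koszul_d (f j) s)"
  by (simp add: koszul_d_def sum_distrib_left) (rule sum.swap)

text \<open>Removing two variables in either order gives opposite signs.\<close>

lemma koszul_d_koszul_d: "koszul_d (koszul_d f) = (\<lambda>s. 0)"
proof
  fix s
  define t where "t = (\<lambda>a b. koszul_sign a s * koszul_sign b (insert a s) *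
    (var a * var b * f (insert a (insert b s))))"
  have anti: "t a b = - t b a" if "a \<noteq> b" "a \<notin> s" "b \<notin> s" for a b
  proof -
    define p where "p = var a * var b * f (insert a (insert b s))"
    have "t a b = koszul_sign a s * koszul_sign b (insert a s) * p"
      by (simp add: t_def p_def)
    moreover have "t b a = koszul_sign b s * koszul_sign a (insert b s) * p"
      by (simp add: t_def p_def insert_commute mult.commute)
    ultimately show ?thesis by (simp only: koszul_sign_swap[OF that] mult_minus_left minus_minus)
  qed
  have "koszul_d (koszul_d f) s = (\<Sum>a\<in>- s. \<Sum>b\<in>- s - {a}. t a b)"
    unfolding koszul_d_def sum_distrib_left t_def
    by (intro sum.cong) (auto simp: insert_commute mult.assoc mult.left_commute)
  also have "\<dots> = (\<Sum>(a, b)\<in>{(a, b). a \<notin> s \<and> b \<notin> s \<and> a \<noteq> b}. t a b)"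
    by (subst sum.Sigma) (auto intro!: sum.cong)
  also have "\<dots> = (\<Sum>(a, b)\<in>{(a, b). a \<notin> s \<and> b \<notin> s \<and> a < b}. t a b) +
      (\<Sum>(a, b)\<in>{(a, b). a \<notin> s \<and> b \<notin> s \<and> b < a}. t a b)"
    by (subst sum.union_disjoint[symmetric]) (auto intro!: sum.cong)
  also have "(\<Sum>(a, b)\<in>{(a, b). a \<notin> s \<and> b \<notin> s \<and> b < a}. t a b) =
      (\<Sum>(a, b)\<in>{(a, b). a \<notin> s \<and> b \<notin> s \<and> a < b}. t b a)"
    by (rule sum.reindex_bij_witness[of _ prod.swap prod.swap]) auto
  also have "\<dots> = (\<Sum>(a, b)\<in>{(a, b). a \<notin> s \<and> b \<notin> s \<and> a < b}. - t a b)"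
    by (rule sum.cong) (auto intro: anti)
  finally show "koszul_d (koszul_d f) s = 0"
    by (simp add: case_prod_unfold sum_negf)
qed

lemma homogeneous_koszul_d:
  assumes "\<And>s. homogeneous c (f s)"
  shows "homogeneous (Suc c) (koszul_d f s)"
proof -
  have "homogeneous (Suc 0 + c) (var a * f (insert a s))" for a
    by (rule homogeneous_mult) (use assms in auto)
  then show ?thesis
    unfolding koszul_d_def by (intro homogeneous_sum homogeneous_koszul_sign_mult) simp
qed

lemma hpart_koszul_d:
  fixes f :: "('n::{finite,linorder}, 'k::field) chain"
  shows "hpart (Suc c) (koszul_d f s) = koszul_d (\<lambda>s. hpart c (f s)) s"
proof -
  have "hpart (Suc c) (var a * p) = var a * hpart c p" for a :: 'n and p :: "('n, 'k) poly_ring"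
    using hpart_mult[of "Suc 0" "var a" c p] by simp
  then show ?thesis
    unfolding koszul_d_def hpart_def by (simp add: restrict_poly_sum restrict_poly_koszul_sign_mult)
qed

lemma koszul_d_support:
  fixes f :: "('n::{finite,linorder}, 'k::field) chain"
  assumes "\<And>s. card s \<ge> Suc i \<Longrightarrow> f s = 0" "card s \<ge> i"
  shows "koszul_d f s = 0"
  unfolding koszul_d_def by (rule sum.neutral) (use assms in auto)

section \<open>Acyclicity of the Koszul complex\<close>

text \<open>
  The linear map that divides a monomial by \<open>x\<^sub>a\<close> if possible and sends it to zero otherwise. It is a left
  inverse of the multiplication by \<open>x\<^sub>a\<close>.
\<close>

definition var_quot :: "'n \<Rightarrow> ('n, 'k::field) poly_ring \<Rightarrow> ('n, 'k) poly_ring" where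
  "var_quot a = Poly_Mapping.map_key (\<lambda>m. xv a + m)"

lemma lookup_var_quot: "lookup (var_quot a p) m = lookup p (xv a + m)"
  by (simp add: var_quot_def map_key.rep_eq inj_def)

lemma var_quot_sum: "var_quot a (sum f A) = (\<Sum>b\<in>A. var_quot a (f b))"
  by (rule poly_mapping_eqI) (simp add: lookup_var_quot lookup_sum)

lemma var_quot_koszul_sign_mult: "var_quot a (koszul_sign b s * p) = koszul_sign b s * var_quot a p"
  by (cases "even (card {c \<in> s. c < b})")
     (auto intro!: poly_mapping_eqI simp: koszul_sign_def lookup_var_quot)

lemma var_quot_var_mult_same: "var_quot a (var a * p) = p"
  by (rule poly_mapping_eqI) (simp add: lookup_var_quot var_eq_mon lookup_mon_mult)

lemma mdvd_xv_add: "b \<noteq> a \<Longrightarrow> mdvd (xv b) (xv a + m) \<longleftrightarrow> mdvd (xv b) m"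
  by (simp add: mdvd_xv lookup_add lookup_xv)

lemma var_quot_var_mult:
  assumes "b \<noteq> a"
  shows "var_quot a (var b * p) = var b * var_quot a p"
proof (rule poly_mapping_eqI)
  fix m
  have "xv a + m - xv b = xv a + (m - xv b)" if "mdvd (xv b) m"
    using that by (metis add.left_commute add_diff_cancel_left' mdvd_iff)
  then show "lookup (var_quot a (var b * p)) m = lookup (var b * var_quot a p) m"
    using assms by (simp add: lookup_var_quot var_eq_mon lookup_mon_mult mdvd_xv_add)
qed

lemma var_mult_var_quot: "var a * var_quot a p = p - restrict_poly (\<lambda>m. lookup m a = 0) p"
  by (rule poly_mapping_eqI)
     (auto simp: lookup_var_quot var_eq_mon lookup_mon_mult lookup_restrict_poly lookup_minus mdvd_xv
        add_diff_monomial)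

lemma restrict_poly_var_mult:
  assumes "b \<noteq> a"
  shows "restrict_poly (\<lambda>m. lookup m a = 0) (var b * p) = var b * restrict_poly (\<lambda>m. lookup m a = 0) p"
  by (rule poly_mapping_eqI)
     (use assms in \<open>auto simp: var_eq_mon lookup_mon_mult lookup_restrict_poly lookup_minus lookup_xv\<close>)

lemma restrict_poly_var_mult_same: "restrict_poly (\<lambda>m. lookup m a = 0) (var a * p) = 0"
  by (rule poly_mapping_eqI)
     (auto simp: var_eq_mon lookup_mon_mult lookup_restrict_poly mdvd_xv)

text \<open>
  Inserting \<open>a\<close> into the index set while dividing by \<open>x\<^sub>a\<close> is a chain homotopy between the identity and
  the projection onto the chains that involve \<open>a\<close> neither in an index set nor in a coefficient.
  Unlike the Euler derivation, it needs no division by integers and works in every characteristic.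
\<close>

definition koszul_homotopy :: "'n::{finite,linorder} \<Rightarrow> ('n, 'k::field) chain \<Rightarrow> ('n, 'k) chain" where
  "koszul_homotopy a f s = (if a \<in> s then koszul_sign a (s - {a}) * var_quot a (f (s - {a})) else 0)"

definition koszul_proj :: "'n::{finite,linorder} \<Rightarrow> ('n, 'k::field) chain \<Rightarrow> ('n, 'k) chain" where
  "koszul_proj a f s = (if a \<in> s then 0 else restrict_poly (\<lambda>m. lookup m a = 0) (f s))"

lemma koszul_d_koszul_homotopy: "koszul_d (koszul_homotopy a f) s + koszul_homotopy a (koszul_d f) s + koszul_proj a f s = f s"
proof (cases "a \<in> s")
  case True
  define r where "r = s - {a}"
  have s: "s = insert a r" "a \<notin> r" using True by (auto simp: r_def)
  have 1: "koszul_d (koszul_homotopy a f) s =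
      (\<Sum>b\<in>- s. koszul_sign b (insert a r) * (var b * (koszul_sign a (insert b r) * var_quot a (f (insert b r)))))"
    unfolding koszul_d_def
  proof (rule sum.cong)
    fix b assume "b \<in> - s"
    then have "insert b s - {a} = insert b r" using s by auto
    then show "koszul_sign b s * (var b * koszul_homotopy a f (insert b s)) =
      koszul_sign b (insert a r) * (var b * (koszul_sign a (insert b r) * var_quot a (f (insert b r))))"
      using True by (simp add: koszul_homotopy_def s(1))
  qed auto
  have comp: "- r = insert a (- s)" "a \<notin> - s" using s by auto
  have 2: "koszul_homotopy a (koszul_d f) s = f s +
      (\<Sum>b\<in>- s. koszul_sign a r * (koszul_sign b r * (var b * var_quot a (f (insert b r)))))"
  proof -
    have "koszul_homotopy a (koszul_d f) s = koszul_sign a r * var_quot a (koszul_d f r)"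
      using True by (simp add: koszul_homotopy_def r_def)
    also have "var_quot a (koszul_d f r) = (\<Sum>b\<in>- r. koszul_sign b r * var_quot a (var b * f (insert b r)))"
      by (simp add: koszul_d_def var_quot_sum var_quot_koszul_sign_mult)
    also have "\<dots> = koszul_sign a r * f s + (\<Sum>b\<in>- s. koszul_sign b r * var_quot a (var b * f (insert b r)))"
      unfolding comp(1) using comp(2) by (simp add: var_quot_var_mult_same s(1))
    also have "(\<Sum>b\<in>- s. koszul_sign b r * var_quot a (var b * f (insert b r))) =
        (\<Sum>b\<in>- s. koszul_sign b r * (var b * var_quot a (f (insert b r))))"
    proof (rule sum.cong)
      fix b assume "b \<in> - s"
      then have "b \<noteq> a" using True by auto
      then show "koszul_sign b r * var_quot a (var b * f (insert b r)) =
          koszul_sign b r * (var b * var_quot a (f (insert b r)))"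
        by (simp add: var_quot_var_mult)
    qed simp
    finally show ?thesis by (simp add: distrib_left sum_distrib_left)
  qed
  have "koszul_d (koszul_homotopy a f) s = - (\<Sum>b\<in>- s. koszul_sign a r * (koszul_sign b r * (var b * var_quot a (f (insert b r)))))"
    unfolding 1 sum_negf[symmetric]
  proof (rule sum.cong)
    fix b assume "b \<in> - s"
    then have b: "b \<noteq> a" "b \<notin> r" using s by auto
    have "koszul_sign b (insert a r) * koszul_sign a (insert b r) = - (koszul_sign a r * koszul_sign b r)"
      using b s(2) by (auto simp: koszul_sign_insert mult.commute)
    then have "koszul_sign b (insert a r) * koszul_sign a (insert b r) * (var b * var_quot a (f (insert b r)))
        = - (koszul_sign a r * koszul_sign b r) * (var b * var_quot a (f (insert b r)))"
      by (rule arg_cong)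
    then show "koszul_sign b (insert a r) * (var b * (koszul_sign a (insert b r) * var_quot a (f (insert b r)))) =
        - (koszul_sign a r * (koszul_sign b r * (var b * var_quot a (f (insert b r)))))"
      by (simp add: mult_ac)
  qed auto
  then show ?thesis using True by (simp add: 2 koszul_proj_def)
next
  case False
  have "koszul_d (koszul_homotopy a f) s = (\<Sum>b\<in>- s. if b = a then var a * var_quot a (f s) else 0)"
    unfolding koszul_d_def
    by (rule sum.cong) (use False in \<open>auto simp: koszul_homotopy_def mult.left_commute\<close>)
  also have "\<dots> = var a * var_quot a (f s)" using False by (simp add: sum.delta')
  finally show ?thesis using False by (simp add: koszul_homotopy_def koszul_proj_def var_mult_var_quot)
qed

lemma koszul_d_koszul_proj: "koszul_d (koszul_proj a f) s = koszul_proj a (koszul_d f) s"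
proof (cases "a \<in> s")
  case True
  then show ?thesis by (simp add: koszul_d_def koszul_proj_def)
next
  case False
  have "koszul_proj a (koszul_d f) s =
      (\<Sum>b\<in>- s. koszul_sign b s * restrict_poly (\<lambda>m. lookup m a = 0) (var b * f (insert b s)))"
    using False by (simp add: koszul_proj_def koszul_d_def restrict_poly_sum restrict_poly_koszul_sign_mult)
  also have "\<dots> = koszul_d (koszul_proj a f) s"
    unfolding koszul_d_def
    by (rule sum.cong) (use False in \<open>auto simp: koszul_proj_def restrict_poly_var_mult restrict_poly_var_mult_same\<close>)
  finally show ?thesis by simp
qed

text \<open>
  Modulo the ideal generated by the variables in \<open>V\<close>, a cycle can be moved by the homotopies of finitely
  many variables outside \<open>V\<close>, one after the other, until its coefficients are free of these variables.
  The homotopies do not disturb the ideal, since dividing by a variable outside \<open>V\<close> keeps it.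
\<close>

lemma koszul_acyclic_mod_vars_aux:
  fixes f :: "('n::{finite,linorder}, 'k::field) chain"
  assumes "finite A" "A \<inter> V = {}" "\<And>s. koszul_d f s \<in> ideal_gen (var ` V)"
    "\<And>s. homogeneous c (f s)"
  shows "\<exists>t g. (\<forall>s. f s - koszul_d t s - g s \<in> ideal_gen (var ` V)) \<and> (\<forall>s. homogeneous c (g s)) \<and>
    (\<forall>s. koszul_d g s \<in> ideal_gen (var ` V)) \<and>
    (\<forall>s. \<forall>m\<in>keys (g s). \<forall>a\<in>A. lookup m a = 0)"
  using assms(1,2)
proof (induction A)
  case empty
  show ?case
    by (rule exI[of _ "\<lambda>s. 0"], rule exI[of _ f]) (use assms in \<open>simp add: ring_module.span_zero\<close>)
next
  case (insert a A)
  then obtain t g where tg: "\<And>s. f s - koszul_d t s - g s \<in> ideal_gen (var ` V)"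
    "\<And>s. homogeneous c (g s)" "\<And>s. koszul_d g s \<in> ideal_gen (var ` V)"
    "\<And>s m b. m \<in> keys (g s) \<Longrightarrow> b \<in> A \<Longrightarrow> lookup m b = 0"
    by (metis Int_insert_left insert_disjoint(1))
  have a: "a \<notin> V" using insert.prems by auto
  define t' where "t' = (\<lambda>s. t s + koszul_homotopy a g s)"
  have kh: "koszul_homotopy a (koszul_d g) s \<in> ideal_gen (var ` V)" for s
  proof -
    have "var_quot a p \<in> ideal_gen (var ` V)" if p: "p \<in> ideal_gen (var ` V)" for p :: "('n, 'k) poly_ring"
      unfolding mem_var_ideal_iff
    proof
      fix m assume "m \<in> keys (var_quot a p)"
      then have "xv a + m \<in> keys p" by (simp add: in_keys_iff lookup_var_quot)
      then obtain i where i: "i \<in> V" "lookup (xv a + m) i > 0"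
        using p unfolding mem_var_ideal_iff by blast
      moreover have "i \<noteq> a" using i(1) a by auto
      ultimately show "\<exists>i\<in>V. lookup m i > 0" by (auto simp: lookup_add lookup_xv)
    qed
    then show ?thesis
      using tg(3) by (auto simp: koszul_homotopy_def ring_module.span_zero ring_module.span_scale)
  qed
  have "f s - koszul_d t' s - koszul_proj a g s \<in> ideal_gen (var ` V)" for s
  proof -
    have "f s - koszul_d t' s - koszul_proj a g s = (f s - koszul_d t s - g s) + koszul_homotopy a (koszul_d g) s"
      using koszul_d_koszul_homotopy[of a g s] by (simp add: t'_def koszul_d_add algebra_simps)
    then show ?thesis by (simp only: ring_module.span_add[OF tg(1) kh])
  qed
  moreover have "homogeneous c (koszul_proj a g s)" for s
    using tg(2)[of s] by (auto simp: koszul_proj_def homogeneous_def keys_restrict_poly)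
  moreover have "koszul_d (koszul_proj a g) s \<in> ideal_gen (var ` V)" for s
    unfolding koszul_d_koszul_proj using tg(3)[of s]
    by (auto simp: koszul_proj_def mem_var_ideal_iff keys_restrict_poly)
  moreover have "\<forall>m\<in>keys (koszul_proj a g s). \<forall>b\<in>insert a A. lookup m b = 0" for s
    using tg(4)[of _ s] by (auto simp: koszul_proj_def keys_restrict_poly)
  ultimately show ?case by blast
qed

lemma hpart_mem_var_ideal:
  "f \<in> ideal_gen (var ` V) \<Longrightarrow> hpart c f \<in> ideal_gen (var ` V)"
  unfolding var_ideal_eq by (rule hpart_mem_monomial_ideal)

text \<open>
  Once all variables outside \<open>V\<close> have been eliminated, the coefficients of the remaining chain are
  monomials of positive degree in the variables \<open>V\<close> and thus vanish modulo the ideal.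
\<close>

lemma koszul_acyclic_mod_vars:
  fixes f :: "('n::{finite,linorder}, 'k::field) chain"
  assumes "\<And>s. koszul_d f s \<in> ideal_gen (var ` V)" "\<And>s. homogeneous c (f s)" "c > 0"
  shows "\<exists>t. (\<forall>s. f s - koszul_d t s \<in> ideal_gen (var ` V)) \<and> (\<forall>s. homogeneous (c - 1) (t s))"
proof -
  obtain t g where tg: "\<And>s. f s - koszul_d t s - g s \<in> ideal_gen (var ` V)"
    "\<And>s. homogeneous c (g s)" "\<And>s m b. m \<in> keys (g s) \<Longrightarrow> b \<in> - V \<Longrightarrow> lookup m b = 0"
    using koszul_acyclic_mod_vars_aux[of "- V" V f c, OF _ _ assms(1,2)] by (simp del: Compl_iff) blast
  have "g s \<in> ideal_gen (var ` V)" for s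
    unfolding mem_var_ideal_iff
  proof
    fix m assume m: "m \<in> keys (g s)"
    then have "mdeg m > 0" using homogeneousD[OF tg(2)] assms(3) by auto
    then have "\<exists>i. lookup m i > 0"
      by (metis finite_UNIV mdeg_def not_gr_zero sum_eq_0_iff)
    then show "\<exists>i\<in>V. lookup m i > 0" using tg(3)[OF m] by force
  qed
  then have "f s - koszul_d t s \<in> ideal_gen (var ` V)" for s
    using ring_module.span_add[OF tg(1)[of s], of "g s"] by simp
  then have "hpart c (f s - koszul_d t s) \<in> ideal_gen (var ` V)" for s
    by (rule hpart_mem_var_ideal)
  moreover have "hpart c (f s - koszul_d t s) = f s - koszul_d (\<lambda>s. hpart (c - 1) (t s)) s" for s
  proof -
    have "hpart c (koszul_d t s) = koszul_d (\<lambda>s. hpart (c - 1) (t s)) s"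
      using hpart_koszul_d[of "c - 1" t s] assms(3) by simp
    then show ?thesis
      using hpart_id[OF assms(2), of s]
      by (simp add: hpart_def restrict_poly_add restrict_poly_minus diff_conv_add_uminus del: add_uminus_conv_diff)
  qed
  ultimately show ?thesis by (intro exI[of _ "\<lambda>s. hpart (c - 1) (t s)"]) auto
qed

lemma koszul_acyclic:
  fixes f :: "('n::{finite,linorder}, 'k::field) chain"
  assumes "koszul_d f = (\<lambda>s. 0)" "\<And>s. homogeneous c (f s)" "c > 0"
  shows "\<exists>t. koszul_d t = f \<and> (\<forall>s. homogeneous (c - 1) (t s))"
proof -
  obtain t where t: "\<And>s. f s - koszul_d t s \<in> ideal_gen (var ` {})" "\<And>s. homogeneous (c - 1) (t s)"
    using koszul_acyclic_mod_vars[of f "{}" c] assms by (auto simp: ring_module.span_zero)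
  have "f s = koszul_d t s" for s using t(1)[of s] by simp
  then show ?thesis using t(2) by (intro exI[of _ t]) auto
qed

section \<open>Koszul-linear modules and ideals\<close>

text \<open>
  For a graded submodule \<open>N\<close> of a free module that is zero below degree \<open>e\<close>, this is the condition that
  \<open>Tor\<^sub>i(N, k)\<close> is concentrated in degree \<open>i + e\<close>: the degree of a chain at \<open>e\<^sub>s\<close> is the degree of its
  coefficient plus the cardinality of \<open>s\<close>, so that \<open>c > e\<close> describes the degrees in which homology must
  vanish. Elements of free modules are sequences of coordinates that vanish from the rank on.
\<close>

definition koszul_linear :: "nat \<Rightarrow> (nat \<Rightarrow> ('n::{finite,linorder}, 'k::field) poly_ring) set \<Rightarrow> bool" where
  "koszul_linear e N \<longleftrightarrow> (\<forall>c>e. \<forall>z :: nat \<Rightarrow> ('n, 'k) chain.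
     (\<forall>s. (\<lambda>j. z j s) \<in> N) \<and> (\<forall>j s. homogeneous c (z j s)) \<and> (\<forall>j s. koszul_d (z j) s = 0) \<longrightarrow>
     (\<exists>y. (\<forall>s. (\<lambda>j. y j s) \<in> N) \<and> (\<forall>j s. koszul_d (y j) s = z j s)))"

definition koszul_linear_ideal :: "nat \<Rightarrow> ('n::{finite,linorder}, 'k::field) poly_ring set \<Rightarrow> bool" where
  "koszul_linear_ideal e I \<longleftrightarrow> (\<forall>c>e. \<forall>z :: ('n, 'k) chain.
     (\<forall>s. z s \<in> I) \<and> (\<forall>s. homogeneous c (z s)) \<and> (\<forall>s. koszul_d z s = 0) \<longrightarrow>
     (\<exists>y. (\<forall>s. y s \<in> I) \<and> (\<forall>s. koszul_d y s = z s)))"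

lemma koszul_linear_idealD:
  fixes z :: "('n::{finite,linorder}, 'k::field) chain"
  assumes "koszul_linear_ideal e I" "c > e" "\<And>s. z s \<in> I" "\<And>s. homogeneous c (z s)"
    "\<And>s. koszul_d z s = 0"
  obtains y where "\<And>s. y s \<in> I" "\<And>s. koszul_d y s = z s"
  using assms unfolding koszul_linear_ideal_def by metis

definition ideal_vectors :: "('n, 'k::field) poly_ring set \<Rightarrow> (nat \<Rightarrow> ('n, 'k) poly_ring) set" where
  "ideal_vectors I = {f. f 0 \<in> I \<and> (\<forall>j>0. f j = 0)}"

lemma koszul_linear_ideal_vectors_iff:
  fixes I :: "('n::{finite,linorder}, 'k::field) poly_ring set"
  assumes "0 \<in> I"
  shows "koszul_linear e (ideal_vectors I) \<longleftrightarrow> koszul_linear_ideal e I"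
proof
  assume L: "koszul_linear e (ideal_vectors I)"
  show "koszul_linear_ideal e I"
    unfolding koszul_linear_ideal_def
  proof (intro allI impI, elim conjE)
    fix c and z :: "('n, 'k) chain"
    assume "e < c" and z: "\<forall>s. z s \<in> I" "\<forall>s. homogeneous c (z s)" "\<forall>s. koszul_d z s = 0"
    define z' where "z' = (\<lambda>j::nat. if j = 0 then z else (\<lambda>s. 0))"
    have "\<exists>y. (\<forall>s. (\<lambda>j. y j s) \<in> ideal_vectors I) \<and> (\<forall>j s. koszul_d (y j) s = z' j s)"
      using L \<open>e < c\<close> z unfolding koszul_linear_def
      by (elim allE[of _ c] impE allE[of _ z']) (auto simp: z'_def ideal_vectors_def)
    then obtain y where y: "\<And>s. (\<lambda>j. y j s) \<in> ideal_vectors I" "\<And>j s. koszul_d (y j) s = z' j s"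
      by blast
    have "\<And>s. y 0 s \<in> I" "\<And>s. koszul_d (y 0) s = z s"
      using y by (simp_all add: z'_def ideal_vectors_def)
    then show "\<exists>y. (\<forall>s. y s \<in> I) \<and> (\<forall>s. koszul_d y s = z s)" by blast
  qed
next
  assume L: "koszul_linear_ideal e I"
  show "koszul_linear e (ideal_vectors I)"
    unfolding koszul_linear_def
  proof (intro allI impI, elim conjE)
    fix c and z :: "nat \<Rightarrow> ('n, 'k) chain"
    assume "e < c" and z: "\<forall>s. (\<lambda>j. z j s) \<in> ideal_vectors I" "\<forall>j s. homogeneous c (z j s)"
      "\<forall>j s. koszul_d (z j) s = 0"
    obtain y where y: "\<And>s. y s \<in> I" "\<And>s. koszul_d y s = z 0 s"
      by (rule koszul_linear_idealD[OF L \<open>e < c\<close>, of "z 0"]) (use z in \<open>auto simp: ideal_vectors_def\<close>)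
    have "z j s = 0" if "j > 0" for j s
      using z(1) that by (auto simp: ideal_vectors_def)
    then have "(\<forall>s. (\<lambda>j. (if j = 0 then y else (\<lambda>s. 0)) s) \<in> ideal_vectors I) \<and>
        (\<forall>j s. koszul_d (if j = 0 then y else (\<lambda>s. 0)) s = z j s)"
      using y by (auto simp: ideal_vectors_def)
    then show "\<exists>y. (\<forall>s. (\<lambda>j. y j s) \<in> ideal_vectors I) \<and> (\<forall>j s. koszul_d (y j) s = z j s)"
      by (intro exI[of _ "\<lambda>j::nat. if j = 0 then y else (\<lambda>s. 0)"]) auto
  qed
qed

section \<open>Linear quotients imply Koszul-linearity\<close>

text \<open>
  A cycle over \<open>J + (u)\<close> is \<open>z = z' + u w\<close> with \<open>z'\<close> over \<open>J\<close>. The boundary of \<open>w\<close> is then a chain over the colon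
  ideal \<open>J : u\<close>, which is generated by variables, so \<open>w\<close> is a boundary up to a chain over \<open>J : u\<close>.
  Subtracting this boundary turns \<open>z\<close> into a cycle over \<open>J\<close>.
\<close>

lemma koszul_linear_ideal_insert:
  fixes u :: "'n::{finite,linorder} monomial"
  assumes lin: "koszul_linear_ideal e (ideal_gen (mon ` A) :: ('n, 'k::field) poly_ring set)"
    and colon: "colon (ideal_gen (mon ` A)) (mon u) = (ideal_gen (var ` V) :: ('n, 'k) poly_ring set)"
    and deg: "mdeg u \<le> e"
  shows "koszul_linear_ideal e (ideal_gen (mon ` insert u A) :: ('n, 'k) poly_ring set)"
  unfolding koszul_linear_ideal_def
proof (intro allI impI, elim conjE)
  let ?J = "ideal_gen (mon ` A) :: ('n, 'k) poly_ring set"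
  fix c and z :: "('n, 'k) chain"
  assume "e < c" and z: "\<forall>s. z s \<in> ideal_gen (mon ` insert u A)" "\<forall>s. homogeneous c (z s)"
    "\<forall>s. koszul_d z s = 0"
  obtain w0 where w0: "z s - w0 s * mon u \<in> ?J" for s
  proof -
    have "\<exists>k. z s - k * mon u \<in> ?J" for s
      using z(1) by (simp add: ring_module.span_insert)
    then show ?thesis using that by metis
  qed
  define w where "w = (\<lambda>s. hpart (c - mdeg u) (w0 s))"
  have w: "z s - mon u * w s \<in> ?J" for s
  proof -
    have "hpart c (mon u * w0 s) = mon u * w s"
      unfolding w_def using hpart_mult[OF homogeneous_mon, of u "c - mdeg u" "w0 s"] \<open>e < c\<close> deg
      by simp
    then have "z s - mon u * w s = hpart c (z s - w0 s * mon u)"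
      using hpart_id[of c "z s"] z(2)
      by (simp add: hpart_def restrict_poly_add restrict_poly_minus diff_conv_add_uminus mult.commute
          del: add_uminus_conv_diff)
    then show ?thesis using w0 by (simp add: hpart_mem_monomial_ideal)
  qed
  have kdw: "koszul_d w s \<in> ideal_gen (var ` V)" for s
  proof -
    have "koszul_d (\<lambda>s. z s - mon u * w s) s \<in> ?J"
      unfolding koszul_d_def by (intro ring_module.span_sum ring_module.span_scale w)
    then have "- (mon u * koszul_d w s) \<in> ?J" using z(3) by (simp add: koszul_d_diff koszul_d_mult)
    then have "mon u * koszul_d w s \<in> ?J" using ring_module.span_neg by fastforce
    then show ?thesis by (simp add: colon_def mult.commute flip: colon)
  qed
  obtain t where t: "\<And>s. w s - koszul_d t s \<in> ideal_gen (var ` V)"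
    and ht: "\<And>s. homogeneous (c - mdeg u - 1) (t s)"
    using koszul_acyclic_mod_vars[of w V "c - mdeg u"] kdw \<open>e < c\<close> deg by (auto simp: w_def)
  define t' where "t' = (\<lambda>s. mon u * t s)"
  define z1 where "z1 = (\<lambda>s. z s - koszul_d t' s)"
  have "z1 s \<in> ?J" for s
  proof -
    have "(w s - koszul_d t s) * mon u \<in> ?J"
      using t[of s] by (simp add: colon_def flip: colon)
    then have "(z s - mon u * w s) + (w s - koszul_d t s) * mon u \<in> ?J"
      using w ring_module.span_add by blast
    moreover have "z1 s = (z s - mon u * w s) + (w s - koszul_d t s) * mon u"
      by (simp add: z1_def t'_def koszul_d_mult algebra_simps)
    ultimately show ?thesis by simp
  qed
  moreover have "homogeneous c (z1 s)" for s
  proof -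
    have "homogeneous (mdeg u + (c - mdeg u - 1)) (t' s)" for s
      unfolding t'_def by (intro homogeneous_mult homogeneous_mon ht)
    then have "homogeneous (Suc (mdeg u + (c - mdeg u - 1))) (koszul_d t' s)"
      by (rule homogeneous_koszul_d)
    then have "homogeneous c (koszul_d t' s)" using \<open>e < c\<close> deg by simp
    then show ?thesis
      unfolding z1_def diff_conv_add_uminus using z(2) by (intro homogeneous_add homogeneous_minus) auto
  qed
  moreover have "koszul_d z1 s = 0" for s
    using z(3) by (simp add: z1_def koszul_d_diff koszul_d_koszul_d)
  ultimately obtain y1 where y1: "\<And>s. y1 s \<in> ?J" "\<And>s. koszul_d y1 s = z1 s"
    using koszul_linear_idealD[OF lin \<open>e < c\<close>, of z1] by blast
  have sub: "?J \<subseteq> ideal_gen (mon ` insert u A)"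
    by (rule ring_module.span_mono) auto
  have "y1 s + t' s \<in> ideal_gen (mon ` insert u A)" for s
  proof (rule ring_module.span_add)
    show "y1 s \<in> ideal_gen (mon ` insert u A)" using y1(1) sub by blast
    show "t' s \<in> ideal_gen (mon ` insert u A)"
      unfolding t'_def mult.commute[of "mon u"]
      by (intro ring_module.span_scale ring_module.span_base) simp
  qed
  moreover have "koszul_d (\<lambda>s. y1 s + t' s) s = z s" for s
    by (simp add: koszul_d_add y1(2) z1_def)
  ultimately show "\<exists>y. (\<forall>s. y s \<in> ideal_gen (mon ` insert u A)) \<and> (\<forall>s. koszul_d y s = z s)"
    by (intro exI[of _ "\<lambda>s. y1 s + t' s"]) auto
qed

lemma min_gens_equigenerated:
  assumes deg: "\<And>m. m \<in> A \<Longrightarrow> mdeg m = e"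
  shows "min_gens (ideal_gen (mon ` A) :: ('n::finite, 'k::field) poly_ring set) = A"
proof (intro equalityI subsetI)
  fix m assume "m \<in> min_gens (ideal_gen (mon ` A) :: ('n, 'k) poly_ring set)"
  then have m: "\<exists>a\<in>A. mdvd a m" "\<And>m'. \<exists>a\<in>A. mdvd a m' \<Longrightarrow> mdvd m' m \<Longrightarrow> m' = m"
    unfolding min_gens_def by (simp_all add: mon_mem_monomial_ideal_iff mon_dvd_mon_iff)
  then obtain a where a: "a \<in> A" "mdvd a m" by blast
  have "a = m" by (rule m(2)) (use a mdvd_refl in blast)+
  then show "m \<in> A" using a by simp
next
  fix m assume m: "m \<in> A"
  have "m' = m" if "a \<in> A" "mdvd a m'" "mdvd m' m" for a m'
  proof -
    have "mdeg a = mdeg m" using deg that(1) m by simp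
    then have "mdeg m \<le> mdeg m'" using mdeg_mono[OF that(2)] by simp
    then show ?thesis using that(3) by (intro mdvd_eq_if_mdeg_le)
  qed
  then show "m \<in> min_gens (ideal_gen (mon ` A) :: ('n, 'k) poly_ring set)"
    using m unfolding min_gens_def
    by (auto simp: mon_mem_monomial_ideal_iff mon_dvd_mon_iff intro: bexI[of _ m])
qed

lemma linear_quotients_imp_koszul_linear:
  fixes A :: "'n::{finite,linorder} monomial set"
  assumes lq: "has_linear_quotients (ideal_gen (mon ` A) :: ('n, 'k::field) poly_ring set)"
    and deg: "\<And>m. m \<in> A \<Longrightarrow> mdeg m = e"
  shows "koszul_linear_ideal e (ideal_gen (mon ` A) :: ('n, 'k) poly_ring set)"
proof -
  obtain us where us: "set us = A" and
    quot: "\<And>i. 1 \<le> i \<Longrightarrow> i < length us \<Longrightarrow>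
      \<exists>V. colon (ideal_gen (mon ` set (take i us))) (mon (us ! i)) =
        (ideal_gen (var ` V) :: ('n, 'k) poly_ring set)"
    using lq unfolding has_linear_quotients_def
    by (simp add: min_gens_equigenerated[OF deg]) blast
  (* The first generator fits the pattern of the others: the zero ideal has the colon ideal 0,
     generated by the empty set of variables. *)
  have "koszul_linear_ideal e (ideal_gen (mon ` set (take i us)) :: ('n, 'k) poly_ring set)"
    if "i \<le> length us" for i
    using that
  proof (induction i)
    case 0
    then show ?case by (auto simp: koszul_linear_ideal_def intro!: exI[of _ "\<lambda>s. 0"])
  next
    case (Suc i)
    have "\<exists>V. colon (ideal_gen (mon ` set (take i us))) (mon (us ! i)) =
        (ideal_gen (var ` V) :: ('n, 'k) poly_ring set)"
    proof (cases "i = 0")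
      case True
      have "mon (us ! i) \<noteq> (0 :: ('n, 'k) poly_ring)"
        by (metis keys_mon keys_zero insert_not_empty)
      then have "colon (ideal_gen {}) (mon (us ! i)) = (ideal_gen (var ` {}) :: ('n, 'k) poly_ring set)"
        by (simp add: colon_def)
      then show ?thesis using True by (intro exI[of _ "{}"]) simp
    next
      case False
      then show ?thesis using quot Suc.prems by simp
    qed
    then obtain V where V: "colon (ideal_gen (mon ` set (take i us))) (mon (us ! i)) =
        (ideal_gen (var ` V) :: ('n, 'k) poly_ring set)" by blast
    moreover have "set (take (Suc i) us) = insert (us ! i) (set (take i us))"
      using Suc.prems by (auto simp: take_Suc_conv_app_nth)
    moreover have "mdeg (us ! i) \<le> e" using us deg Suc.prems by auto
    moreover have "koszul_linear_ideal e (ideal_gen (mon ` set (take i us)) :: ('n, 'k) poly_ring set)"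
      using Suc by simp
    ultimately show ?case by (simp only: koszul_linear_ideal_insert)
  qed
  from this[of "length us"] show ?thesis using us by simp
qed

section \<open>A criterion for nonlinear syzygies\<close>

text \<open>
  The cycle is the boundary of \<open>g e\<^sub>S\<close>, whose coefficients \<open>\<plusminus> x\<^sub>a g\<close> lie in the ideal. If it is the boundary of a
  chain over the ideal, then the monomial \<open>x\<^sub>a\<^sub>0 g\<close> in its coefficient at \<open>S - {a0}\<close> must come from some
  variable \<open>b\<close> outside this set, that is from a monomial \<open>x\<^sub>a\<^sub>0 g / x\<^sub>b\<close> of the ideal. For
  \<open>b = a0\<close> this would be \<open>g\<close> itself.
\<close>

lemma koszul_linear_obstruction:
  fixes g :: "'n::{finite,linorder} monomial"
  assumes lin: "koszul_linear_ideal e (ideal_gen (mon ` L) :: ('n, 'k::field) poly_ring set)"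
    and deg: "e \<le> mdeg g"
    and mem: "\<And>a. a \<in> S \<Longrightarrow> \<exists>w\<in>L. mdvd w (xv a + g)"
    and a0: "a0 \<in> S"
  shows "\<exists>b h. b \<notin> S - {a0} \<and> xv a0 + g = xv b + h \<and> (\<exists>w\<in>L. mdvd w h)"
proof -
  define f :: "('n, 'k) chain" where "f = (\<lambda>s. if s = S then mon g else 0)"
  have kdf: "koszul_d f s = (if \<exists>a. a \<notin> s \<and> insert a s = S
      then koszul_sign (SOME a. a \<notin> s \<and> insert a s = S) s * mon (xv (SOME a. a \<notin> s \<and> insert a s = S) + g)
      else 0)" for s
  proof (cases "\<exists>a. a \<notin> s \<and> insert a s = S")
    case True
    define b where "b = (SOME a. a \<notin> s \<and> insert a s = S)"
    have b: "b \<notin> s" "insert b s = S" using someI_ex[OF True] by (simp_all add: b_def)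
    have "koszul_d f s = (\<Sum>a\<in>- s. if a = b then koszul_sign b s * mon (xv b + g) else 0)"
      unfolding koszul_d_def
    proof (rule sum.cong)
      fix a assume "a \<in> - s"
      then have "insert a s = S \<longleftrightarrow> a = b" using b by auto
      then show "koszul_sign a s * (var a * f (insert a s)) =
          (if a = b then koszul_sign b s * mon (xv b + g) else 0)"
        by (simp add: f_def var_eq_mon mon_add)
    qed simp
    then show ?thesis using True b by (simp add: b_def sum.delta)
  next
    case False
    then show ?thesis by (auto simp: koszul_d_def f_def intro!: sum.neutral)
  qed
  have "koszul_d f s \<in> ideal_gen (mon ` L)" for s
  proof (cases "\<exists>a. a \<notin> s \<and> insert a s = S")
    case True
    have "(SOME a. a \<notin> s \<and> insert a s = S) \<in> S" using someI_ex[OF True] by auto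
    then show ?thesis using True mem
      by (simp add: kdf ring_module.span_scale mon_mem_monomial_ideal_iff)
  next
    case False
    show ?thesis unfolding kdf if_not_P[OF False] by (rule ring_module.span_zero)
  qed
  moreover have "homogeneous (Suc (mdeg g)) (koszul_d f s)" for s
    by (rule homogeneous_koszul_d) (auto simp: f_def)
  ultimately obtain y where y: "\<And>s. y s \<in> ideal_gen (mon ` L)" "\<And>s. koszul_d y s = koszul_d f s"
    using koszul_linear_idealD[OF lin, of "Suc (mdeg g)" "koszul_d f"] deg by (auto simp: koszul_d_koszul_d)
  define F where "F = S - {a0}"
  have "(SOME a. a \<notin> F \<and> insert a F = S) = a0"
    by (rule some_equality) (use a0 in \<open>auto simp: F_def\<close>)
  moreover have "\<exists>a. a \<notin> F \<and> insert a F = S"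
    by (rule exI[of _ a0]) (use a0 in \<open>auto simp: F_def\<close>)
  ultimately have "koszul_d f F = koszul_sign a0 F * mon (xv a0 + g)"
    using kdf[of F] by simp
  then have "lookup (koszul_d y F) (xv a0 + g) \<noteq> 0"
    by (simp add: y(2) lookup_koszul_sign_mult_eq_0 lookup_mon)
  then have "(\<Sum>b\<in>- F. lookup (koszul_sign b F * (var b * y (insert b F))) (xv a0 + g)) \<noteq> 0"
    by (simp add: koszul_d_def lookup_sum)
  then obtain b where b: "b \<notin> F" "lookup (koszul_sign b F * (var b * y (insert b F))) (xv a0 + g) \<noteq> 0"
    by (metis (no_types, lifting) ComplD sum.neutral)
  then have *: "mdvd (xv b) (xv a0 + g)" "lookup (y (insert b F)) (xv a0 + g - xv b) \<noteq> 0"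
    by (auto simp: lookup_koszul_sign_mult_eq_0 var_eq_mon lookup_mon_mult split: if_splits)
  then have "\<exists>w\<in>L. mdvd w (xv a0 + g - xv b)"
    using y(1)[of "insert b F"] by (auto simp: mem_monomial_ideal_iff in_keys_iff)
  then show ?thesis
    using b(1) add_diff_monomial[OF *(1)] unfolding F_def by metis
qed

section \<open>Linear resolutions imply Koszul-linearity\<close>

lemma koszul_linear_ideal_mono:
  "koszul_linear_ideal e I \<Longrightarrow> e \<le> e' \<Longrightarrow> koszul_linear_ideal e' I"
  unfolding koszul_linear_ideal_def by (meson le_less_trans)

text \<open>
  The chase through the double complex of the Koszul complex and the resolution, for all images
  \<open>N\<^sub>l\<close> of the maps \<open>A l\<close> simultaneously. A Koszul cycle \<open>z\<close> over \<open>N\<^sub>l\<close> is lifted to a chain \<open>f\<close> of the free module.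
  The boundary of \<open>f\<close> is a cycle over the kernel \<open>N\<^sub>l\<^sub>+\<^sub>1\<close> on smaller index sets, hence by induction the boundary
  of a chain \<open>p\<close> over \<open>N\<^sub>l\<^sub>+\<^sub>1\<close>. The cycle \<open>f - p\<close> of the free module is a boundary as its coefficients
  have positive degree, and it is still a lift of \<open>z\<close>. The induction is on a strict bound \<open>i\<close> for the size of
  the index sets on which \<open>z\<close> does not vanish, so that the base case is \<open>z = 0\<close>.
\<close>

lemma exact_linear_complex_koszul_boundary:
  fixes A :: "nat \<Rightarrow> nat \<Rightarrow> nat \<Rightarrow> ('n::{finite,linorder}, 'k::field) poly_ring"
  assumes hom: "\<And>l r j. homogeneous (e l) (A l r j)"
    and e: "\<And>l. e (Suc l) = 1"
    and rows: "\<And>l r j. r \<ge> b l \<Longrightarrow> A (Suc l) r j = 0"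
    and exact: "\<And>l f. (\<And>r. (\<Sum>j<b l. A l r j * f j) = 0) \<Longrightarrow>
      \<exists>g. \<forall>r<b l. f r = (\<Sum>j<b (Suc l). A (Suc l) r j * g j)"
    and complex: "\<And>l r g. (\<Sum>j<b l. A l r j * (\<Sum>i<b (Suc l). A (Suc l) j i * g i)) = 0"
  shows "\<lbrakk>c > e l; \<And>s. \<exists>f. \<forall>r. z r s = (\<Sum>j<b l. A l r j * f j); \<And>r s. homogeneous c (z r s);
      \<And>r s. card s \<ge> i \<Longrightarrow> z r s = 0; \<And>r s. koszul_d (z r) s = 0\<rbrakk> \<Longrightarrow>
    \<exists>y. \<forall>r s. z r s = koszul_d (\<lambda>s. \<Sum>j<b l. A l r j * y j s) s"
proof (induction i arbitrary: l z c)
  case 0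
  then show ?case by (intro exI[of _ "\<lambda>j s. 0"]) simp
next
  case (Suc i)
  note ce = Suc.prems(1) and mem = Suc.prems(2) and zhom = Suc.prems(3) and supp = Suc.prems(4)
    and cyc = Suc.prems(5)
  obtain f where f: "\<And>s r. z r s = (\<Sum>j<b l. A l r j * f s j)"
    using mem by metis
  define f' where "f' = (\<lambda>j s. if card s \<ge> Suc i then 0 else hpart (c - e l) (f s j))"
  have hf': "homogeneous (c - e l) (f' j s)" for j s
    by (simp add: f'_def)
  have zf': "z r s = (\<Sum>j<b l. A l r j * f' j s)" for r s
  proof (cases "card s \<ge> Suc i")
    case True
    then show ?thesis using supp by (simp add: f'_def)
  next
    case False
    have "z r s = hpart c (\<Sum>j<b l. A l r j * f s j)"
      using hpart_id[OF zhom, of r s] by (simp flip: f)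
    also have "\<dots> = (\<Sum>j<b l. hpart (e l + (c - e l)) (A l r j * f s j))"
      using ce by (simp add: hpart_def restrict_poly_sum)
    also have "\<dots> = (\<Sum>j<b l. A l r j * f' j s)"
      using False by (simp add: hpart_mult[OF hom] f'_def)
    finally show ?thesis .
  qed
  define w where "w = (\<lambda>j s. if j < b l then koszul_d (f' j) s else 0)"
  have koszul_d_z: "koszul_d (z r) s = (\<Sum>j<b l. A l r j * koszul_d (f' j) s)" for r s
  proof -
    have "z r = (\<lambda>s. \<Sum>j<b l. A l r j * f' j s)" using zf' by auto
    then show ?thesis by (simp add: koszul_d_sum koszul_d_mult)
  qed
  have "\<exists>y. \<forall>r s. w r s = koszul_d (\<lambda>s. \<Sum>j<b (Suc l). A (Suc l) r j * y j s) s"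
  proof (rule Suc.IH)
    show "e (Suc l) < Suc (c - e l)" using ce e by simp
    show "\<exists>g. \<forall>r. w r s = (\<Sum>j<b (Suc l). A (Suc l) r j * g j)" for s
    proof -
      have "(\<Sum>j<b l. A l r j * w j s) = 0" for r
        using koszul_d_z[of r s] cyc by (simp add: w_def)
      then obtain g where g: "\<forall>r<b l. w r s = (\<Sum>j<b (Suc l). A (Suc l) r j * g j)"
        using exact[of l "\<lambda>j. w j s"] by blast
      have "w r s = (\<Sum>j<b (Suc l). A (Suc l) r j * g j)" for r
        by (cases "r < b l") (use g rows in \<open>auto simp: w_def\<close>)
      then show ?thesis by blast
    qed
    show "homogeneous (Suc (c - e l)) (w r s)" for r s
      by (simp add: w_def homogeneous_koszul_d hf')
    show "w r s = 0" if "card s \<ge> i" for r s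
      using koszul_d_support[of i "f' r" s] that by (auto simp: w_def f'_def)
    show "koszul_d (w r) s = 0" for r s
    proof (cases "r < b l")
      case True
      then have "w r = koszul_d (f' r)" by (auto simp: w_def)
      then show ?thesis by (simp add: koszul_d_koszul_d)
    qed (simp add: w_def)
  qed
  then obtain y' where y': "\<And>r s. w r s = koszul_d (\<lambda>s. \<Sum>j<b (Suc l). A (Suc l) r j * y' j s) s"
    by blast
  define y where "y = (\<lambda>j s. hpart (c - e l - 1) (y' j s))"
  define p where "p = (\<lambda>r s. \<Sum>j<b (Suc l). A (Suc l) r j * y j s)"
  have hom_p: "homogeneous (c - e l) (p r s)" for r s
  proof -
    have "homogeneous (1 + (c - e l - 1)) (A (Suc l) r j * y j s)" for j
      using hom[of "Suc l" r j] e[of l] by (intro homogeneous_mult) (simp_all add: y_def)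
    moreover have "1 + (c - e l - 1) = c - e l" using ce by simp
    ultimately show ?thesis by (simp only: p_def homogeneous_sum)
  qed
  have wp: "w r s = koszul_d (p r) s" for r s
  proof -
    have "homogeneous (Suc (c - e l)) (w r s)"
      by (simp add: w_def homogeneous_koszul_d hf')
    then have "w r s = koszul_d (\<lambda>s. hpart (c - e l) (\<Sum>j<b (Suc l). A (Suc l) r j * y' j s)) s"
      by (simp only: hpart_koszul_d[symmetric] y'[symmetric] hpart_id)
    also have "(\<lambda>s. hpart (c - e l) (\<Sum>j<b (Suc l). A (Suc l) r j * y' j s)) = p r"
    proof
      fix s
      have "hpart (1 + (c - e l - 1)) (A (Suc l) r j * y' j s) = A (Suc l) r j * y j s" for j
        unfolding y_def by (rule hpart_mult) (use hom[of "Suc l" r j] e[of l] in simp)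
      moreover have "1 + (c - e l - 1) = c - e l" using ce by simp
      ultimately have "hpart (c - e l) (A (Suc l) r j * y' j s) = A (Suc l) r j * y j s" for j
        by (simp only:)
      then show "hpart (c - e l) (\<Sum>j<b (Suc l). A (Suc l) r j * y' j s) = p r s"
        by (simp add: p_def hpart_def restrict_poly_sum)
    qed
    finally show ?thesis .
  qed
  have "\<exists>t. koszul_d t = (\<lambda>s. f' j s - p j s)" if "j < b l" for j
  proof -
    have "koszul_d (\<lambda>s. f' j s - p j s) s = 0" for s
      using wp[of j s] that by (simp add: koszul_d_diff w_def)
    moreover have "homogeneous (c - e l) (f' j s - p j s)" for s
      unfolding diff_conv_add_uminus by (intro homogeneous_add homogeneous_minus hf' hom_p)
    ultimately show ?thesis
      using koszul_acyclic[of "\<lambda>s. f' j s - p j s" "c - e l"] ce by auto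
  qed
  then obtain t where t: "\<And>j s. j < b l \<Longrightarrow> koszul_d (t j) s = f' j s - p j s"
    by metis
  have "z r s = koszul_d (\<lambda>s. \<Sum>j<b l. A l r j * t j s) s" for r s
  proof -
    have "(\<Sum>j<b l. A l r j * (f' j s - p j s)) = z r s"
      using complex[of l r "\<lambda>i. y i s"] by (simp add: right_diff_distrib sum_subtractf zf' p_def)
    then show ?thesis by (simp add: koszul_d_sum koszul_d_mult t)
  qed
  then show ?case by blast
qed

lemma mult_mat_vec_index:
  assumes "A \<in> carrier_mat nr nc" "r < nr" "f \<in> carrier_vec nc"
  shows "(A *\<^sub>v f) $ r = (\<Sum>j<nc. A $$ (r, j) * f $ j)"
  using assms by (auto simp: scalar_prod_def atLeast0LessThan intro!: sum.cong)

text \<open>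
  The definition of a linear resolution leaves the degree \<open>d\<close> of its generators open. An element
  \<open>mon u\<close> of the ideal bounds it from above, as \<open>u\<close> is divisible by a monomial of degree \<open>d\<close>.
\<close>

lemma linear_resolution_imp_koszul_linear:
  fixes I :: "('n::{finite,linorder}, 'k::field) poly_ring set"
  assumes lin: "has_linear_resolution I" and u: "mon u \<in> I" "mdeg u \<le> e"
  shows "koszul_linear_ideal e I"
proof -
  obtain d s M where res: "minimal_graded_free_resolution s M I"
    and s: "\<And>i c. c \<in> set (s i) \<Longrightarrow> c = d + i"
    using lin unfolding has_linear_resolution_def by blast
  define b where "b = (\<lambda>l. length (s l))"
  define nr where "nr = (\<lambda>l. case l of 0 \<Rightarrow> 1 | Suc l' \<Rightarrow> b l')"
  define dg where "dg = (\<lambda>l::nat. if l = 0 then d else 1)"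
  define A where "A = (\<lambda>l r j. if r < nr l \<and> j < b l then M l $$ (r, j) else 0)"
  have M0: "graded_matrix [0] (s 0) (M 0)"
    and MS: "\<And>i. graded_matrix (s i) (s (Suc i)) (M (Suc i))"
    and img: "{(M 0 *\<^sub>v f) $ 0 | f. f \<in> carrier_vec (b 0)} = I"
    and ker: "\<And>i. mat_kernel (M i) = {M (Suc i) *\<^sub>v f | f. f \<in> carrier_vec (b (Suc i))}"
    using res unfolding minimal_graded_free_resolution_def b_def by blast+
  have carr: "M l \<in> carrier_mat (nr l) (b l)" for l
    using M0 MS by (cases l) (simp_all add: graded_matrix_def nr_def b_def)
  have sn: "s l ! j = d + l" if "j < b l" for j l
    using s[of "s l ! j" l] that by (auto simp: b_def)
  have homA: "homogeneous (dg l) (A l r j)" for l r j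
  proof (cases "r < nr l \<and> j < b l")
    case True
    show ?thesis
    proof (rule homogeneousI)
      fix m assume m: "m \<in> keys (A l r j)"
      show "mdeg m = dg l"
      proof (cases l)
        case 0
        then have "mdeg m + [0] ! r = s 0 ! j"
          using M0 m True by (simp add: graded_matrix_def nr_def b_def A_def)
        then show ?thesis using 0 True sn[of j 0] by (simp add: dg_def nr_def)
      next
        case (Suc k)
        then have "mdeg m + s k ! r = s (Suc k) ! j"
          using MS[of k] m True by (simp add: graded_matrix_def nr_def b_def A_def)
        then show ?thesis using Suc True sn[of j "Suc k"] sn[of r k] by (simp add: dg_def nr_def)
      qed
    qed
  next
    case False
    then show ?thesis unfolding A_def if_not_P[OF False] by simp
  qed
  have mv: "(M l *\<^sub>v f) $ r = (\<Sum>j<b l. A l r j * f $ j)"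
    if "f \<in> carrier_vec (b l)" "r < nr l" for l f r
    using mult_mat_vec_index[OF carr that(2,1)] that(2) by (simp add: A_def)
  have memI: "x \<in> I \<longleftrightarrow> (\<exists>g. x = (\<Sum>j<b 0. A 0 0 j * g j))" for x
  proof
    assume "x \<in> I"
    then obtain f where f: "f \<in> carrier_vec (b 0)" "x = (M 0 *\<^sub>v f) $ 0" using img by blast
    then show "\<exists>g. x = (\<Sum>j<b 0. A 0 0 j * g j)"
      using mv[of f 0 0] by (auto simp: nr_def)
  next
    assume "\<exists>g. x = (\<Sum>j<b 0. A 0 0 j * g j)"
    then obtain g where g: "x = (\<Sum>j<b 0. A 0 0 j * g j)" by blast
    have "x = (M 0 *\<^sub>v vec (b 0) g) $ 0"
      using mv[of "vec (b 0) g" 0 0] by (simp add: nr_def g)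
    then show "x \<in> I" using img by auto
  qed
  have exact: "\<exists>g. \<forall>r<b l. f r = (\<Sum>j<b (Suc l). A (Suc l) r j * g j)"
    if "\<And>r. (\<Sum>j<b l. A l r j * f j) = 0" for l f
  proof -
    have "M l *\<^sub>v vec (b l) f = 0\<^sub>v (nr l)"
      using mv[of "vec (b l) f" l] that carr[of l] by (intro eq_vecI) auto
    then have "vec (b l) f \<in> mat_kernel (M l)"
      using carr[of l] by (simp add: mat_kernel_def)
    then obtain g where g: "g \<in> carrier_vec (b (Suc l))" "vec (b l) f = M (Suc l) *\<^sub>v g"
      using ker[of l] by auto
    have "f r = (\<Sum>j<b (Suc l). A (Suc l) r j * g $ j)" if "r < b l" for r
    proof -
      have "f r = vec (b l) f $ r" using that by simp
      also have "\<dots> = (M (Suc l) *\<^sub>v g) $ r" using g(2) by simp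
      also have "\<dots> = (\<Sum>j<b (Suc l). A (Suc l) r j * g $ j)"
        using mv[OF g(1), of r] that by (simp add: nr_def)
      finally show ?thesis .
    qed
    then show ?thesis by (intro exI[of _ "\<lambda>j. g $ j"]) simp
  qed
  have complex: "(\<Sum>j<b l. A l r j * (\<Sum>i<b (Suc l). A (Suc l) j i * g i)) = 0" for l r g
  proof (cases "r < nr l")
    case True
    define v where "v = M (Suc l) *\<^sub>v vec (b (Suc l)) g"
    have v: "v \<in> mat_kernel (M l)" using ker[of l] by (auto simp: v_def)
    have vc: "v \<in> carrier_vec (b l)" and "M l *\<^sub>v v = 0\<^sub>v (nr l)"
      using mat_kernelD[OF carr v] by auto
    then have "(\<Sum>j<b l. A l r j * v $ j) = 0" using mv[OF vc True] True by simp
    moreover have "v $ j = (\<Sum>i<b (Suc l). A (Suc l) j i * g i)" if "j < b l" for j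
      using mv[of "vec (b (Suc l)) g" "Suc l" j] that by (simp add: v_def nr_def)
    ultimately show ?thesis by simp
  qed (simp add: A_def)
  have "d \<le> e"
  proof -
    obtain g where "mon u = (\<Sum>j<b 0. A 0 0 j * g j)" using memI u(1) by blast
    then have "(\<Sum>j<b 0. lookup (A 0 0 j * g j) u) \<noteq> 0"
      by (metis (no_types, lifting) lookup_mon lookup_sum sum.cong zero_neq_one)
    then obtain j where "lookup (A 0 0 j * g j) u \<noteq> 0" by (metis (no_types, lifting) sum.neutral)
    then obtain m1 m2 where "u = m1 + m2" "m1 \<in> keys (A 0 0 j)"
      using keys_mult[of "A 0 0 j" "g j"] by (auto simp: in_keys_iff)
    then have "d \<le> mdeg u" using homogeneousD[OF homA] by (auto simp: mdeg_add dg_def)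
    then show ?thesis using u(2) by simp
  qed
  have "koszul_linear_ideal d I"
    unfolding koszul_linear_ideal_def
  proof (intro allI impI, elim conjE)
    fix c and z :: "('n, 'k) chain"
    assume z: "d < c" "\<forall>s. z s \<in> I" "\<forall>s. homogeneous c (z s)" "\<forall>s. koszul_d z s = 0"
    define z' where "z' = (\<lambda>r::nat. if r = 0 then z else (\<lambda>s. 0))"
    have "\<exists>y. \<forall>r s. z' r s = koszul_d (\<lambda>s. \<Sum>j<b 0. A 0 r j * y j s) s"
    proof (rule exact_linear_complex_koszul_boundary[where e = dg and i = "Suc (card (UNIV :: 'n set))", OF homA _ _ exact complex])
      show "\<exists>f. \<forall>r. z' r s = (\<Sum>j<b 0. A 0 r j * f j)" for s
      proof -
        obtain f where f: "z s = (\<Sum>j<b 0. A 0 0 j * f j)" using z(2) memI by blast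
        then have "\<forall>r. z' r s = (\<Sum>j<b 0. A 0 r j * f j)"
          by (auto simp: z'_def A_def nr_def)
        then show ?thesis by blast
      qed
      show "z' r s = 0" if "Suc (card (UNIV :: 'n set)) \<le> card s" for r s
        using that card_mono[of UNIV s] by simp
    qed (use z in \<open>auto simp: dg_def z'_def A_def nr_def\<close>)
    then obtain y where y: "\<forall>r s. z' r s = koszul_d (\<lambda>s. \<Sum>j<b 0. A 0 r j * y j s) s" ..
    have "z s = koszul_d (\<lambda>s. \<Sum>j<b 0. A 0 0 j * y j s) s" for s
      using spec[OF spec[OF y, of 0], of s] unfolding z'_def if_P[OF refl] .
    moreover have "(\<Sum>j<b 0. A 0 0 j * y j s) \<in> I" for s
      unfolding memI by (rule exI[of _ "\<lambda>j. y j s"]) simp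
    ultimately show "\<exists>y. (\<forall>s. y s \<in> I) \<and> (\<forall>s. koszul_d y s = z s)"
      by (intro exI[of _ "\<lambda>s. \<Sum>j<b 0. A 0 0 j * y j s"]) simp
  qed
  then show ?thesis using \<open>d \<le> e\<close> by (rule koszul_linear_ideal_mono)
qed

section \<open>Koszul-linearity implies linear resolutions\<close>

lemma finite_Mon: "finite (Mon e :: 'n::finite monomial set)"
proof -
  have "lookup m i \<le> mdeg m" for m :: "'n monomial" and i
    unfolding mdeg_def by (rule member_le_sum) auto
  then have "lookup ` (Mon e :: 'n monomial set) \<subseteq> {f. \<forall>i. (i \<in> UNIV \<longrightarrow> f i \<in> {..e}) \<and> (i \<notin> UNIV \<longrightarrow> f i = 0)}"
    by (auto simp: Mon_def)
  then have "finite (lookup ` (Mon e :: 'n monomial set))"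
    by (rule finite_subset) (rule finite_set_of_finite_funs; simp)
  then show ?thesis
    by (rule finite_imageD) (auto intro!: inj_onI poly_mapping_eqI)
qed

definition graded_submodule :: "nat \<Rightarrow> (nat \<Rightarrow> ('n::finite, 'k::field) poly_ring) set \<Rightarrow> bool" where
  "graded_submodule r N \<longleftrightarrow> (\<forall>f\<in>N. \<forall>j\<ge>r. f j = 0) \<and> (\<lambda>j. 0) \<in> N \<and>
     (\<forall>f\<in>N. \<forall>g\<in>N. (\<lambda>j. f j + g j) \<in> N) \<and> (\<forall>p. \<forall>f\<in>N. (\<lambda>j. p * f j) \<in> N) \<and>
     (\<forall>c. \<forall>f\<in>N. (\<lambda>j. hpart c (f j)) \<in> N)"

lemma graded_submodule_sum:
  assumes "graded_submodule r N" "\<And>i. i \<in> A \<Longrightarrow> f i \<in> N"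
  shows "(\<lambda>j. \<Sum>i\<in>A. p i * f i j) \<in> N"
  using assms(2)
  by (induction A rule: infinite_finite_induct) (use assms(1) in \<open>auto simp: graded_submodule_def\<close>)

lemma graded_submodule_ideal_vectors:
  "graded_submodule 1 (ideal_vectors (ideal_gen (mon ` A) :: ('n::finite, 'k::field) poly_ring set))"
  unfolding graded_submodule_def ideal_vectors_def
  by (auto simp: ring_module.span_zero ring_module.span_add ring_module.span_scale
      hpart_mem_monomial_ideal) (simp_all add: hpart_def)

definition initial_degree_ge :: "nat \<Rightarrow> (nat \<Rightarrow> ('n::finite, 'k::field) poly_ring) set \<Rightarrow> bool" where
  "initial_degree_ge e N \<longleftrightarrow>
     (\<forall>f\<in>N. \<forall>c<e. (\<forall>j. homogeneous c (f j)) \<longrightarrow> f = (\<lambda>j. 0))"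

lemma sum_hpart:
  assumes "finite C" "mdeg ` keys p \<subseteq> C"
  shows "(\<Sum>c\<in>C. hpart c p) = p"
proof (rule poly_mapping_eqI)
  fix m
  have "lookup (\<Sum>c\<in>C. hpart c p) m = (\<Sum>c\<in>C. if mdeg m = c then lookup p m else 0)"
    by (simp add: lookup_sum hpart_def lookup_restrict_poly)
  also have "\<dots> = (if mdeg m \<in> C then lookup p m else 0)"
    using assms(1) by simp
  also have "\<dots> = lookup p m"
    using assms(2) not_in_keys_iff_lookup_eq_zero[of m p] by auto
  finally show "lookup (\<Sum>c\<in>C. hpart c p) m = lookup p m" .
qed

lemma homogeneous_0_eq: "homogeneous 0 p \<Longrightarrow> p = Poly_Mapping.single 0 (lookup p 0)"
  by (rule poly_mapping_eqI)
     (auto simp: lookup_single when_def homogeneous_def Mon_def in_keys_iff mdeg_eq_0_iff)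

lemma sum_fun_apply: "(\<Sum>a\<in>A. f a) x = (\<Sum>a\<in>A. f a x)"
  by (induction A rule: infinite_finite_induct) (simp_all add: zero_fun_def)

text \<open>
  A basis over \<open>k\<close> of the degree \<open>e\<close> part of a graded submodule. Both spanning and independence are
  phrased with polynomial coefficients, as they are applied to maps between free modules over \<open>S\<close>.
\<close>

lemma homogeneous_degree_basis:
  fixes N :: "(nat \<Rightarrow> ('n::{finite,linorder}, 'k::field) poly_ring) set"
  assumes N: "graded_submodule r N"
  obtains B where "finite B" "\<And>f j. f \<in> B \<Longrightarrow> homogeneous e (f j)" "B \<subseteq> N"
    "\<And>f. f \<in> N \<Longrightarrow> (\<And>j. homogeneous e (f j)) \<Longrightarrow> \<exists>u. \<forall>j. f j = (\<Sum>v\<in>B. u v * v j)"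
    "\<And>u v. (\<And>v. v \<in> B \<Longrightarrow> homogeneous 0 (u v)) \<Longrightarrow> (\<And>j. (\<Sum>v\<in>B. u v * v j) = 0) \<Longrightarrow>
      v \<in> B \<Longrightarrow> u v = 0"
proof -
  define sc :: "'k \<Rightarrow> (nat \<Rightarrow> ('n, 'k) poly_ring) \<Rightarrow> nat \<Rightarrow> ('n, 'k) poly_ring"
    where "sc = (\<lambda>c f j. Poly_Mapping.single 0 c * f j)"
  interpret vs: vector_space sc
    by unfold_locales
       (auto simp: sc_def algebra_simps single_add mult_single simp flip: mult.assoc)
  define W where "W = {f \<in> N. \<forall>j. homogeneous e (f j)}"
  obtain B where B: "B \<subseteq> W" "vs.independent B" "W \<subseteq> vs.span B"
    by (rule vs.maximal_independent_subset)
  define un where "un = (\<lambda>(i :: nat, m) j. if j = i then mon m else (0 :: ('n, 'k) poly_ring))"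
  define T where "T = un ` ({..<r} \<times> Mon e)"
  have "finite T" by (simp add: T_def finite_Mon)
  have "W \<subseteq> vs.span T"
  proof
    fix f assume f: "f \<in> W"
    have "f = (\<Sum>x\<in>{..<r} \<times> Mon e. sc (lookup (f (fst x)) (snd x)) (un x))"
    proof
      fix j
      have "(\<Sum>x\<in>{..<r} \<times> Mon e. sc (lookup (f (fst x)) (snd x)) (un x)) j
          = (\<Sum>i<r. \<Sum>m\<in>Mon e. if j = i then Poly_Mapping.single m (lookup (f i) m) else 0)"
        by (auto simp: sum_fun_apply sum.cartesian_product sc_def un_def mon_def mult_single
            case_prod_unfold intro!: sum.cong)
      also have "\<dots> = (\<Sum>i<r. if j = i then f i else 0)"
      proof (rule sum.cong)
        fix i
        have "(\<Sum>m\<in>Mon e. Poly_Mapping.single m (lookup (f i) m)) = f i"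
          by (subst (3) poly_eq_sum_singles, rule sum.mono_neutral_right)
             (use f in \<open>auto simp: finite_Mon W_def homogeneous_def in_keys_iff\<close>)
        then show "(\<Sum>m\<in>Mon e. if j = i then Poly_Mapping.single m (lookup (f i) m) else 0) =
            (if j = i then f i else 0)" by simp
      qed simp
      also have "\<dots> = f j"
        using f N by (auto simp: W_def graded_submodule_def)
      finally show "f j = (\<Sum>x\<in>{..<r} \<times> Mon e. sc (lookup (f (fst x)) (snd x)) (un x)) j" ..
    qed
    also have "\<dots> \<in> vs.span T"
      by (intro vs.span_sum vs.span_scale vs.span_base) (auto simp: T_def)
    finally show "f \<in> vs.span T" .
  qed
  then have fin: "finite B"
    using vs.independent_span_bound[OF \<open>finite T\<close> B(2)] B(1) by blast
  have spn: "\<exists>u. \<forall>j. f j = (\<Sum>v\<in>B. u v * v j)" if "f \<in> N" "\<And>j. homogeneous e (f j)" for f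
  proof -
    have "f \<in> vs.span B" using that B(3) by (auto simp: W_def)
    then obtain u where "f = (\<Sum>v\<in>B. sc (u v) v)"
      unfolding vs.span_finite[OF fin] by auto
    then have "\<forall>j. f j = (\<Sum>v\<in>B. Poly_Mapping.single 0 (u v) * v j)"
      by (simp add: sum_fun_apply sc_def)
    then show ?thesis by (rule exI[of _ "\<lambda>v. Poly_Mapping.single 0 (u v)"])
  qed
  have ind: "u v = 0" if u: "\<And>v. v \<in> B \<Longrightarrow> homogeneous 0 (u v)"
    and 0: "\<And>j. (\<Sum>v\<in>B. u v * v j) = 0" and "v \<in> B" for u v
  proof -
    have "(\<Sum>v\<in>B. sc (lookup (u v) 0) v) = (\<lambda>j. \<Sum>v\<in>B. u v * v j)"
    proof
      fix j
      show "(\<Sum>v\<in>B. sc (lookup (u v) 0) v) j = (\<Sum>v\<in>B. u v * v j)"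
        unfolding sum_fun_apply
        by (intro sum.cong) (simp_all add: sc_def homogeneous_0_eq[OF u, symmetric])
    qed
    then have "(\<Sum>v\<in>B. sc (lookup (u v) 0) v) = 0" by (simp add: 0 zero_fun_def)
    then have "lookup (u v) 0 = 0"
      using vs.independentD[OF B(2) fin subset_refl _ \<open>v \<in> B\<close>, of "\<lambda>v. lookup (u v) 0"] by blast
    then show ?thesis using homogeneous_0_eq[OF u[OF \<open>v \<in> B\<close>]] by simp
  qed
  have hom: "homogeneous e (f j)" if "f \<in> B" for f j
    using that B(1) by (auto simp: W_def)
  have "B \<subseteq> N" using B(1) by (auto simp: W_def)
  from fin hom this spn ind show ?thesis by (rule that)
qed

text \<open>
  Koszul-linearity in homological degree zero. An element \<open>f\<close> of \<open>N\<close> is a cycle on the empty index set, so in degree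
  above \<open>e\<close> it is the boundary of a chain over \<open>N\<close>, which writes \<open>f\<close> as a combination of elements of \<open>N\<close>
  of smaller degree with the variables as coefficients.
\<close>

lemma koszul_linear_generated:
  fixes N :: "(nat \<Rightarrow> ('n::{finite,linorder}, 'k::field) poly_ring) set"
  assumes N: "graded_submodule r N" and lin: "koszul_linear e N" and ini: "initial_degree_ge e N"
    and span: "\<And>f. f \<in> N \<Longrightarrow> (\<And>j. homogeneous e (f j)) \<Longrightarrow> \<exists>u. \<forall>j. f j = (\<Sum>v\<in>B. u v * v j)"
    and f: "f \<in> N"
  shows "\<exists>u. \<forall>j. f j = (\<Sum>v\<in>B. u v * v j)"
proof -
  have hom: "\<exists>u. \<forall>j. f j = (\<Sum>v\<in>B. u v * v j)" if "f \<in> N" "\<And>j. homogeneous c (f j)" for c f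
    using that
  proof (induction c arbitrary: f rule: less_induct)
    case (less c)
    consider "c < e" | "c = e" | "c > e" by linarith
    then show ?case
    proof cases
      case 1
      then have "f = (\<lambda>j. 0)" using ini less.prems by (auto simp: initial_degree_ge_def)
      then show ?thesis by (intro exI[of _ "\<lambda>v. 0"]) simp
    next
      case 2
      then show ?thesis using span less.prems by simp
    next
      case 3
      define z where "z = (\<lambda>j s. if s = ({} :: 'n set) then f j else 0)"
      have "koszul_d (z j) s = 0" for j s
        by (simp add: koszul_d_def z_def)
      moreover have "(\<lambda>j. z j s) \<in> N" for s
        using less.prems(1) N by (cases "s = {}") (auto simp: z_def graded_submodule_def)
      moreover have "homogeneous c (z j s)" for j s
        using less.prems(2) by (simp add: z_def)
      ultimately have "\<exists>y. (\<forall>s. (\<lambda>j. y j s) \<in> N) \<and> (\<forall>j s. koszul_d (y j) s = z j s)"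
        using lin 3 unfolding koszul_linear_def by blast
      then obtain y where y: "\<And>s. (\<lambda>j. y j s) \<in> N" "\<And>j s. koszul_d (y j) s = z j s" by blast
      have fj: "f j = (\<Sum>a\<in>UNIV. koszul_sign a {} * (var a * hpart (c - 1) (y j {a})))" for j
      proof -
        have "f j = hpart c (koszul_d (y j) {})"
          using hpart_id[OF less.prems(2), of j] by (simp add: y(2) z_def)
        also have "\<dots> = koszul_d (\<lambda>s. hpart (c - 1) (y j s)) {}"
          using hpart_koszul_d[of "c - 1" "y j" "{}"] 3 by simp
        finally show ?thesis by (simp add: koszul_d_def)
      qed
      have "\<exists>u. \<forall>j. hpart (c - 1) (y j {a}) = (\<Sum>v\<in>B. u v * v j)" for a
        by (rule less.IH[of "c - 1"]) (use 3 y(1) N in \<open>auto simp: graded_submodule_def\<close>)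
      then have "\<exists>u. \<forall>a j. hpart (c - 1) (y j {a}) = (\<Sum>v\<in>B. u a v * v j)"
        by (intro choice allI)
      then obtain u where u: "\<And>a j. hpart (c - 1) (y j {a}) = (\<Sum>v\<in>B. u a v * v j)" by blast
      have "f j = (\<Sum>v\<in>B. (\<Sum>a\<in>UNIV. koszul_sign a {} * (var a * u a v)) * v j)" for j
        unfolding fj u sum_distrib_left sum_distrib_right
        by (subst sum.swap) (simp add: mult.assoc)
      then show ?thesis by (intro exI[of _ "\<lambda>v. \<Sum>a\<in>UNIV. koszul_sign a {} * (var a * u a v)"]) simp
    qed
  qed
  define C where "C = (\<Union>j<r. mdeg ` keys (f j))"
  have "finite C" by (simp add: C_def)
  have fC: "f j = (\<Sum>c\<in>C. hpart c (f j))" for j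
  proof (cases "j < r")
    case True
    then have "mdeg ` keys (f j) \<subseteq> C" by (auto simp: C_def)
    from sum_hpart[OF \<open>finite C\<close> this] show ?thesis by simp
  next
    case False
    then have "f j = 0" using N f by (auto simp: graded_submodule_def)
    then show ?thesis by (simp add: hpart_def)
  qed
  have "\<exists>u. \<forall>j. hpart c (f j) = (\<Sum>v\<in>B. u v * v j)" for c
    by (rule hom[of _ c]) (use N f in \<open>auto simp: graded_submodule_def\<close>)
  then have "\<exists>u. \<forall>c j. hpart c (f j) = (\<Sum>v\<in>B. u c v * v j)"
    by (intro choice allI)
  then obtain u where u: "\<And>c j. hpart c (f j) = (\<Sum>v\<in>B. u c v * v j)" by blast
  have "f j = (\<Sum>v\<in>B. (\<Sum>c\<in>C. u c v) * v j)" for j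
  proof -
    have "f j = (\<Sum>c\<in>C. \<Sum>v\<in>B. u c v * v j)"
      using fC[of j] by (simp only: u)
    then show ?thesis by (simp only: sum_distrib_right sum.swap[of _ B])
  qed
  then show ?thesis by (intro exI[of _ "\<lambda>v. \<Sum>c\<in>C. u c v"] allI)
qed

definition syzygies :: "nat \<Rightarrow> (nat \<Rightarrow> nat \<Rightarrow> ('n, 'k::field) poly_ring) \<Rightarrow> (nat \<Rightarrow> ('n, 'k) poly_ring) set" where
  "syzygies b A = {g. (\<forall>i\<ge>b. g i = 0) \<and> (\<forall>j. (\<Sum>i<b. A j i * g i) = 0)}"

text \<open>
  The dimension shift \<open>Tor\<^sub>i(syz N) = Tor\<^sub>i\<^sub>+\<^sub>1(N)\<close> in the relevant degrees. A cycle \<open>z\<close> of syzygies is the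
  boundary of a chain \<open>t\<close> of the free module. The image of \<open>t\<close> is a cycle over \<open>N\<close>, hence a boundary, and
  correcting \<open>t\<close> by a lift of the bounding chain makes it a chain of syzygies.
\<close>

lemma koszul_linear_syzygies:
  fixes N :: "(nat \<Rightarrow> ('n::{finite,linorder}, 'k::field) poly_ring) set"
  assumes lin: "koszul_linear e N"
    and hom: "\<And>j i. homogeneous e (A j i)"
    and N: "N = {\<lambda>j. \<Sum>i<b. A j i * g i | g. True}"
  shows "koszul_linear 1 (syzygies b A)"
  unfolding koszul_linear_def
proof (intro allI impI, elim conjE)
  fix k and z :: "nat \<Rightarrow> ('n, 'k) chain"
  assume "1 < k" and z: "\<forall>s. (\<lambda>j. z j s) \<in> syzygies b A" "\<forall>j s. homogeneous k (z j s)"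
    "\<forall>j s. koszul_d (z j) s = 0"
  have "\<exists>t. koszul_d t = z i \<and> (\<forall>s. homogeneous (k - 1) (t s))" for i
    by (rule koszul_acyclic) (use z \<open>1 < k\<close> in auto)
  then obtain t0 where t0: "\<And>i. koszul_d (t0 i) = z i" "\<And>i s. homogeneous (k - 1) (t0 i s)" by metis
  define t where "t = (\<lambda>i. if i < b then t0 i else (\<lambda>s. 0))"
  have t: "koszul_d (t i) s = z i s" "homogeneous (k - 1) (t i s)" "i \<ge> b \<Longrightarrow> t i s = 0" for i s
    using t0 z(1) by (auto simp: t_def syzygies_def)
  define w where "w = (\<lambda>j s. \<Sum>i<b. A j i * t i s)"
  have w1: "(\<lambda>j. w j s) \<in> N" for s by (auto simp: N w_def)
  have w2: "homogeneous (e + (k - 1)) (w j s)" for j s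
    unfolding w_def by (intro homogeneous_sum homogeneous_mult hom t(2))
  have w3: "koszul_d (w j) s = 0" for j s
    using z(1) by (simp add: w_def koszul_d_sum koszul_d_mult t(1) syzygies_def)
  have "\<exists>y. (\<forall>s. (\<lambda>j. y j s) \<in> N) \<and> (\<forall>j s. koszul_d (y j) s = w j s)"
    using lin[unfolded koszul_linear_def, rule_format, of "e + (k - 1)" w] w1 w2 w3 \<open>1 < k\<close> by auto
  then obtain y where y: "\<And>s. (\<lambda>j. y j s) \<in> N" "\<And>j s. koszul_d (y j) s = w j s" by blast
  have "\<exists>g. \<forall>j. y j s = (\<Sum>i<b. A j i * g i)" for s
    using y(1)[of s] by (auto simp: N fun_eq_iff)
  then obtain y0 where y0: "\<And>j s. y j s = (\<Sum>i<b. A j i * y0 s i)" by metis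
  define y' where "y' = (\<lambda>i s. if i < b then y0 s i else 0)"
  have y': "y j s = (\<Sum>i<b. A j i * y' i s)" for j s by (simp add: y0 y'_def)
  define t' where "t' = (\<lambda>i s. t i s - koszul_d (y' i) s)"
  have "(\<lambda>i. t' i s) \<in> syzygies b A" for s
  proof -
    have "(\<Sum>i<b. A j i * koszul_d (y' i) s) = w j s" for j
    proof -
      have "y j = (\<lambda>s. \<Sum>i<b. A j i * y' i s)" using y' by auto
      then have "koszul_d (y j) s = (\<Sum>i<b. A j i * koszul_d (y' i) s)" by (simp add: koszul_d_sum koszul_d_mult)
      then show ?thesis by (simp add: y(2))
    qed
    moreover have "koszul_d (y' i) s = 0" if "i \<ge> b" for i
      using that by (simp add: y'_def)
    ultimately show ?thesis
      using t(3) by (simp add: syzygies_def t'_def right_diff_distrib sum_subtractf w_def)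
  qed
  moreover have "koszul_d (t' i) s = z i s" for i s
    by (simp add: t'_def koszul_d_diff t(1) koszul_d_koszul_d)
  ultimately show "\<exists>y. (\<forall>s. (\<lambda>j. y j s) \<in> syzygies b A) \<and> (\<forall>j s. koszul_d (y j) s = z j s)"
    by blast
qed

lemma graded_submodule_syzygies:
  assumes hom: "\<And>j i. homogeneous e (A j i)"
  shows "graded_submodule b (syzygies b A)"
proof -
  have "(\<Sum>i<b. A j i * hpart c (g i)) = hpart (e + c) (\<Sum>i<b. A j i * g i)" for j c g
    by (simp add: hpart_def restrict_poly_sum) (simp add: hpart_mult[OF hom] flip: hpart_def)
  moreover have "(\<Sum>i<b. A j i * (p * g i)) = p * (\<Sum>i<b. A j i * g i)" for j p g
    by (simp add: sum_distrib_left mult.left_commute)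
  moreover have "hpart c 0 = 0" for c by (simp add: hpart_def)
  ultimately show ?thesis
    by (auto simp: graded_submodule_def syzygies_def distrib_left sum.distrib)
qed

text \<open>
  The step of the construction of a resolution. Taking a basis of the degree \<open>e\<close> part as generators
  ensures that no syzygy has a nonzero constant coefficient, which is minimality.
\<close>

lemma koszul_linear_presentation:
  fixes N :: "(nat \<Rightarrow> ('n::{finite,linorder}, 'k::field) poly_ring) set"
  assumes N: "graded_submodule r N" and lin: "koszul_linear e N" and ini: "initial_degree_ge e N"
  obtains b A where "\<And>j i. homogeneous e (A j i)"
    "N = {\<lambda>j. \<Sum>i<b. A j i * g i | g. True}"
    "graded_submodule b (syzygies b A)" "koszul_linear 1 (syzygies b A)"
    "initial_degree_ge 1 (syzygies b A)"
proof -
  obtain B where B: "finite B" "\<And>f j. f \<in> B \<Longrightarrow> homogeneous e (f j)" "B \<subseteq> N"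
    and span: "\<And>f. f \<in> N \<Longrightarrow> (\<And>j. homogeneous e (f j)) \<Longrightarrow> \<exists>u. \<forall>j. f j = (\<Sum>v\<in>B. u v * v j)"
    and indep: "\<And>u v. (\<And>v. v \<in> B \<Longrightarrow> homogeneous 0 (u v)) \<Longrightarrow> (\<And>j. (\<Sum>v\<in>B. u v * v j) = 0) \<Longrightarrow>
      v \<in> B \<Longrightarrow> u v = 0"
    by (rule homogeneous_degree_basis[OF N, of e]) blast
  obtain fs where fs: "set fs = B" "distinct fs" using finite_distinct_list[OF B(1)] by blast
  define b where "b = length fs"
  define A where "A = (\<lambda>j i. if i < b then (fs ! i) j else 0)"
  have bij: "bij_betw ((!) fs) {..<b} B"
    using fs by (auto simp: b_def intro: bij_betw_nth)
  have hom: "homogeneous e (A j i)" for j i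
    using B(2) fs by (auto simp: A_def b_def)
  have sumB: "(\<Sum>v\<in>B. u v * v j) = (\<Sum>i<b. A j i * u (fs ! i))" for u j
    by (subst sum.reindex_bij_betw[OF bij, symmetric]) (simp add: A_def mult.commute)
  have Neq: "N = {\<lambda>j. \<Sum>i<b. A j i * g i | g. True}"
  proof (intro equalityI subsetI)
    fix f assume "f \<in> N"
    then obtain u where "\<forall>j. f j = (\<Sum>v\<in>B. u v * v j)"
      using koszul_linear_generated[OF N lin ini span] by blast
    then have "f = (\<lambda>j. \<Sum>i<b. A j i * u (fs ! i))" by (auto simp: sumB)
    then show "f \<in> {\<lambda>j. \<Sum>i<b. A j i * g i | g. True}"
      by (intro CollectI exI[of _ "\<lambda>i. u (fs ! i)"]) simp
  next
    fix f assume "f \<in> {\<lambda>j. \<Sum>i<b. A j i * g i | g. True}"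
    then obtain g where "f = (\<lambda>j. \<Sum>i<b. A j i * g i)" by blast
    then have "f = (\<lambda>j. \<Sum>i<b. g i * (fs ! i) j)" by (simp add: A_def mult.commute)
    also have "\<dots> \<in> N" by (rule graded_submodule_sum[OF N]) (use B(3) fs in \<open>auto simp: b_def\<close>)
    finally show "f \<in> N" .
  qed
  have "initial_degree_ge 1 (syzygies b A)"
    unfolding initial_degree_ge_def
  proof (intro ballI allI impI)
    fix g and c :: nat assume g: "g \<in> syzygies b A" and "c < 1" and "\<forall>j. homogeneous c (g j)"
    then have g0: "\<And>i. homogeneous 0 (g i)" by simp
    define u where "u = (\<lambda>v. g (the_inv_into {..<b} ((!) fs) v))"
    have ui: "u (fs ! i) = g i" if "i < b" for i
      using the_inv_into_f_f[OF bij_betw_imp_inj_on[OF bij]] that by (simp add: u_def)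
    have "u v = 0" if "v \<in> B" for v
    proof (rule indep[of u v])
      show "(\<Sum>v\<in>B. u v * v j) = 0" for j
        using g by (simp add: sumB ui syzygies_def)
    qed (use that g0 in \<open>auto simp: u_def\<close>)
    then have "g i = 0" if "i < b" for i
      using ui[OF that] bij_betwE[OF bij] that by (metis lessThan_iff)
    moreover have "g i = 0" if "i \<ge> b" for i using g that by (simp add: syzygies_def)
    ultimately show "g = (\<lambda>j. 0)" by (metis linorder_not_le)
  qed
  then show ?thesis
    using graded_submodule_syzygies[of e A b, OF hom] koszul_linear_syzygies[OF lin hom Neq]
    by (intro that[of A b, OF hom Neq])
qed

text \<open>
  The resolution is built step by step. The state of the construction is the rank \<open>r\<close> of the current
  free module together with the submodule of \<open>S\<^sup>r\<close> that is to be covered next. This submodule starts in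
  degree \<open>e\<close> for the ideal itself, and in degree one for all later syzygy modules.
\<close>

lemma koszul_linear_imp_linear_resolution:
  fixes I :: "('n::{finite,linorder}, 'k::field) poly_ring set"
  assumes I: "I = ideal_gen (mon ` G)" and deg: "\<And>m. m \<in> G \<Longrightarrow> e \<le> mdeg m"
    and lin: "koszul_linear_ideal e I"
  shows "has_linear_resolution I"
proof -
  define en where "en = (\<lambda>n::nat. if n = 0 then e else 1)"
  define P where "P = (\<lambda>n (x :: nat \<times> (nat \<Rightarrow> ('n, 'k) poly_ring) set). (n = 0 \<longrightarrow> x = (1, ideal_vectors I)) \<and>
    graded_submodule (fst x) (snd x) \<and> koszul_linear (en n) (snd x) \<and> initial_degree_ge (en n) (snd x))"
  define Q where "Q = (\<lambda>n (x :: nat \<times> (nat \<Rightarrow> ('n, 'k) poly_ring) set) y.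
    \<exists>A. (\<forall>j i. homogeneous (en n) (A j i)) \<and>
      snd x = {\<lambda>j. \<Sum>i<fst y. A j i * g i | g. True} \<and> snd y = syzygies (fst y) A)"
  have "0 \<in> I" by (simp add: I ring_module.span_zero)
  have ini: "initial_degree_ge e (ideal_vectors I)"
    unfolding initial_degree_ge_def
  proof (intro ballI allI impI)
    fix f c assume f: "f \<in> ideal_vectors I" and "c < e" and hom: "\<forall>j. homogeneous c (f j)"
    have "keys (f 0) = {}"
    proof (rule ccontr)
      assume "keys (f 0) \<noteq> {}"
      then obtain m where m: "m \<in> keys (f 0)" by blast
      then obtain a where "a \<in> G" "mdvd a m"
        using f by (auto simp: ideal_vectors_def I mem_monomial_ideal_iff)
      then have "e \<le> mdeg m" using deg mdeg_mono by (meson order_trans)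
      then show False using homogeneousD[of c "f 0" m] hom m \<open>c < e\<close> by auto
    qed
    then have "f j = 0" for j using f by (cases "j = 0") (auto simp: ideal_vectors_def)
    then show "f = (\<lambda>j. 0)" by auto
  qed
  have "P 0 (1, ideal_vectors I)"
    using ini lin \<open>0 \<in> I\<close> graded_submodule_ideal_vectors[of G]
    by (simp add: P_def en_def koszul_linear_ideal_vectors_iff I)
  then have "\<exists>st. \<forall>n. P n (st n) \<and> Q n (st n) (st (Suc n))"
  proof (rule dependent_nat_choice[OF exI])
    fix x n assume P: "P n x"
    show "\<exists>y. P (Suc n) y \<and> Q n x y"
    proof (rule koszul_linear_presentation[of "fst x" "snd x" "en n"])
      fix b and A :: "nat \<Rightarrow> nat \<Rightarrow> ('n, 'k) poly_ring"
      assume "\<And>j i. homogeneous (en n) (A j i)" "snd x = {\<lambda>j. \<Sum>i<b. A j i * g i | g. True}"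
        "graded_submodule b (syzygies b A)" "koszul_linear 1 (syzygies b A)"
        "initial_degree_ge 1 (syzygies b A)"
      then have "P (Suc n) (b, syzygies b A) \<and> Q n x (b, syzygies b A)"
        unfolding P_def Q_def by (intro conjI exI[of _ A]) (simp_all add: en_def)
      then show ?thesis by blast
    qed (use P in \<open>auto simp: P_def\<close>)
  qed
  then obtain st where P: "\<And>n. P n (st n)" and "\<And>n. Q n (st n) (st (Suc n))" by blast
  have "\<exists>A. \<forall>n. (\<forall>j i. homogeneous (en n) (A n j i)) \<and>
      snd (st n) = {\<lambda>j. \<Sum>i<fst (st (Suc n)). A n j i * g i | g. True} \<and>
      snd (st (Suc n)) = syzygies (fst (st (Suc n))) (A n)"
    by (rule choice) (use \<open>\<And>n. Q n (st n) (st (Suc n))\<close> in \<open>simp only: Q_def simp_thms\<close>)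
  then obtain A where A: "\<forall>n. (\<forall>j i. homogeneous (en n) (A n j i)) \<and>
      snd (st n) = {\<lambda>j. \<Sum>i<fst (st (Suc n)). A n j i * g i | g. True} \<and>
      snd (st (Suc n)) = syzygies (fst (st (Suc n))) (A n)" ..
  have homA: "homogeneous (en n) (A n j i)" for n j i
    using A by simp
  have img: "snd (st n) = {\<lambda>j. \<Sum>i<fst (st (Suc n)). A n j i * g i | g. True}" for n
    using spec[OF A, of n] by (elim conjE)
  have syz: "snd (st (Suc n)) = syzygies (fst (st (Suc n))) (A n)" for n
    using spec[OF A, of n] by (elim conjE)
  define b where "b = (\<lambda>n. fst (st (Suc n)))"
  define nr where "nr = (\<lambda>n. fst (st n))"
  define s where "s = (\<lambda>n. replicate (b n) (e + n))"
  define M where "M = (\<lambda>n. mat (nr n) (b n) (\<lambda>(j, i). A n j i))"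
  have st0: "st 0 = (1, ideal_vectors I)" using P[of 0] by (simp add: P_def)
  have nrS: "nr (Suc n) = b n" for n by (simp add: nr_def b_def)
  have nr0: "nr 0 = 1" by (simp add: nr_def st0)
  have rows0: "(\<Sum>i<b n. A n j i * g i) = 0" if "j \<ge> nr n" for n j g
  proof -
    have "(\<lambda>j. \<Sum>i<b n. A n j i * g i) \<in> snd (st n)" unfolding img b_def by blast
    then show ?thesis using P[of n] that by (auto simp: P_def graded_submodule_def nr_def)
  qed
  have mv: "(M n *\<^sub>v vec (b n) g) $ j = (\<Sum>i<b n. A n j i * g i)" if "j < nr n" for n g j
    using mult_mat_vec_index[of "M n" "nr n" "b n" j "vec (b n) g"] that by (simp add: M_def)
  have vecE: "v \<in> carrier_vec k \<Longrightarrow> \<exists>g. v = vec k g" for k and v :: "('n, 'k) poly_ring vec"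
    by (metis carrier_vecD eq_vecI index_vec dim_vec)
  have "graded_matrix [0] (s 0) (M 0)"
    using homA[of 0] homogeneousD by (fastforce simp: graded_matrix_def s_def M_def nr0 en_def)
  moreover have "graded_matrix (s n) (s (Suc n)) (M (Suc n))" for n
    unfolding graded_matrix_def
  proof (intro conjI allI impI ballI)
    show "M (Suc n) \<in> carrier_mat (length (s n)) (length (s (Suc n)))"
      by (simp add: M_def s_def nrS)
  next
    fix a c m assume *: "a < length (s n)" "c < length (s (Suc n))" "m \<in> keys (M (Suc n) $$ (a, c))"
    then have "m \<in> keys (A (Suc n) a c)" by (simp add: M_def s_def nrS)
    then have "mdeg m = 1" using homogeneousD[OF homA] by (auto simp: en_def)
    then show "mdeg m + s n ! a = s (Suc n) ! c" using * by (simp add: s_def)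
  qed
  moreover have "{(M 0 *\<^sub>v f) $ 0 | f. f \<in> carrier_vec (length (s 0))} = I"
  proof -
    have "x \<in> I \<longleftrightarrow> (\<exists>g. x = (\<Sum>i<b 0. A 0 0 i * g i))" for x
    proof -
      have "x \<in> I \<longleftrightarrow> (\<lambda>j::nat. if j = 0 then x else 0) \<in> snd (st 0)"
        by (simp add: st0 ideal_vectors_def)
      also have "\<dots> \<longleftrightarrow> (\<exists>g. \<forall>j. (if j = 0 then x else 0) = (\<Sum>i<b 0. A 0 j i * g i))"
        by (auto simp: img b_def fun_eq_iff)
      also have "\<dots> \<longleftrightarrow> (\<exists>g. x = (\<Sum>i<b 0. A 0 0 i * g i))"
      proof
        assume "\<exists>g. x = (\<Sum>i<b 0. A 0 0 i * g i)"
        then obtain g where g: "x = (\<Sum>i<b 0. A 0 0 i * g i)" by blast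
        have "(if j = 0 then x else 0) = (\<Sum>i<b 0. A 0 j i * g i)" for j
          using rows0[of 0 j g] by (cases "j = 0") (simp_all add: g nr0)
        then show "\<exists>g. \<forall>j. (if j = 0 then x else 0) = (\<Sum>i<b 0. A 0 j i * g i)" by blast
      qed (metis (full_types))
      finally show ?thesis .
    qed
    moreover have "{(M 0 *\<^sub>v f) $ 0 | f. f \<in> carrier_vec (length (s 0))} =
        {\<Sum>i<b 0. A 0 0 i * g i | g. True}"
    proof (intro equalityI subsetI)
      fix x assume "x \<in> {(M 0 *\<^sub>v f) $ 0 | f. f \<in> carrier_vec (length (s 0))}"
      then obtain f where f: "f \<in> carrier_vec (b 0)" "x = (M 0 *\<^sub>v f) $ 0"
        by (auto simp: s_def)
      then obtain g where "f = vec (b 0) g" using vecE by blast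
      then show "x \<in> {\<Sum>i<b 0. A 0 0 i * g i | g. True}" using mv[of 0 0 g] f(2) nr0 by auto
    next
      fix x assume "x \<in> {\<Sum>i<b 0. A 0 0 i * g i | g. True}"
      then obtain g where "x = (\<Sum>i<b 0. A 0 0 i * g i)" by blast
      then have "x = (M 0 *\<^sub>v vec (b 0) g) $ 0" using mv[of 0 0 g] nr0 by simp
      then show "x \<in> {(M 0 *\<^sub>v f) $ 0 | f. f \<in> carrier_vec (length (s 0))}"
        by (auto simp: s_def)
    qed
    ultimately show ?thesis by auto
  qed
  moreover have "mat_kernel (M n) = {M (Suc n) *\<^sub>v f | f. f \<in> carrier_vec (length (s (Suc n)))}" for n
  proof -
    define ext where "ext = (\<lambda>g i. if i < b n then g i else (0 :: ('n, 'k) poly_ring))"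
    have sy: "ext g \<in> syzygies (b n) (A n) \<longleftrightarrow> vec (b n) g \<in> mat_kernel (M n)" for g
    proof -
      have "vec (b n) g \<in> mat_kernel (M n) \<longleftrightarrow> (\<forall>j<nr n. (\<Sum>i<b n. A n j i * g i) = 0)"
        unfolding mat_kernel_def using mv[of _ n g] by (auto simp: M_def vec_eq_iff)
      also have "\<dots> \<longleftrightarrow> (\<forall>j. (\<Sum>i<b n. A n j i * g i) = 0)"
        using rows0 by (metis linorder_not_le)
      finally show ?thesis by (simp add: syzygies_def ext_def)
    qed
    have im: "ext g \<in> syzygies (b n) (A n) \<longleftrightarrow> (\<exists>h. \<forall>j<b n. g j = (\<Sum>i<b (Suc n). A (Suc n) j i * h i))" for g
    proof -
      have "ext g \<in> syzygies (b n) (A n) \<longleftrightarrow> (\<exists>h. \<forall>j. ext g j = (\<Sum>i<b (Suc n). A (Suc n) j i * h i))"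
        using syz[of n] img[of "Suc n"] by (auto simp: b_def fun_eq_iff)
      also have "\<dots> \<longleftrightarrow> (\<exists>h. \<forall>j<b n. g j = (\<Sum>i<b (Suc n). A (Suc n) j i * h i))"
        using rows0[where n = "Suc n"] by (simp add: ext_def nrS)
      finally show ?thesis .
    qed
    show ?thesis
    proof (intro equalityI subsetI)
      fix v assume v: "v \<in> mat_kernel (M n)"
      then have "v \<in> carrier_vec (b n)" by (simp add: mat_kernel_def M_def)
      then obtain g where g: "v = vec (b n) g" using vecE by blast
      then obtain h where h: "\<And>j. j < b n \<Longrightarrow> g j = (\<Sum>i<b (Suc n). A (Suc n) j i * h i)"
        using v sy im by blast
      have "v = M (Suc n) *\<^sub>v vec (b (Suc n)) h"
        by (rule eq_vecI) (use mv[of _ "Suc n" h] h in \<open>auto simp: g nrS M_def\<close>)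
      then show "v \<in> {M (Suc n) *\<^sub>v f | f. f \<in> carrier_vec (length (s (Suc n)))}"
        by (auto simp: s_def)
    next
      fix v assume "v \<in> {M (Suc n) *\<^sub>v f | f. f \<in> carrier_vec (length (s (Suc n)))}"
      then obtain h where h: "v = M (Suc n) *\<^sub>v vec (b (Suc n)) h" using vecE by (auto simp: s_def)
      have "v = vec (b n) (\<lambda>j. \<Sum>i<b (Suc n). A (Suc n) j i * h i)"
        by (rule eq_vecI) (use mv[of _ "Suc n" h] in \<open>auto simp: h nrS M_def\<close>)
      then show "v \<in> mat_kernel (M n)" using sy im by blast
    qed
  qed
  moreover have "elements_mat (M (Suc n)) \<subseteq> ideal_gen (range var)" for n
  proof
    fix x assume "x \<in> elements_mat (M (Suc n))"
    then obtain j i where x: "x = A (Suc n) j i" by (auto simp: elements_mat_def M_def)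
    show "x \<in> ideal_gen (range var)"
      unfolding mem_var_ideal_iff
    proof
      fix m assume "m \<in> keys x"
      then have "mdeg m = 1" using homogeneousD[OF homA] by (auto simp: x en_def)
      then have "m \<noteq> 0" by auto
      then show "\<exists>i\<in>UNIV. lookup m i > 0" by (metis UNIV_I gr0I lookup_zero poly_mapping_eqI)
    qed
  qed
  ultimately have "minimal_graded_free_resolution s M I"
    by (simp add: minimal_graded_free_resolution_def)
  moreover have "\<forall>i. \<forall>c\<in>set (s i). c = e + i" by (simp add: s_def)
  ultimately show ?thesis unfolding has_linear_resolution_def by blast
qed

section \<open>The lexicographic order on monomials\<close>

lemma less_xv: "k < l \<Longrightarrow> xv l < (xv k :: 'n::{finite,linorder} monomial)"
  unfolding less_monomial_iff by (intro exI[of _ k]) (auto simp: lookup_xv)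

lemma le_xv: "k \<le> l \<Longrightarrow> xv l \<le> (xv k :: 'n::{finite,linorder} monomial)"
  by (metis le_less less_xv)

lemma lex_less_at:
  fixes v w :: "'n::{finite,linorder} monomial"
  assumes "\<And>j. j < i \<Longrightarrow> lookup v j = lookup w j" "lookup v i < lookup w i"
  shows "v < w"
  unfolding less_monomial_iff using assms by auto

lemma lex_le_at:
  fixes v w :: "'n::{finite,linorder} monomial"
  assumes "v \<le> w" "\<And>j. j < i \<Longrightarrow> lookup v j = lookup w j"
  shows "lookup v i \<le> lookup w i"
  using lex_less_at[of i w v] assms by (metis linorder_not_less)

lemma lex_between_prefix:
  fixes v w u :: "'n::{finite,linorder} monomial"
  assumes "v \<le> w" "w \<le> u" "\<And>j. j < i \<Longrightarrow> lookup v j = lookup u j" "j < i"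
  shows "lookup w j = lookup u j"
proof (rule ccontr)
  assume ne: "lookup w j \<noteq> lookup u j"
  define k where "k = Min {k. k \<le> j \<and> lookup w k \<noteq> lookup u k}"
  have k: "k \<le> j" "lookup w k \<noteq> lookup u k"
    using Min_in[of "{k. k \<le> j \<and> lookup w k \<noteq> lookup u k}"] ne by (auto simp: k_def)
  have lt: "lookup w r = lookup u r" if "r < k" for r
  proof (rule ccontr)
    assume "lookup w r \<noteq> lookup u r"
    then have "k \<le> r" using that k(1) unfolding k_def by (intro Min_le) auto
    then show False using that by simp
  qed
  have "lookup w k \<le> lookup u k" using lex_le_at[OF assms(2)] lt by simp
  moreover have "lookup v k \<le> lookup w k"
    by (rule lex_le_at[OF assms(1)]) (use lt k(1) assms(3,4) in auto)
  moreover have "lookup v k = lookup u k" using k(1) assms(3,4) by auto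
  ultimately show False using k(2) by simp
qed

lemma ex_lookup_less:
  assumes "mdeg a = mdeg b" "a \<noteq> b"
  shows "\<exists>l. lookup b l < lookup a l"
proof (rule ccontr)
  assume "\<not> ?thesis"
  then have "mdvd a b" by (auto simp: mdvd_def not_less)
  then show False using assms mdvd_eq_if_mdeg_le by (metis order_refl)
qed

lemma lex_less_ex_above:
  fixes a b :: "'n::{finite,linorder} monomial"
  assumes "mdeg a = mdeg b" "a < b"
  obtains k l where "k < l" "\<And>j. j < k \<Longrightarrow> lookup a j = lookup b j"
    "lookup a k < lookup b k" "lookup b l < lookup a l"
proof -
  obtain k where k: "lookup a k < lookup b k" "\<And>j. j < k \<Longrightarrow> lookup a j = lookup b j"
    using assms(2) unfolding less_monomial_iff by blast
  obtain l where l: "lookup b l < lookup a l"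
    using ex_lookup_less[of a b] assms by auto
  have "k < l" using k l by (metis less_irrefl linorder_cases order_less_asym)
  then show ?thesis using that k l by blast
qed

text \<open>The monomial \<open>m x\<^sub>k / x\<^sub>l\<close>, to be used if \<open>x\<^sub>l\<close> divides \<open>m\<close>.\<close>

definition exchange :: "'n monomial \<Rightarrow> 'n \<Rightarrow> 'n \<Rightarrow> 'n monomial" where
  "exchange m k l = (m - xv l) + xv k"

lemma exchange_add: "lookup m l > 0 \<Longrightarrow> exchange m k l + xv l = m + xv k"
  using add_diff_monomial[of "xv l" m] by (simp add: exchange_def mdvd_xv add_ac)

lemma mdeg_exchange: "lookup m l > 0 \<Longrightarrow> mdeg (exchange m k l) = mdeg m"
  using arg_cong[OF exchange_add, of m l mdeg k] by (simp add: mdeg_add)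

lemma lookup_exchange:
  "lookup (exchange m k l) j = lookup m j - (if j = l then 1 else 0) + (if j = k then 1 else 0)"
  by (auto simp: exchange_def lookup_add lookup_minus lookup_xv)

lemma exchange_greater:
  fixes m :: "'n::{finite,linorder} monomial"
  assumes "k < l" "lookup m l > 0" shows "m < exchange m k l"
proof -
  have "m + xv l < m + xv k" using less_xv[OF assms(1)] by simp
  then show ?thesis by (simp flip: exchange_add[OF assms(2), of k])
qed

lemma exchange_less:
  fixes m :: "'n::{finite,linorder} monomial"
  assumes "l < k" "lookup m l > 0" shows "exchange m k l < m"
proof -
  have "m + xv k < m + xv l" using less_xv[OF assms(1)] by simp
  then show ?thesis by (simp flip: exchange_add[OF assms(2), of k])
qed

lemma exchange_le_iff:
  fixes m :: "'n::{finite,linorder} monomial"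
  assumes "lookup m l > 0"
  shows "exchange m k l \<le> w \<longleftrightarrow> m + xv k \<le> w + xv l" "w \<le> exchange m k l \<longleftrightarrow> w + xv l \<le> m + xv k"
    "exchange m k l < w \<longleftrightarrow> m + xv k < w + xv l" "w < exchange m k l \<longleftrightarrow> w + xv l < m + xv k"
  by (simp_all flip: exchange_add[OF assms, of k])

lemma le_last_var: "(r :: 'n::{finite,linorder}) \<le> last_var"
  by (simp add: last_var_def)

lemma first_var_le: "first_var \<le> (r :: 'n::{finite,linorder})"
  by (simp add: first_var_def)

lemma finite_lexseg: "finite (lexseg u v)"
  using finite_Mon by (rule finite_subset[rotated]) (auto simp: lexseg_def)

section \<open>Linear quotients from an ordering of the generators\<close>

lemma ex_sorted_list:
  assumes "finite L" "\<And>x y z. R x y \<Longrightarrow> R y z \<Longrightarrow> R x z"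
    "\<And>x y. x \<in> L \<Longrightarrow> y \<in> L \<Longrightarrow> x \<noteq> y \<Longrightarrow> R x y \<or> R y x"
  shows "\<exists>us. distinct us \<and> set us = L \<and> sorted_wrt R us"
  using assms(1,3)
proof (induction L)
  case empty
  then show ?case by simp
next
  case (insert x L)
  then obtain us where us: "distinct us" "set us = L" "sorted_wrt R us" by auto
  define vs where "vs = filter (\<lambda>y. R y x) us @ x # filter (\<lambda>y. \<not> R y x) us"
  have "R x y" if "y \<in> L" "\<not> R y x" for y using insert.prems[of x y] that insert.hyps by auto
  then have "sorted_wrt R vs"
    using us assms(2) by (auto simp: vs_def sorted_wrt_append intro: sorted_wrt_filter)
  moreover have "distinct vs" "set vs = insert x L"
    using us insert.hyps by (auto simp: vs_def)
  ultimately show ?case by blast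
qed

text \<open>
  For generators of equal degree, a colon ideal with respect to the earlier generators is generated by
  variables if every quotient \<open>m' / gcd(m', m)\<close> is divisible by a variable \<open>x\<^sub>k\<close> that is itself such a
  quotient, that is \<open>m x\<^sub>k / x\<^sub>l\<close> is an earlier generator for some \<open>x\<^sub>l\<close>.
\<close>

lemma linear_quotientsI:
  fixes L :: "'n::{finite,linorder} monomial set"
  assumes "finite L" and deg: "\<And>m. m \<in> L \<Longrightarrow> mdeg m = e"
    and trans: "\<And>x y z. R x y \<Longrightarrow> R y z \<Longrightarrow> R x z" and irrefl: "\<And>x. \<not> R x x"
    and total: "\<And>x y. x \<in> L \<Longrightarrow> y \<in> L \<Longrightarrow> x \<noteq> y \<Longrightarrow> R x y \<or> R y x"
    and ex: "\<And>m m'. m \<in> L \<Longrightarrow> m' \<in> L \<Longrightarrow> R m' m \<Longrightarrow>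
      \<exists>m''\<in>L. R m'' m \<and> (\<exists>k l. m'' + xv l = m + xv k \<and> lookup m k < lookup m' k)"
  shows "has_linear_quotients (ideal_gen (mon ` L) :: ('n, 'k::field) poly_ring set)"
proof -
  have "\<exists>us. distinct us \<and> set us = L \<and> sorted_wrt R us"
    by (rule ex_sorted_list[of L R, OF assms(1)]) (erule trans, assumption, rule total)
  then obtain us where us: "distinct us" "set us = L" "sorted_wrt R us" by blast
  have nth: "R (us ! j) (us ! i) \<longleftrightarrow> j < i" if "i < length us" "j < length us" for i j
    using us(3) that trans irrefl unfolding sorted_wrt_iff_nth_less by (metis linorder_cases)
  have "\<exists>V. colon (ideal_gen (mon ` set (take i us))) (mon (us ! i)) =
      (ideal_gen (var ` V) :: ('n, 'k) poly_ring set)" if i: "i < length us" for i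
  proof (intro exI equalityI subsetI)
    define m where "m = us ! i"
    define E where "E = set (take i us)"
    define V where "V = {k. \<exists>a\<in>E. \<exists>l. a + xv l = m + xv k}"
    have mL: "m \<in> L" using i us(2) by (auto simp: m_def)
    have E: "a \<in> E \<longleftrightarrow> a \<in> L \<and> R a m" for a
    proof
      assume "a \<in> E"
      then obtain j where "j < i" "a = us ! j" by (auto simp: E_def in_set_conv_nth)
      then show "a \<in> L \<and> R a m" using nth[of i j] i us(2) by (auto simp: m_def)
    next
      assume a: "a \<in> L \<and> R a m"
      then obtain j where "j < length us" "a = us ! j" using us(2) by (auto simp: in_set_conv_nth)
      then show "a \<in> E" using nth[of i j] i a by (auto simp: m_def E_def in_set_conv_nth)
    qed
    have keys: "keys (g * mon m) = (\<lambda>n. m + n) ` keys g" for g :: "('n, 'k) poly_ring"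
    proof (intro equalityI subsetI)
      fix n assume "n \<in> keys (g * mon m)"
      then have "mdvd m n" "n - m \<in> keys g"
        by (auto simp: mult.commute[of g] in_keys_iff lookup_mon_mult split: if_splits)
      then show "n \<in> (\<lambda>n. m + n) ` keys g" using add_diff_monomial by (metis image_eqI)
    qed (auto simp: mult.commute[of g] in_keys_iff lookup_mon_mult)
    have colon: "g \<in> colon (ideal_gen (mon ` E)) (mon m) \<longleftrightarrow>
        (\<forall>n\<in>keys g. \<exists>a\<in>E. mdvd a (m + n))" for g :: "('n, 'k) poly_ring"
      by (simp add: colon_def mem_monomial_ideal_iff keys)
    {
      fix g :: "('n, 'k) poly_ring"
      assume g: "g \<in> colon (ideal_gen (mon ` set (take i us))) (mon (us ! i))"
      show "g \<in> ideal_gen (var ` V)"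
        unfolding mem_var_ideal_iff
      proof
        fix n assume "n \<in> keys g"
        then obtain a where a: "a \<in> E" "mdvd a (m + n)"
          using g colon[of g] unfolding E_def m_def by blast
        then obtain m'' k l where "m'' \<in> L" "R m'' m" "m'' + xv l = m + xv k" "lookup m k < lookup a k"
          using ex[OF mL, of a] E by blast
        moreover have "lookup a k \<le> lookup m k + lookup n k" for k
          using a(2) by (simp add: mdvd_def lookup_add)
        ultimately have "k \<in> V" "lookup n k > 0"
          using E by (auto simp: V_def) (metis add.right_neutral not_gr_zero not_less)
        then show "\<exists>k\<in>V. lookup n k > 0" by blast
      qed
    next
      fix g :: "('n, 'k) poly_ring"
      assume g: "g \<in> ideal_gen (var ` V)"
      have "g \<in> colon (ideal_gen (mon ` E)) (mon m)"
        unfolding colon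
      proof
        fix n assume "n \<in> keys g"
        then obtain k where "k \<in> V" "lookup n k > 0" using g unfolding mem_var_ideal_iff by blast
        then obtain a l b where a: "a \<in> E" "a + xv l = m + xv k" "n = xv k + b"
          unfolding V_def mdvd_xv[symmetric] mdvd_iff by blast
        then have "m + n = a + (xv l + b)" by (simp flip: add.assoc)
        then have "mdvd a (m + n)" by simp
        then show "\<exists>a\<in>E. mdvd a (m + n)" using a(1) by blast
      qed
      then show "g \<in> colon (ideal_gen (mon ` set (take i us))) (mon (us ! i))"
        by (simp add: E_def m_def)
    }
  qed
  then show ?thesis
    unfolding has_linear_quotients_def
    using us(1,2) by (intro exI[of _ us]) (simp add: min_gens_equigenerated[OF deg])
qed

section \<open>Lexsegments with linear quotients\<close>

lemma lexsegD:
  assumes "w \<in> lexseg u v"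
  shows "mdeg w = mdeg u" "v \<le> w" "w \<le> u"
  using assms by (auto simp: lexseg_def Mon_def)

lemma lexsegI: "mdeg w = mdeg u \<Longrightarrow> v \<le> w \<Longrightarrow> w \<le> u \<Longrightarrow> w \<in> lexseg u v"
  by (auto simp: lexseg_def Mon_def)

text \<open>
  The variable \<open>x\<^sub>i\<close> is the first one in which \<open>u\<close> and \<open>v\<close> differ. All monomials of the segment agree with \<open>u\<close>
  and \<open>v\<close> before \<open>x\<^sub>i\<close>, and are sorted into levels by their exponent at \<open>x\<^sub>i\<close>. The intermediate levels are
  complete, the top level is bounded by \<open>u\<close>, and the bottom level by \<open>v\<close>.
\<close>

locale lexsegment =
  fixes u v :: "'n::{finite,linorder} monomial" and i :: 'n
  assumes mdeg_eq: "mdeg v = mdeg u"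
    and prefix: "\<And>j. j < i \<Longrightarrow> lookup v j = lookup u j"
    and at: "lookup v i < lookup u i"
begin

lemma mem_prefix: "w \<in> lexseg u v \<Longrightarrow> j < i \<Longrightarrow> lookup w j = lookup u j"
  using lex_between_prefix[of v w u i j] lexsegD[of w u v] prefix by blast

lemma mem_at:
  assumes "w \<in> lexseg u v"
  shows "lookup v i \<le> lookup w i" "lookup w i \<le> lookup u i"
proof -
  note w = lexsegD[OF assms] and pw = mem_prefix[OF assms]
  show "lookup v i \<le> lookup w i" by (rule lex_le_at[OF w(2)]) (simp add: pw prefix)
  show "lookup w i \<le> lookup u i" by (rule lex_le_at[OF w(3)]) (simp add: pw)
qed

lemma above_v: "(\<And>j. j < i \<Longrightarrow> lookup w j = lookup u j) \<Longrightarrow> lookup v i < lookup w i \<Longrightarrow> v \<le> w"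
  by (rule less_imp_le, rule lex_less_at[of i]) (auto simp: prefix)

lemma below_u: "(\<And>j. j < i \<Longrightarrow> lookup w j = lookup u j) \<Longrightarrow> lookup w i < lookup u i \<Longrightarrow> w \<le> u"
  by (rule less_imp_le, rule lex_less_at[of i]) auto

text \<open>
  In the top level, an exchange may overshoot \<open>u\<close>. Then \<open>x\<^sub>i\<close> is given up instead, which leads to the level
  below. The condition says that even the least monomial obtained in this way is not below \<open>v\<close>. It
  holds trivially if there are intermediate levels.
\<close>

definition recoverable :: bool where
  "recoverable \<longleftrightarrow> (\<forall>q. mdeg q = mdeg u \<longrightarrow> u < q \<longrightarrow> (\<forall>r\<le>i. lookup q r = lookup u r) \<longrightarrow>
     v \<le> exchange q last_var i)"

definition before_recoverable :: "'n monomial \<Rightarrow> 'n monomial \<Rightarrow> bool" where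
  "before_recoverable m' m \<longleftrightarrow> lookup m' i < lookup m i \<or> lookup m' i = lookup m i \<and> m < m'"

text \<open>
  An exchange \<open>m x\<^sub>k / x\<^sub>l\<close> that overshoots \<open>u\<close> can be replaced by \<open>m x\<^sub>k / x\<^sub>i\<close>, which is at least
  \<open>q x\<^sub>n / x\<^sub>i\<close> for \<open>q = m x\<^sub>k / x\<^sub>l\<close>.
\<close>

lemma recoverable_exchange:
  assumes recoverable and m: "m \<in> lexseg u v" and k: "i < k" "k < l" and l: "lookup m l > 0"
    and "u < exchange m k l"
  shows "lookup m i = lookup u i" "v \<le> exchange m k i"
proof -
  define q where "q = exchange m k l"
  have q: "mdeg q = mdeg u" "u < q"
    using assms mdeg_exchange[OF l, of k] lexsegD[OF m] by (simp_all add: q_def)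
  have qm: "lookup q r = lookup m r" if "r < k" for r
    using that k by (auto simp: q_def lookup_exchange)
  have "lookup u r = lookup q r" if "r < k" for r
    by (rule lex_between_prefix[of m u q k]) (use lexsegD[OF m] q(2) qm that in auto)
  then have qu: "\<forall>r\<le>i. lookup q r = lookup u r" using k(1) by auto
  then show mi: "lookup m i = lookup u i" using qm[of i] k(1) by simp
  have qi: "lookup q i > 0" and mi0: "lookup m i > 0" using qu mi at by auto
  have "v \<le> exchange q last_var i" using \<open>recoverable\<close> q qu by (simp add: recoverable_def)
  moreover have "exchange q last_var i \<le> exchange m k i"
  proof -
    have "q + xv last_var \<le> q + xv l" using le_xv[OF le_last_var] by simp
    also have "\<dots> = m + xv k" unfolding q_def by (rule exchange_add[OF l])
    also have "\<dots> = exchange m k i + xv i" by (rule exchange_add[OF mi0, symmetric])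
    finally show ?thesis by (simp add: exchange_le_iff(1)[OF qi])
  qed
  ultimately show "v \<le> exchange m k i" by (rule order_trans)
qed

text \<open>
  The levels are listed from the bottom to the top, each of them in decreasing order.
\<close>

lemma recoverable_linear_quotients:
  assumes recoverable
  shows "has_linear_quotients (ideal_gen (mon ` lexseg u v) :: ('n, 'k::field) poly_ring set)"
proof (rule linear_quotientsI[where e = "mdeg u" and R = before_recoverable])
  fix m m' assume m: "m \<in> lexseg u v" and m': "m' \<in> lexseg u v" and b: "before_recoverable m' m"
  note mD = lexsegD[OF m] and m'D = lexsegD[OF m']
  have deg: "mdeg m = mdeg m'" using mD m'D by simp
  have pre: "lookup m j = lookup m' j" if "j < i" for j
    using mem_prefix[OF m that] mem_prefix[OF m' that] by simp
  let ?goal = "\<exists>m''\<in>lexseg u v. before_recoverable m'' m \<and>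
    (\<exists>k l. m'' + xv l = m + xv k \<and> lookup m k < lookup m' k)"
  have up: "?goal" if "i < k" "k < l" "lookup m k < lookup m' k" "lookup m l > 0" "exchange m k l \<le> u" for k l
  proof (rule bexI[of _ "exchange m k l"])
    have gt: "m < exchange m k l" using exchange_greater that by blast
    then show "exchange m k l \<in> lexseg u v"
      using that mD mdeg_exchange[OF that(4), of k] by (intro lexsegI) auto
    have "lookup (exchange m k l) i = lookup m i" using that by (auto simp: lookup_exchange)
    then show "before_recoverable (exchange m k l) m \<and>
        (\<exists>k' l'. exchange m k l + xv l' = m + xv k' \<and> lookup m k' < lookup m' k')"
      using gt exchange_add[OF that(4)] that(3) by (auto simp: before_recoverable_def)
  qed
  have down: "?goal" if "i < k" "lookup m k < lookup m' k" "lookup m i > 0" "v \<le> exchange m k i" for k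
  proof (rule bexI[of _ "exchange m k i"])
    have "exchange m k i < m" using exchange_less that by blast
    then show "exchange m k i \<in> lexseg u v"
      using that mD mdeg_exchange[OF that(3), of k] by (intro lexsegI) auto
    have "lookup (exchange m k i) i < lookup m i" using that by (auto simp: lookup_exchange)
    then show "before_recoverable (exchange m k i) m \<and>
        (\<exists>k' l'. exchange m k i + xv l' = m + xv k' \<and> lookup m k' < lookup m' k')"
      using exchange_add[OF that(3)] that(2) by (auto simp: before_recoverable_def)
  qed
  show ?goal
  proof (cases "lookup m' i = lookup m i")
    case True
    then have "m < m'" using b by (simp add: before_recoverable_def)
    then obtain k l where kl: "k < l" "\<And>j. j < k \<Longrightarrow> lookup m j = lookup m' j"
      "lookup m k < lookup m' k" "lookup m' l < lookup m l"
      using lex_less_ex_above[OF deg] by blast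
    have "i < k" using kl(3) pre True by (metis linorder_cases less_irrefl)
    show ?thesis
    proof (cases "exchange m k l \<le> u")
      case True
      then show ?thesis using up \<open>i < k\<close> kl by auto
    next
      case False
      then have "v \<le> exchange m k i" "lookup m i = lookup u i"
        using recoverable_exchange[OF assms m \<open>i < k\<close> kl(1)] kl(4) by auto
      then show ?thesis using down \<open>i < k\<close> kl(3) at by simp
    qed
  next
    case False
    then have lt: "lookup m' i < lookup m i" using b by (simp add: before_recoverable_def)
    define K where "K = {k. lookup m k < lookup m' k}"
    have "K \<noteq> {}" using ex_lookup_less[of m' m] deg lt by (force simp: K_def)
    define k where "k = Min K"
    have k: "lookup m k < lookup m' k" using Min_in[of K] \<open>K \<noteq> {}\<close> by (auto simp: k_def K_def)
    have kmin: "lookup m' r \<le> lookup m r" if "r < k" for r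
    proof (rule ccontr)
      assume "\<not> ?thesis"
      then have "k \<le> r" unfolding k_def by (intro Min_le) (auto simp: K_def)
      then show False using that by simp
    qed
    have "i < k" using k lt pre by (metis linorder_cases less_asym less_irrefl)
    have mi: "lookup m i > 0" using lt by simp
    (* If m x_k / x_i falls below v although m' does not, then m' follows m x_k / x_i up to k;
       so it has less than m at some later l, and m can be raised within its level. *)
    show ?thesis
    proof (cases "v \<le> exchange m k i")
      case True
      then show ?thesis using down \<open>i < k\<close> k mi by blast
    next
      case False
      define m1 where "m1 = exchange m k i"
      have "m1 < m'" using False m'D(2) by (simp add: m1_def)
      have m1: "lookup m1 r = (if r = i then lookup m i - 1 else if r = k then lookup m k + 1 else lookup m r)" for r
        using \<open>i < k\<close> by (auto simp: m1_def lookup_exchange)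
      have eq: "lookup m1 r = lookup m' r" if "r < k" for r
      proof -
        obtain k2 where k2: "lookup m1 k2 < lookup m' k2" "\<And>j. j < k2 \<Longrightarrow> lookup m1 j = lookup m' j"
          using \<open>m1 < m'\<close> unfolding less_monomial_iff by blast
        have "lookup m' s \<le> lookup m1 s" if "s < k" for s
          using kmin[OF that] lt that by (auto simp: m1)
        then have "k \<le> k2" using k2(1) by (metis not_le)
        then show ?thesis using k2(2) that by simp
      qed
      have "mdeg m1 = mdeg m'" using mdeg_exchange[OF mi] deg by (simp add: m1_def)
      then obtain l where l: "lookup m' l < lookup m1 l"
        using ex_lookup_less[of m1 m'] \<open>m1 < m'\<close> by auto
      have "lookup m1 k \<le> lookup m' k" using k \<open>i < k\<close> by (auto simp: m1)
      then have "k < l" using l eq by (metis linorder_cases less_irrefl not_le)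
      then have ml: "lookup m l > 0" using l \<open>i < k\<close> by (auto simp: m1 split: if_splits)
      have "exchange m k l \<le> u"
        using recoverable_exchange[OF assms m \<open>i < k\<close> \<open>k < l\<close> ml] False by (meson not_le)
      then show ?thesis using up \<open>i < k\<close> \<open>k < l\<close> k ml by blast
    qed
  qed
qed (auto simp: before_recoverable_def lexsegD finite_lexseg)

text \<open>
  Here the bottom level consists of the monomials that contain one of the variables
  \<open>x\<^sub>i\<^sub>+\<^sub>1,\<dots>,x\<^sub>j\<close>, whatever else they contain.
\<close>

definition exceptional :: "'n \<Rightarrow> bool" where
  "exceptional j \<longleftrightarrow> lookup u i = lookup v i + 1 \<and> i < j \<and> j < last_var \<and> lookup v j = 1 \<and>
     (\<forall>r>i. r \<noteq> j \<longrightarrow> r \<noteq> last_var \<longrightarrow> lookup v r = 0)"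

lemma exceptional_bottom:
  assumes j: "exceptional j" and w: "mdeg w = mdeg u" "\<And>r. r \<le> i \<Longrightarrow> lookup w r = lookup v r"
  shows "v \<le> w \<longleftrightarrow> (\<exists>s. i < s \<and> s \<le> j \<and> lookup w s > 0)"
proof
  assume "v \<le> w"
  show "\<exists>s. i < s \<and> s \<le> j \<and> lookup w s > 0"
  proof (rule ccontr)
    assume none: "\<not> ?thesis"
    have "lookup w r = lookup v r" if "r < j" for r
    proof (cases "r \<le> i")
      case False
      then have "lookup w r = 0" using none that by auto
      moreover have "lookup v r = 0" using j False that by (auto simp: exceptional_def)
      ultimately show ?thesis by simp
    qed (use w in auto)
    moreover have "lookup w j < lookup v j" using none j by (auto simp: exceptional_def)
    ultimately have "w < v" by (rule lex_less_at)
    then show False using \<open>v \<le> w\<close> by simp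
  qed
next
  assume "\<exists>s. i < s \<and> s \<le> j \<and> lookup w s > 0"
  then obtain s where s: "i < s" "s \<le> j" "lookup w s > 0" by blast
  show "v \<le> w"
  proof (rule ccontr)
    assume "\<not> v \<le> w"
    then obtain r where r: "lookup w r < lookup v r" "\<And>t. t < r \<Longrightarrow> lookup w t = lookup v t"
      by (auto simp: less_monomial_iff not_le)
    have "i < r" using r(1) w(2) by (metis linorder_not_le less_irrefl)
    then have "r = j \<or> r = last_var" using r(1) j by (auto simp: exceptional_def)
    moreover have "r \<noteq> last_var"
    proof
      assume "r = last_var"
      then have "lookup w t \<le> lookup v t" for t
        using r le_last_var[of t] by (cases "t = last_var") auto
      then have "mdvd w v" by (simp add: mdvd_def)
      then have "w = v" using w(1) mdeg_eq by (intro mdvd_eq_if_mdeg_le) auto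
      then show False using r(1) by simp
    qed
    ultimately have "r = j" by simp
    then have "lookup w j = 0" using r(1) j by (simp add: exceptional_def)
    then have "s < j" using s by (cases "s = j") auto
    then have "lookup w s = 0" using r(2)[of s] \<open>r = j\<close> s j by (auto simp: exceptional_def)
    then show False using s by simp
  qed
qed

text \<open>
  The bottom level comes first, in decreasing order; the top level follows in increasing order. As
  exchanges within the top level now go downwards, they cannot overshoot \<open>u\<close>.
\<close>

definition before_exceptional :: "'n monomial \<Rightarrow> 'n monomial \<Rightarrow> bool" where
  "before_exceptional m' m \<longleftrightarrow> lookup m' i < lookup m i \<or>
     lookup m' i = lookup m i \<and> (if lookup m i = lookup v i then m < m' else m' < m)"

text \<open>
  Going from the top to the bottom level, \<open>m x\<^sub>k / x\<^sub>i\<close> for the first \<open>k\<close> at which \<open>m'\<close> has more than \<open>m\<close> contains a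
  variable of \<open>x\<^sub>i\<^sub>+\<^sub>1,\<dots>,x\<^sub>j\<close>: either \<open>x\<^sub>k\<close>, or a variable before \<open>x\<^sub>k\<close> that \<open>m\<close> shares with \<open>m'\<close>.
\<close>

lemma exceptional_linear_quotients:
  assumes j: "exceptional j"
  shows "has_linear_quotients (ideal_gen (mon ` lexseg u v) :: ('n, 'k::field) poly_ring set)"
proof (rule linear_quotientsI[where e = "mdeg u" and R = before_exceptional])
  fix m m' assume m: "m \<in> lexseg u v" and m': "m' \<in> lexseg u v" and b: "before_exceptional m' m"
  note mD = lexsegD[OF m] and m'D = lexsegD[OF m']
  have deg: "mdeg m = mdeg m'" using mD m'D by simp
  have pre: "lookup m r = lookup m' r" if "r < i" for r
    using mem_prefix[OF m that] mem_prefix[OF m' that] by simp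
  have val: "lookup m i = lookup v i \<or> lookup m i = lookup v i + 1"
    "lookup m' i = lookup v i \<or> lookup m' i = lookup v i + 1"
    using mem_at[OF m] mem_at[OF m'] j by (auto simp: exceptional_def)
  let ?goal = "\<exists>m''\<in>lexseg u v. before_exceptional m'' m \<and>
    (\<exists>k l. m'' + xv l = m + xv k \<and> lookup m k < lookup m' k)"
  consider (bottom) "lookup m' i = lookup m i" "lookup m i = lookup v i" "m < m'"
    | (top) "lookup m' i = lookup m i" "lookup m i = lookup v i + 1" "m' < m"
    | (mixed) "lookup m' i = lookup v i" "lookup m i = lookup v i + 1"
    using b val by (auto simp: before_exceptional_def)
  then show ?goal
  proof cases
    case bottom
    then obtain k l where kl: "k < l" "\<And>j. j < k \<Longrightarrow> lookup m j = lookup m' j"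
      "lookup m k < lookup m' k" "lookup m' l < lookup m l"
      using lex_less_ex_above[OF deg] by blast
    have "i < k" using kl(3) pre bottom(1) by (metis linorder_cases less_irrefl)
    define q where "q = exchange m k l"
    have ml: "lookup m l > 0" using kl(4) by simp
    have gt: "m < q" using exchange_greater kl(1) ml by (simp add: q_def)
    have qr: "lookup q r = lookup m r" if "r \<le> i" for r
      using that kl(1) \<open>i < k\<close> by (auto simp: q_def lookup_exchange)
    have "q \<le> u" by (rule below_u) (use qr mem_prefix[OF m] bottom at in auto)
    then have "q \<in> lexseg u v"
      using gt mD mdeg_exchange[OF ml, of k] by (intro lexsegI) (auto simp: q_def)
    moreover have "before_exceptional q m"
      using bottom gt qr[of i] by (simp add: before_exceptional_def)
    moreover have "q + xv l = m + xv k" unfolding q_def by (rule exchange_add[OF ml])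
    ultimately show ?thesis using kl(3) by blast
  next
    case top
    then obtain k0 k where kl: "k0 < k" "\<And>j. j < k0 \<Longrightarrow> lookup m' j = lookup m j"
      "lookup m' k0 < lookup m k0" "lookup m k < lookup m' k"
      using lex_less_ex_above[OF deg[symmetric]] by blast
    have "i < k0" using kl(3) pre top(1) by (metis linorder_cases less_irrefl)
    define q where "q = exchange m k k0"
    have ml: "lookup m k0 > 0" using kl(3) by simp
    have lt: "q < m" using exchange_less kl(1) ml by (simp add: q_def)
    have qr: "lookup q r = lookup m r" if "r \<le> i" for r
      using that kl(1) \<open>i < k0\<close> by (auto simp: q_def lookup_exchange)
    have "v \<le> q" by (rule above_v) (use qr mem_prefix[OF m] top in auto)
    then have "q \<in> lexseg u v"
      using lt mD mdeg_exchange[OF ml, of k] by (intro lexsegI) (auto simp: q_def)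
    moreover have "before_exceptional q m"
      using top lt qr[of i] by (simp add: before_exceptional_def)
    moreover have "q + xv k0 = m + xv k" unfolding q_def by (rule exchange_add[OF ml])
    ultimately show ?thesis using kl(4) by blast
  next
    case mixed
    define K where "K = {k. lookup m k < lookup m' k}"
    have "K \<noteq> {}" using ex_lookup_less[of m' m] deg mixed by (force simp: K_def)
    define k where "k = Min K"
    have k: "lookup m k < lookup m' k" using Min_in[of K] \<open>K \<noteq> {}\<close> by (auto simp: k_def K_def)
    have kmin: "lookup m' r \<le> lookup m r" if "r < k" for r
    proof (rule ccontr)
      assume "\<not> ?thesis"
      then have "k \<le> r" unfolding k_def by (intro Min_le) (auto simp: K_def)
      then show False using that by simp
    qed
    have "i < k" using k mixed pre by (metis linorder_cases less_irrefl less_add_one less_asym)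
    have mi: "lookup m i > 0" using mixed by simp
    define q where "q = exchange m k i"
    have q: "lookup q r = (if r = i then lookup m i - 1 else if r = k then lookup m k + 1 else lookup m r)" for r
      using \<open>i < k\<close> by (auto simp: q_def lookup_exchange)
    have lt: "q < m" using exchange_less \<open>i < k\<close> mi by (simp add: q_def)
    have qdeg: "mdeg q = mdeg u" using mdeg_exchange[OF mi] mD by (simp add: q_def)
    have qr: "lookup q r = lookup v r" if "r \<le> i" for r
      using that \<open>i < k\<close> mixed mem_prefix[OF m, of r] prefix[of r] by (auto simp: q)
    have "\<exists>s. i < s \<and> s \<le> j \<and> lookup q s > 0"
    proof (cases "k \<le> j")
      case True
      then show ?thesis using \<open>i < k\<close> by (intro exI[of _ k]) (auto simp: q)
    next
      case False
      have m'v: "lookup m' r = lookup v r" if "r \<le> i" for r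
        using that mixed mem_prefix[OF m', of r] prefix[of r] by (cases "r = i") auto
      obtain s where s: "i < s" "s \<le> j" "lookup m' s > 0"
        using exceptional_bottom[OF j m'D(1) m'v] m'D(2) by auto
      have "s < k" using s False by auto
      then have "lookup q s > 0" using kmin[of s] s by (auto simp: q)
      then show ?thesis using s by blast
    qed
    then have "v \<le> q" using exceptional_bottom[OF j qdeg qr] by simp
    then have "q \<in> lexseg u v" using lt mD qdeg by (intro lexsegI) auto
    moreover have "before_exceptional q m"
      using mixed by (simp add: before_exceptional_def q)
    moreover have "q + xv i = m + xv k" unfolding q_def by (rule exchange_add[OF mi])
    ultimately show ?thesis using k by blast
  qed
qed (auto simp: before_exceptional_def lexsegD finite_lexseg split: if_splits)

end

section \<open>Lexsegments without nonlinear syzygies\<close>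

context lexsegment
begin

lemma mem_if_at_less:
  assumes "mdeg w = mdeg u" "\<And>j. j < i \<Longrightarrow> lookup w j = lookup u j" "lookup w i < lookup u i" "v \<le> w"
  shows "w \<in> lexseg u v"
  using assms below_u by (intro lexsegI) auto

text \<open>The least monomial of the top level.\<close>

lemma ex_mem_pure_tail: "\<exists>w\<in>lexseg u v. \<forall>r. r \<noteq> last_var \<longrightarrow> lookup w r = (if r \<le> i then lookup u r else 0)"
proof -
  define p where "p = Poly_Mapping.mapp (\<lambda>r c. c when r \<le> i) u"
  have p: "lookup p r = (if r \<le> i then lookup u r else 0)" for r
    by (auto simp: p_def lookup_mapp when_def in_keys_iff)
  have "mdvd p u" by (simp add: mdvd_def p)
  then have dp: "mdeg p \<le> mdeg u" by (rule mdeg_mono)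
  define w where "w = p + Poly_Mapping.single last_var (mdeg u - mdeg p)"
  have dw: "mdeg w = mdeg u" using dp by (simp add: w_def mdeg_add mdeg_single)
  have w: "lookup w r = (if r \<le> i then lookup u r else 0)" if "r \<noteq> last_var" for r
    using that by (simp add: w_def lookup_add p lookup_single when_def)
  have "i \<noteq> last_var"
  proof
    assume "i = last_var"
    then have "lookup v r \<le> lookup u r" for r
      using le_last_var[of r] prefix[of r] at by (cases "r = last_var") auto
    then have "v = u" using mdeg_eq by (intro mdvd_eq_if_mdeg_le) (auto simp: mdvd_def)
    then show False using at by simp
  qed
  then have "i < last_var" using le_last_var[of i] by simp
  have wp: "lookup w r = lookup u r" if "r \<le> i" for r
    using w[of r] that \<open>i < last_var\<close> by auto
  have "w \<le> u"
  proof (rule ccontr)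
    assume "\<not> w \<le> u"
    then obtain r where r: "lookup u r < lookup w r" "\<And>t. t < r \<Longrightarrow> lookup u t = lookup w t"
      by (auto simp: less_monomial_iff not_le)
    have "i < r" using r(1) wp by (metis linorder_not_le less_irrefl)
    then have "r = last_var" using r(1) w[of r] by (cases "r = last_var") (auto split: if_splits)
    then have "lookup u t \<le> lookup w t" for t
      using r le_last_var[of t] by (cases "t = last_var") auto
    then have "u = w" using dw by (intro mdvd_eq_if_mdeg_le) (auto simp: mdvd_def)
    then show False using r(1) by simp
  qed
  moreover have "v \<le> w" by (rule above_v) (use wp at in auto)
  ultimately show ?thesis using dw w by (intro bexI[of _ w] lexsegI) auto
qed

text \<open>
  If the segment is not recoverable, there are only two levels, and the obstruction to Koszul-linearity
  is used twice. Let \<open>x\<^sub>j\<close> be the last variable of \<open>v\<close> before \<open>x\<^sub>n\<close>. The first use, with \<open>g = v x\<^sub>n\<^sup>s / x\<^sub>j\<close>, shows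
  that \<open>x\<^sub>i v / x\<^sub>j\<close> is not above \<open>u\<close>. The second use concerns the greatest monomial \<open>q\<close> that violates
  recoverability and the first \<open>x\<^sub>e\<close> such that \<open>g = q x\<^sub>e / x\<^sub>i\<close> is below \<open>v\<close>. It would yield a contradiction if
  \<open>x\<^sub>i g\<close> were in the ideal. That it is not forces \<open>q\<close>, and with it \<open>v / x\<^sub>j\<close>, to
  contain none of \<open>x\<^sub>i\<^sub>+\<^sub>1,\<dots>,x\<^sub>j\<close>, so the segment is exceptional.
\<close>

lemma koszul_linear_imp_recoverable_or_exceptional:
  assumes lin: "koszul_linear_ideal (mdeg u) (ideal_gen (mon ` lexseg u v) :: ('n, 'k::field) poly_ring set)"
    and bad: "\<not> recoverable"
  shows "\<exists>j. exceptional j"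
proof -
  let ?L = "lexseg u v"
  note obstruction = koszul_linear_obstruction[OF lin]
  define F where "F = {q. mdeg q = mdeg u \<and> u < q \<and> (\<forall>r\<le>i. lookup q r = lookup u r) \<and> exchange q last_var i < v}"
  obtain q0 where "q0 \<in> F" using bad by (auto simp: F_def recoverable_def not_le)
  then have "F \<noteq> {}" by auto
  moreover have "finite F"
    by (rule finite_subset[OF _ finite_Mon[of "mdeg u"]]) (auto simp: F_def Mon_def)
  moreover define q where "q = Max F"
  ultimately have "q \<in> F" and qmax: "\<And>p. p \<in> F \<Longrightarrow> p \<le> q" by auto
  then have q: "mdeg q = mdeg u" "u < q" "\<And>r. r \<le> i \<Longrightarrow> lookup q r = lookup u r"
    "exchange q last_var i < v" by (auto simp: F_def)
  have qi: "lookup q i > 0" using q(3) at by auto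
  have "i \<noteq> last_var"
  proof
    assume "i = last_var"
    then have "q = u" using q(3) le_last_var by (intro poly_mapping_eqI) auto
    then show False using q(2) by simp
  qed
  then have il: "i < last_var" using le_last_var[of i] by simp
  define p where "p = exchange q last_var i"
  have p: "lookup p r = (if r = i then lookup u i - 1 else if r = last_var then lookup q r + 1 else lookup q r)" for r
    using il q(3)[of i] by (auto simp: p_def lookup_exchange)
  have pdeg: "mdeg p = mdeg v" using mdeg_exchange[OF qi] q(1) mdeg_eq by (simp add: p_def)
  have pv: "lookup p r = lookup v r" if "r < i" for r
    using that il q(3)[of r] prefix[of r] by (auto simp: p)
  have "lookup p i \<le> lookup v i"
    by (rule lex_le_at[of p v]) (use q(4) pv in \<open>auto simp: p_def\<close>)
  then have ui: "lookup u i = lookup v i + 1" using at by (auto simp: p)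
  obtain r0 where r0: "lookup p r0 < lookup v r0" "\<And>r. r < r0 \<Longrightarrow> lookup p r = lookup v r"
    using q(4) unfolding p_def[symmetric] less_monomial_iff by blast
  have "i < r0"
  proof (rule ccontr)
    assume "\<not> i < r0"
    then have "r0 < i \<or> r0 = i" by auto
    then show False using r0(1) pv[of r0] ui by (auto simp: p)
  qed
  have "r0 \<noteq> last_var"
  proof
    assume "r0 = last_var"
    then have "lookup p t \<le> lookup v t" for t
      using r0 le_last_var[of t] by (cases "t = last_var") auto
    then have "p = v" using pdeg by (intro mdvd_eq_if_mdeg_le) (auto simp: mdvd_def)
    then show False using r0(1) by simp
  qed
  then have "r0 < last_var" using le_last_var[of r0] by simp
  define A where "A = {r. i < r \<and> r < last_var \<and> lookup v r > 0}"
  have r0A: "r0 \<in> A" using r0(1) \<open>i < r0\<close> \<open>r0 < last_var\<close> by (auto simp: A_def)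
  define j where "j = Max A"
  have "A \<noteq> {}" using r0A by auto
  then have "j \<in> A" unfolding j_def by (intro Max_in) auto
  then have j: "i < j" "j < last_var" "lookup v j > 0" by (auto simp: A_def)
  have jmax: "r \<le> j" if "r \<in> A" for r using that by (simp add: j_def)
  have vafter: "lookup v r = 0" if "j < r" "r < last_var" for r
  proof (rule ccontr)
    assume "lookup v r \<noteq> 0"
    then have "r \<in> A" using that j by (auto simp: A_def)
    then show False using jmax[of r] that by simp
  qed
  (* Otherwise let s be minimal such that x_i (v / x_j) x_n^(s + 1) is in the ideal. With
     g = (v / x_j) x_n^(s + 1), all x_a g for a in A are in the ideal, but no x_i g / x_b for b
     outside A is: b = n contradicts the minimality of s, and for b = i it is g itself. *)
  define t where "t = exchange v i j"
  have tr: "lookup t r = (if r = i then lookup u i else if r = j then lookup v j - 1 else lookup v r)" for r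
    using j ui by (auto simp: t_def lookup_exchange)
  have tdeg: "mdeg t = mdeg u" using mdeg_exchange[OF j(3)] mdeg_eq by (simp add: t_def)
  have "t \<le> u"
  proof (rule ccontr)
    assume "\<not> t \<le> u"
    define tail where "tail = (\<lambda>s::nat. Poly_Mapping.single (last_var :: 'n) s)"
    have tail: "lookup (tail s) r = (if r = last_var then s else 0)" for s r
      by (simp add: tail_def lookup_single when_def)
    have mdeg_tail: "mdeg (tail s) = s" for s by (simp add: mdeg_def tail)
    have tailS: "tail (Suc s) = xv last_var + tail s" for s
      by (rule poly_mapping_eqI) (simp add: lookup_add tail lookup_xv)
    define Q where "Q = (\<lambda>s. \<exists>w\<in>?L. mdvd w (t + tail s))"
    have Q0: "\<not> Q 0"
    proof
      assume "Q 0"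
      then obtain w where w: "w \<in> ?L" "mdvd w t" by (auto simp: Q_def tail_def)
      then have "w = t" using tdeg lexsegD(1)[OF w(1)] by (intro mdvd_eq_if_mdeg_le) auto
      then show False using w(1) \<open>\<not> t \<le> u\<close> lexsegD(3) by blast
    qed
    have Qu: "Q (mdeg u)"
    proof -
      obtain w where w: "w \<in> ?L" "\<And>r. r \<noteq> last_var \<Longrightarrow> lookup w r = (if r \<le> i then lookup u r else 0)"
        using ex_mem_pure_tail by blast
      have "lookup w r \<le> lookup (t + tail (mdeg u)) r" for r
      proof (cases "r = last_var")
        case True
        have "lookup w r \<le> mdeg w" unfolding mdeg_def by (rule member_le_sum) auto
        then show ?thesis using True lexsegD(1)[OF w(1)] by (simp add: lookup_add tail)
      next
        case False
        show ?thesis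
          using w(2)[OF False] False j prefix[of r] by (auto simp: lookup_add tail tr)
      qed
      then show ?thesis using w(1) by (auto simp: Q_def mdvd_def)
    qed
    obtain s where s: "\<not> Q s" "Q (Suc s)"
    proof (rule ccontr)
      assume "\<not> thesis"
      then have step: "\<not> Q s \<Longrightarrow> \<not> Q (Suc s)" for s using that by blast
      have "\<not> Q s" for s by (induction s) (use Q0 step in auto)
      then show False using Qu by blast
    qed
    define g where "g = (v - xv j) + tail (Suc s)"
    have vj: "xv j + (v - xv j) = v" using j(3) by (intro add_diff_monomial) (simp add: mdvd_xv)
    have ig: "xv i + g = t + tail (Suc s)"
      by (simp add: g_def t_def exchange_def add_ac)
    have gr: "lookup g r = (if r = j then lookup v j - 1 else if r = last_var then lookup v r + Suc s else lookup v r)" for r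
      using j by (auto simp: g_def lookup_add lookup_minus lookup_xv tail)
    have gdeg: "mdeg u \<le> mdeg g"
      using arg_cong[OF ig, of mdeg] by (simp add: mdeg_add tdeg mdeg_tail)
    have "\<exists>w\<in>?L. mdvd w (xv a + g)" if a: "a \<in> insert i A" for a
    proof (cases "a = i")
      case True
      then show ?thesis using s(2) by (simp add: ig Q_def)
    next
      case False
      then have "a \<in> A" using a by simp
      then have ia: "i < a" "a \<le> j" using jmax by (auto simp: A_def)
      define w where "w = exchange v a j"
      have wr: "lookup w r = lookup v r" if "r \<le> i" for r
        using that ia j by (auto simp: w_def lookup_exchange)
      have "v \<le> w"
      proof (cases "a = j")
        case True
        then show ?thesis using vj by (simp add: w_def exchange_def add.commute)
      next
        case False
        then have "a < j" using ia(2) by simp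
        then show ?thesis using exchange_greater[of a j v] j(3) by (simp add: w_def less_imp_le)
      qed
      moreover have "mdeg w = mdeg u" using mdeg_exchange[OF j(3)] mdeg_eq by (simp add: w_def)
      ultimately have "w \<in> ?L" by (intro mem_if_at_less) (use wr prefix at in auto)
      moreover have "xv a + g = w + tail (Suc s)" by (simp add: w_def exchange_def g_def add_ac)
      ultimately show ?thesis by (auto simp: intro!: bexI[of _ w])
    qed
    then obtain b h where b: "b \<notin> insert i A - {i}" "xv i + g = xv b + h" "\<exists>w\<in>?L. mdvd w h"
      using obstruction[OF gdeg, of "insert i A" i] by blast
    obtain w where w: "w \<in> ?L" "mdvd w h" using b(3) by blast
    have wh: "lookup w r \<le> lookup h r" for r using w(2) by (simp add: mdvd_def)
    have hr: "lookup (xv i + g) r = (if r = b then 1 else 0) + lookup h r" for r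
      by (simp add: b(2) lookup_add lookup_xv)
    consider "b = i" | "b < i" | "b = last_var" | "i < b" "b < last_var"
      using le_last_var[of b] by fastforce
    then show False
    proof cases
      case 1
      then have "h = g" using b(2) by simp
      have "w < v \<or> w = v \<or> v < w" by auto
      moreover have "w \<noteq> v" using wh[of j] \<open>h = g\<close> j by (auto simp: gr)
      ultimately have "v < w" using lexsegD(2)[OF w(1)] by auto
      then obtain r1 where r1: "lookup v r1 < lookup w r1" "\<And>r. r < r1 \<Longrightarrow> lookup v r = lookup w r"
        unfolding less_monomial_iff by blast
      have "r1 = last_var"
        using r1(1) wh[of r1] \<open>h = g\<close> by (auto simp: gr split: if_splits)
      then show False using r1(2)[of j] wh[of j] \<open>h = g\<close> j by (auto simp: gr)
    next
      case 2
      then have "lookup (xv i + g) b = lookup u b"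
        using j il prefix by (auto simp: lookup_add lookup_xv gr)
      then show False using hr[of b] wh[of b] mem_prefix[OF w(1) 2] by simp
    next
      case 3
      have "xv last_var + h = xv last_var + (t + tail s)"
        using b(2) 3 ig tailS[of s] by (simp add: add_ac)
      then have "h = t + tail s" by (simp only: add_left_cancel)
      then show False using s(1) w by (auto simp: Q_def)
    next
      case 4
      then have "lookup v b = 0" using b(1) by (auto simp: A_def)
      then have "lookup (xv i + g) b = 0" using 4 by (auto simp: lookup_add lookup_xv gr)
      then show False using hr[of b] by simp
    qed
  qed
  (* As e is the first index with q x_e / x_i < v, the products x_a (q x_e / x_i) with i < a < e are
     in the ideal; as q is the greatest violation, no variable beyond x_e divides it. *)
  define E where "E = {e. i < e \<and> exchange q e i < v}"
  have lE: "last_var \<in> E" using il q(4) by (simp add: E_def)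
  define e where "e = Min E"
  have "E \<noteq> {}" using lE by auto
  then have "e \<in> E" unfolding e_def by (intro Min_in) auto
  then have e: "i < e" "exchange q e i < v" by (auto simp: E_def)
  have emin: "v \<le> exchange q a i" if "i < a" "a < e" for a
  proof (rule ccontr)
    assume "\<not> ?thesis"
    then have "a \<in> E" using that by (simp add: E_def)
    then have "e \<le> a" by (simp add: e_def)
    then show False using that by simp
  qed
  have qtail: "lookup q f = 0" if "e < f" for f
  proof (rule ccontr)
    assume "lookup q f \<noteq> 0"
    then have qf: "lookup q f > 0" by simp
    define q' where "q' = exchange q e f"
    have gt: "q < q'" using exchange_greater[OF that qf] by (simp add: q'_def)
    have q'r: "lookup q' r = lookup q r" if "r \<le> i" for r
      using that \<open>e < f\<close> e(1) by (auto simp: q'_def lookup_exchange)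
    have q'i: "lookup q' i > 0" using q'r qi by simp
    have "q' + xv last_var + xv f = q + xv e + xv last_var"
      using exchange_add[OF qf, of e] by (simp add: q'_def add_ac)
    also have "\<dots> < v + xv i + xv last_var"
      using e(2) by (simp add: exchange_le_iff(3)[OF qi])
    also have "\<dots> \<le> v + xv i + xv f"
      using le_xv[OF le_last_var, of f] by simp
    finally have "exchange q' last_var i < v"
      by (simp add: exchange_le_iff(3)[OF q'i])
    then have "q' \<in> F"
      using gt q q'r mdeg_exchange[OF qf, of e] by (auto simp: F_def q'_def)
    then show False using qmax gt by (meson not_le)
  qed
  have ei: "xv i + exchange q e i = xv e + q"
    using exchange_add[OF qi, of e] by (simp add: add.commute)
  have not_mem: False if mem: "\<exists>w\<in>?L. mdvd w (xv i + exchange q e i)"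
  proof -
    have gdeg: "mdeg u \<le> mdeg (exchange q e i)" using mdeg_exchange[OF qi] q(1) by simp
    have "\<exists>w\<in>?L. mdvd w (xv a + exchange q e i)" if a: "a \<in> {i..<e}" for a
    proof (cases "a = i")
      case False
      then have ia: "i < a" "a < e" using a by auto
      have "exchange q a i \<in> ?L"
        by (rule mem_if_at_less)
           (use emin[OF ia] mdeg_exchange[OF qi] q(1,3) qi ia in \<open>auto simp: lookup_exchange\<close>)
      moreover have "xv a + exchange q e i = exchange q a i + xv e" by (simp add: exchange_def add_ac)
      ultimately show ?thesis by (intro bexI[of _ "exchange q a i"]) simp_all
    qed (use mem in simp)
    then obtain b h where b: "b \<notin> {i..<e} - {i}" "xv e + q = xv b + h" "\<exists>w\<in>?L. mdvd w h"
      using obstruction[OF gdeg, of "{i..<e}" i] e(1) ei by auto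
    obtain w where w: "w \<in> ?L" "mdvd w h" using b(3) by blast
    have "mdeg h = mdeg u" using arg_cong[OF b(2), of mdeg] q(1) by (simp add: mdeg_add)
    then have "w = h" using w lexsegD(1)[OF w(1)] by (intro mdvd_eq_if_mdeg_le) auto
    then have h: "h \<in> ?L" using w(1) by simp
    have hr: "lookup (xv e + q) r = (if r = b then 1 else 0) + lookup h r" for r
      by (simp add: b(2) lookup_add lookup_xv)
    consider "b = i" | "b < i" | "b = e" | "e < b"
      using b(1) by fastforce
    then show False
    proof cases
      case 1
      then have "h = exchange q e i" using b(2) ei by (metis add_left_cancel)
      then show False using e(2) lexsegD(2)[OF h] by simp
    next
      case 2
      then have "lookup (xv e + q) b = lookup u b"
        using e q(3)[of b] by (auto simp: lookup_add lookup_xv)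
      then show False using hr[of b] mem_prefix[OF h 2] by simp
    next
      case 3
      then have "h = q" using b(2) by simp
      then show False using q(2) lexsegD(3)[OF h] by simp
    next
      case 4
      then have "lookup (xv e + q) b = 0" using qtail by (auto simp: lookup_add lookup_xv)
      then show False using hr[of b] by simp
    qed
  qed
  have qzero: "lookup q r = 0" if r: "i < r" "r \<le> j" for r
  proof (rule ccontr)
    assume "lookup q r \<noteq> 0"
    then have qr: "lookup q r > 0" by simp
    define w where "w = exchange q e r"
    have wr: "lookup w s = lookup u s" if "s \<le> i" for s
      using that r e q(3)[of s] by (auto simp: w_def lookup_exchange)
    have "w + xv r = q + xv e" unfolding w_def by (rule exchange_add[OF qr])
    also have "\<dots> < v + xv i" using e(2) by (simp add: exchange_le_iff(3)[OF qi])
    also have "\<dots> \<le> u + xv j" using \<open>t \<le> u\<close> by (simp add: t_def exchange_le_iff(1)[OF j(3)])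
    also have "\<dots> \<le> u + xv r" using le_xv[OF r(2)] by simp
    finally have "w < u" by simp
    moreover have "v \<le> w" by (rule above_v) (use wr at in auto)
    ultimately have "w \<in> ?L" using mdeg_exchange[OF qr] q(1) by (intro lexsegI) (auto simp: w_def)
    moreover have "xv i + exchange q e i = w + xv r"
      unfolding ei using exchange_add[OF qr, of e] by (simp add: w_def add.commute)
    ultimately show False by (intro not_mem bexI[of _ w]) simp_all
  qed
  have "t < q" using \<open>t \<le> u\<close> q(2) by simp
  then obtain r1 where r1: "lookup t r1 < lookup q r1" "\<And>r. r < r1 \<Longrightarrow> lookup t r = lookup q r"
    unfolding less_monomial_iff by blast
  have "j < r1"
  proof (rule ccontr)
    assume "\<not> j < r1"
    then have "r1 \<le> i" using r1(1) qzero[of r1] by (cases "i < r1") auto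
    then have "lookup t r1 = lookup q r1"
      using q(3)[of r1] prefix[of r1] j(1) by (auto simp: tr)
    then show False using r1(1) by simp
  qed
  have tzero: "lookup t r = 0" if "i < r" "r \<le> j" for r
    using qzero[OF that] r1(2)[of r] \<open>j < r1\<close> that by simp
  have "lookup v j = 1" using tzero[of j] j by (auto simp: tr split: if_splits)
  moreover have "lookup v r = 0" if "i < r" "r \<noteq> j" "r \<noteq> last_var" for r
  proof (cases "r < j")
    case True
    then show ?thesis using tzero[OF that(1)] that by (auto simp: tr less_imp_le split: if_splits)
  next
    case False
    then show ?thesis using vafter[of r] that le_last_var[of r] by auto
  qed
  ultimately show ?thesis using ui j by (auto simp: exceptional_def)
qed

end

section \<open>Componentwise lexsegment ideals\<close>

lemma ex_lexsegment:
  assumes "mdeg v = mdeg u" "v < u"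
  shows "\<exists>i. lexsegment u v i"
  using assms unfolding less_monomial_iff lexsegment_def by auto

lemma singleton_linear_quotients:
  "has_linear_quotients (ideal_gen (mon ` lexseg u u) :: ('n::{finite,linorder}, 'k::field) poly_ring set)"
proof -
  have "lexseg u u = {u}" by (auto simp: lexseg_def Mon_def)
  then show ?thesis
    by (intro linear_quotientsI[where e = "mdeg u" and R = "\<lambda>_ _. False"]) auto
qed

lemma lexseg_koszul_linear_imp_linear_quotients:
  fixes u v :: "'n::{finite,linorder} monomial"
  assumes "mdeg v = mdeg u" "v \<le> u"
    "koszul_linear_ideal (mdeg u) (ideal_gen (mon ` lexseg u v) :: ('n, 'k::field) poly_ring set)"
  shows "has_linear_quotients (ideal_gen (mon ` lexseg u v) :: ('n, 'k) poly_ring set)"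
proof (cases "u = v")
  case True
  then show ?thesis using singleton_linear_quotients by simp
next
  case False
  then have "v < u" using assms(2) by (metis le_neq_trans)
  then obtain i where "lexsegment u v i" using ex_lexsegment[of v u] assms(1) by auto
  then interpret lexsegment u v i .
  show ?thesis
    using koszul_linear_imp_recoverable_or_exceptional[OF assms(3)] recoverable_linear_quotients
      exceptional_linear_quotients by blast
qed

lemma single_Suc: "Poly_Mapping.single a (Suc k) = xv a + Poly_Mapping.single a k"
  by (rule poly_mapping_eqI) (simp add: lookup_add lookup_xv lookup_single when_def)

lemma single_last_le_single_first:
  "Poly_Mapping.single last_var k \<le> (Poly_Mapping.single first_var k :: 'n::{finite,linorder} monomial)"
  by (induction k) (auto simp: single_Suc intro: add_mono le_xv[OF first_var_le])

text \<open>
  For \<open>U = x\<^sub>1\<^sup>k\<^sup>+\<^sup>1 u\<close> and \<open>V = x\<^sub>n\<^sup>k\<^sup>+\<^sup>1 v\<close>, a monomial \<open>q > U\<close> satisfies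
  \<open>q x\<^sub>n / x\<^sub>1 > x\<^sub>1\<^sup>k x\<^sub>n u \<ge> V\<close>, so the segment is recoverable. With a single variable there is only one
  monomial in each degree.
\<close>

lemma lexseg_shift_linear_quotients:
  fixes u v :: "'n::{finite,linorder} monomial"
  assumes deg: "mdeg v = mdeg u" and le: "v \<le> u"
  shows "has_linear_quotients (ideal_gen (mon ` lexseg
    (Poly_Mapping.single first_var (Suc k) + u) (Poly_Mapping.single last_var (Suc k) + v))
      :: ('n, 'k::field) poly_ring set)"
proof -
  define a b :: "'n monomial"
    where "a = Poly_Mapping.single first_var k" and "b = Poly_Mapping.single last_var k"
  define U where "U = xv first_var + a + u"
  define V where "V = xv last_var + b + v"
  have degUV: "mdeg V = mdeg U"
    by (simp add: U_def V_def mdeg_add a_def b_def mdeg_single deg)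
  have "has_linear_quotients (ideal_gen (mon ` lexseg U V) :: ('n, 'k) poly_ring set)"
  proof (cases "first_var = (last_var :: 'n)")
    case True
    then have one: "i = last_var" for i :: 'n
      using first_var_le[of i] le_last_var[of i] by auto
    have "U = V"
    proof (rule ccontr)
      assume "U \<noteq> V"
      then obtain l where l: "lookup U l < lookup V l"
        using ex_lookup_less[of V U] degUV by auto
      obtain l' where "lookup V l' < lookup U l'"
        using ex_lookup_less[of U V] degUV \<open>U \<noteq> V\<close> by auto
      then show False using l one[of l] one[of l'] by simp
    qed
    then show ?thesis using singleton_linear_quotients by simp
  next
    case False
    have "lookup v first_var \<le> lookup u first_var"
      by (rule lex_le_at[OF le]) (use first_var_le in \<open>auto simp: not_less[symmetric]\<close>)
    then have "lookup V first_var < lookup U first_var"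
      using False by (simp add: U_def V_def a_def b_def lookup_add lookup_xv lookup_single when_def)
    then interpret lexsegment U V first_var
      by unfold_locales (use degUV first_var_le in \<open>auto simp: not_less[symmetric]\<close>)
    have recoverable
      unfolding recoverable_def
    proof (intro allI impI)
      fix q assume q: "mdeg q = mdeg U" "U < q" "\<forall>r\<le>first_var. lookup q r = lookup U r"
      have qf: "lookup q first_var > 0" using q(3) at by auto
      have "V + xv first_var = xv last_var + xv first_var + (b + v)" by (simp add: V_def add_ac)
      also have "\<dots> \<le> xv last_var + xv first_var + (a + u)"
        using add_mono[OF single_last_le_single_first[of k, where 'n = 'n] le]
        by (simp add: a_def b_def)
      also have "\<dots> = U + xv last_var" by (simp add: U_def add_ac)
      also have "\<dots> \<le> q + xv last_var" using q(2) by simp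
      finally show "V \<le> exchange q last_var first_var" by (simp add: exchange_le_iff(2)[OF qf])
    qed
    then show ?thesis by (rule recoverable_linear_quotients)
  qed
  then show ?thesis by (simp add: U_def V_def a_def b_def single_Suc)
qed

lemma equigenerated_linear_quotients_imp_linear_resolution:
  fixes A :: "'n::{finite,linorder} monomial set"
  assumes "has_linear_quotients (ideal_gen (mon ` A) :: ('n, 'k::field) poly_ring set)"
    and deg: "\<And>m. m \<in> A \<Longrightarrow> mdeg m = e"
  shows "has_linear_resolution (ideal_gen (mon ` A) :: ('n, 'k) poly_ring set)"
  by (rule koszul_linear_imp_linear_resolution[OF refl, of A e])
     (simp_all add: deg linear_quotients_imp_koszul_linear[OF assms])

lemma lowest_gen_degree_le:
  fixes I :: "('n::finite, 'k::field) poly_ring set"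
  assumes "lowest_gen_degree I d" "mon m \<in> I"
  shows "d \<le> mdeg m"
  using assms(2)
proof (induction "mdeg m" arbitrary: m rule: less_induct)
  case less
  show ?case
  proof (cases "m \<in> min_gens I")
    case True
    then show ?thesis using assms(1) by (simp add: lowest_gen_degree_def)
  next
    case False
    then obtain m' where m': "mon m' \<in> I" "mdvd m' m" "m' \<noteq> m"
      using less.prems by (auto simp: min_gens_def mon_dvd_mon_iff)
    then have "mdeg m' < mdeg m" using mdvd_eq_if_mdeg_le by (meson not_le)
    then show ?thesis using less.hyps m'(1) by fastforce
  qed
qed

lemma mon_mem_lin_span_iff:
  "(mon m :: ('n, 'k::field) poly_ring) \<in> lin_span (mon ` L) \<longleftrightarrow> m \<in> L"
proof
  have "keys f \<subseteq> L" if "f \<in> lin_span (mon ` L)" for f :: "('n, 'k) poly_ring"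
    using that
  proof (induction rule: poly_space.span_induct_alt)
    case base
    then show ?case by simp
  next
    case (step c x y)
    then obtain a where a: "a \<in> L" "x = mon a" by auto
    have "keys (scalar c x) \<subseteq> {a}" by (simp add: scalar_def a(2) mon_def mult_single)
    then show ?case using keys_add[of "scalar c x" y] step(2) a(1) by blast
  qed
  then show "(mon m :: ('n, 'k) poly_ring) \<in> lin_span (mon ` L) \<Longrightarrow> m \<in> L" by force
qed (simp add: poly_space.span_base)

text \<open>
  The monomials of degree at least \<open>d\<close> in the ideal are those of the segments spanning its components, as a
  linear span of monomials contains no others; below the lowest generator degree there are none.
\<close>

lemma componentwise_lexsegment_components:
  fixes I :: "('n::{finite,linorder}, 'k::field) poly_ring set"
  assumes "componentwise_lexsegment I" and low: "lowest_gen_degree I d"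
  obtains u v where "mdeg u = d" "mdeg v = d" "v \<le> u"
    "\<And>j. j < d \<Longrightarrow> component_ideal I j = ideal_gen (mon ` {})"
    "\<And>j. component_ideal I (j + d) = ideal_gen (mon `
      lexseg (Poly_Mapping.single first_var j + u) (Poly_Mapping.single last_var j + v))"
proof -
  obtain d' u v where d': "lowest_gen_degree I d'" and uv: "u \<in> Mon d'" "v \<in> Mon d'"
    and comp: "\<And>j. j \<ge> d' \<Longrightarrow> component I j = lin_span (mon `
      lexseg (Poly_Mapping.single first_var (j - d') + u) (Poly_Mapping.single last_var (j - d') + v))"
    using assms(1) unfolding componentwise_lexsegment_def by blast
  have "d' = d" using d' low unfolding lowest_gen_degree_def by (metis order_antisym)
  have gens: "{m \<in> Mon (j + d). mon m \<in> I} =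
    lexseg (Poly_Mapping.single first_var j + u) (Poly_Mapping.single last_var j + v)" (is "_ = ?L") for j
  proof -
    have "m \<in> Mon (j + d) \<and> mon m \<in> I \<longleftrightarrow> mon m \<in> component I (j + d)" for m
      by (auto simp: component_def homogeneous_def)
    also have "\<dots> m \<longleftrightarrow> m \<in> ?L" for m
      using comp[of "j + d"] \<open>d' = d\<close> by (simp add: mon_mem_lin_span_iff)
    finally show ?thesis by auto
  qed
  show ?thesis
  proof (rule that)
    show "mdeg u = d" "mdeg v = d" using uv \<open>d' = d\<close> by (auto simp: Mon_def)
    obtain m where m: "m \<in> min_gens I" "mdeg m = d" using low by (auto simp: lowest_gen_degree_def)
    then have "m \<in> lexseg u v" using gens[of 0] by (auto simp: min_gens_def Mon_def)
    then show "v \<le> u" by (auto simp: lexseg_def)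
    show "component_ideal I j = ideal_gen (mon ` {})" if "j < d" for j
    proof -
      have "{m \<in> Mon j. mon m \<in> I} = {}"
        using lowest_gen_degree_le[OF low] that by (force simp: Mon_def)
      then show ?thesis by (simp only: component_ideal_def)
    qed
    show "component_ideal I (j + d) = ideal_gen (mon `
      lexseg (Poly_Mapping.single first_var j + u) (Poly_Mapping.single last_var j + v))" for j
      by (simp only: component_ideal_def gens)
  qed
qed

theorem theorem7:
  fixes I :: "('n::{finite,linorder}, 'k::field) poly_ring set"
    and d :: nat
    and u v :: "'n monomial"
  assumes "componentwise_lexsegment I"
    and "d \<ge> 1"
    and "lowest_gen_degree I d"
    and "u \<in> Mon d" and "v \<in> Mon d" and "v \<le> u"
    and "var first_var dvd (mon u :: ('n, 'k) poly_ring)"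
    and "component_ideal I d = ideal_gen (mon ` lexseg u v)"
  shows "(componentwise_linear I \<longleftrightarrow> has_linear_resolution (component_ideal I d)) \<and>
         (has_linear_resolution (component_ideal I d) \<longleftrightarrow>
            has_linear_quotients (component_ideal I d)) \<and>
         (has_linear_quotients (component_ideal I d) \<longleftrightarrow> componentwise_linear_quotients I)"
proof -
  obtain u' v' :: "'n monomial" where deg: "mdeg u' = d" "mdeg v' = d" and le: "v' \<le> u'"
    and small: "\<And>j. j < d \<Longrightarrow> component_ideal I j = ideal_gen (mon ` {})"
    and large: "\<And>j. component_ideal I (j + d) = ideal_gen (mon `
      lexseg (Poly_Mapping.single first_var j + u') (Poly_Mapping.single last_var j + v'))"
    by (rule componentwise_lexsegment_components[OF assms(1,3)], rule that)
  have Id: "component_ideal I d = ideal_gen (mon ` lexseg u' v')"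
    using large[of 0] by simp
  have quot: "has_linear_quotients (component_ideal I j)" if "j \<noteq> d" for j
  proof (cases "j < d")
    case True
    then show ?thesis
      unfolding small[OF True] by (intro linear_quotientsI[where R = "\<lambda>_ _. False"]) auto
  next
    case False
    define k where "k = j - d - 1"
    have "j = Suc k + d" using False that by (simp add: k_def)
    then show ?thesis
      using lexseg_shift_linear_quotients[of v' u' k, where 'k = 'k] deg le large[of "Suc k"] by simp
  qed
  have res: "has_linear_resolution (component_ideal I j)" if "has_linear_quotients (component_ideal I j)" for j
    using that unfolding component_ideal_def
    by (rule equigenerated_linear_quotients_imp_linear_resolution[of _ j]) (simp add: Mon_def)
  have "has_linear_quotients (component_ideal I d)" if "has_linear_resolution (component_ideal I d)"
  proof -
    have "u' \<in> lexseg u' v'" using le by (auto simp: lexseg_def Mon_def)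
    then have "(mon u' :: ('n, 'k) poly_ring) \<in> component_ideal I d"
      unfolding Id by (intro ring_module.span_base) simp
    then have "koszul_linear_ideal (mdeg u') (component_ideal I d)"
      using linear_resolution_imp_koszul_linear[OF that] by blast
    then show ?thesis
      unfolding Id using lexseg_koszul_linear_imp_linear_quotients[of v' u'] deg le by simp
  qed
  then show ?thesis
    using res quot unfolding componentwise_linear_def componentwise_linear_quotients_def by metis
qed

end
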